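(* Let $R$ be a $1$-dimensional noetherian Cohen-Macaulay commutative ring. Then there is a bijection between the following: (a) the Serre subcategories of $\mathrm{cm}\,R$; (b) the subsets of the set $\mathrm{Min}\,R$ of minimal prime ideals of $R$.
   Context: All subcategories are full and closed under isomorphisms. $\mathrm{cm}\,R$ is the category of maximal Cohen-Macaulay $R$-modules, i.e. the finitely generated $R$-modules $M$ such that, for every prime $\mathfrak{p}$ of $R$, either $M_{\mathfrak{p}}=0$ or $\mathrm{depth}_{R_{\mathfrak{p}}} M_{\mathfrak{p}}=\dim R_{\mathfrak{p}}$. It is an extension-closed subcategory of the category $\mathrm{mod}\,R$ of finitely generated $R$-modules. Let $\mathcal{X}$ be an extension-closed additive subcategory of an abelian category $\mathcal{A}$. A conflation of $\mathcal{X}$ is an exact sequence $0\to A\to B\to C\to 0$ of $\mathcal{A}$ with $A,B,C\in\mathcal{X}$. A Serre subcategory of $\mathcal{X}$ is an additive subcategory $\mathcal{S}\subseteq\mathcal{X}$ (containing $0$, closed under finite direct sums) such that for every conflation $0\to A\to B\to C\to 0$ of $\mathcal{X}$, $B\in\mathcal{S}$ if and only if both $A\in\mathcal{S}$ and $C\in\mathcal{S}$. *)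

theory Defs
  imports "HOL-Algebra.Algebra" "HOL-Library.Extended_Nat"
begin

section \<open>Modules\<close>

text \<open>
  A record of type \<^typ>\<open>('a, 'b) module\<close> also has the ring fields mult and one.  They play no role
  for a module, and no definition below reads them off a module.
\<close>

definition module_hom ::
    "('a, 'r) ring_scheme \<Rightarrow> ('a, 'b, 'm) module_scheme \<Rightarrow> ('a, 'c, 'n) module_scheme \<Rightarrow> ('b \<Rightarrow> 'c) set"
  where "module_hom R M N =
    {h \<in> hom (add_monoid M) (add_monoid N).
       \<forall>a\<in>carrier R. \<forall>x\<in>carrier M. h (a \<odot>\<^bsub>M\<^esub> x) = a \<odot>\<^bsub>N\<^esub> h x}"

definition module_isomorphic ::
    "('a, 'r) ring_scheme \<Rightarrow> ('a, 'b, 'm) module_scheme \<Rightarrow> ('a, 'c, 'n) module_scheme \<Rightarrow> bool"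
  where "module_isomorphic R M N \<longleftrightarrow>
    (\<exists>h\<in>module_hom R M N. bij_betw h (carrier M) (carrier N))"

definition direct_sum ::
    "('a, 'b, 'm) module_scheme \<Rightarrow> ('a, 'c, 'n) module_scheme \<Rightarrow> ('a, 'b \<times> 'c) module"
  where "direct_sum M N =
    \<lparr>carrier = carrier M \<times> carrier N, monoid.mult = undefined, one = undefined,
     ring.zero = (\<zero>\<^bsub>M\<^esub>, \<zero>\<^bsub>N\<^esub>),
     ring.add = (\<lambda>(x, y) (x', y'). (x \<oplus>\<^bsub>M\<^esub> x', y \<oplus>\<^bsub>N\<^esub> y')),
     smult = (\<lambda>a (x, y). (a \<odot>\<^bsub>M\<^esub> x, a \<odot>\<^bsub>N\<^esub> y))\<rparr>"

definition fin_gen_module :: "('a, 'r) ring_scheme \<Rightarrow> ('a, 'b, 'm) module_scheme \<Rightarrow> bool"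
  where "fin_gen_module R M \<longleftrightarrow> module R M \<and>
    (\<exists>B. finite B \<and> B \<subseteq> carrier M \<and>
      carrier M = {\<Oplus>\<^bsub>M\<^esub>b\<in>B. r b \<odot>\<^bsub>M\<^esub> b | r. r \<in> B \<rightarrow> carrier R})"

definition regular_module :: "('a, 'r) ring_scheme \<Rightarrow> ('a, 'a) module"
  where "regular_module R =
    \<lparr>carrier = carrier R, monoid.mult = (\<otimes>\<^bsub>R\<^esub>), one = \<one>\<^bsub>R\<^esub>,
     ring.zero = \<zero>\<^bsub>R\<^esub>, ring.add = (\<oplus>\<^bsub>R\<^esub>), smult = (\<otimes>\<^bsub>R\<^esub>)\<rparr>"


section \<open>Localization\<close>

text \<open>Below, \<open>S\<close> is a multiplicative subset of \<open>R\<close>, and the pair \<open>(x, s)\<close> stands for the fraction \<open>x/s\<close>.\<close>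

definition fraction_rel ::
    "'a set \<Rightarrow> ('a, 'b, 'm) module_scheme \<Rightarrow> (('b \<times> 'a) \<times> ('b \<times> 'a)) set"
  where "fraction_rel S M =
    {((x, s), (y, t)). x \<in> carrier M \<and> s \<in> S \<and> y \<in> carrier M \<and> t \<in> S \<and>
       (\<exists>u\<in>S. u \<odot>\<^bsub>M\<^esub> (t \<odot>\<^bsub>M\<^esub> x) = u \<odot>\<^bsub>M\<^esub> (s \<odot>\<^bsub>M\<^esub> y))}"

definition fraction :: "'a set \<Rightarrow> ('a, 'b, 'm) module_scheme \<Rightarrow> 'b \<Rightarrow> 'a \<Rightarrow> ('b \<times> 'a) set"
  where "fraction S M x s = fraction_rel S M `` {(x, s)}"

definition localize_ring :: "('a, 'r) ring_scheme \<Rightarrow> 'a set \<Rightarrow> ('a \<times> 'a) set ring"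
  where "localize_ring R S =
    \<lparr>carrier = (carrier R \<times> S) // fraction_rel S (regular_module R),
     monoid.mult = (\<lambda>U V. \<Union>(x, s)\<in>U. \<Union>(y, t)\<in>V.
       fraction S (regular_module R) (x \<otimes>\<^bsub>R\<^esub> y) (s \<otimes>\<^bsub>R\<^esub> t)),
     one = fraction S (regular_module R) \<one>\<^bsub>R\<^esub> \<one>\<^bsub>R\<^esub>,
     ring.zero = fraction S (regular_module R) \<zero>\<^bsub>R\<^esub> \<one>\<^bsub>R\<^esub>,
     ring.add = (\<lambda>U V. \<Union>(x, s)\<in>U. \<Union>(y, t)\<in>V.
       fraction S (regular_module R) (t \<otimes>\<^bsub>R\<^esub> x \<oplus>\<^bsub>R\<^esub> s \<otimes>\<^bsub>R\<^esub> y) (s \<otimes>\<^bsub>R\<^esub> t))\<rparr>"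

definition localize_module ::
    "('a, 'r) ring_scheme \<Rightarrow> 'a set \<Rightarrow> ('a, 'b, 'm) module_scheme \<Rightarrow>
      (('a \<times> 'a) set, ('b \<times> 'a) set) module"
  where "localize_module R S M =
    \<lparr>carrier = (carrier M \<times> S) // fraction_rel S M,
     monoid.mult = undefined, one = undefined,
     ring.zero = fraction S M \<zero>\<^bsub>M\<^esub> \<one>\<^bsub>R\<^esub>,
     ring.add = (\<lambda>U V. \<Union>(x, s)\<in>U. \<Union>(y, t)\<in>V.
       fraction S M (t \<odot>\<^bsub>M\<^esub> x \<oplus>\<^bsub>M\<^esub> s \<odot>\<^bsub>M\<^esub> y) (s \<otimes>\<^bsub>R\<^esub> t)),
     smult = (\<lambda>U V. \<Union>(a, s)\<in>U. \<Union>(y, t)\<in>V. fraction S M (a \<odot>\<^bsub>M\<^esub> y) (s \<otimes>\<^bsub>R\<^esub> t))\<rparr>"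

abbreviation local_ring_at :: "('a, 'r) ring_scheme \<Rightarrow> 'a set \<Rightarrow> ('a \<times> 'a) set ring"
  where "local_ring_at R p \<equiv> localize_ring R (carrier R - p)"

abbreviation module_at ::
    "('a, 'r) ring_scheme \<Rightarrow> 'a set \<Rightarrow> ('a, 'b, 'm) module_scheme \<Rightarrow>
      (('a \<times> 'a) set, ('b \<times> 'a) set) module"
  where "module_at R p M \<equiv> localize_module R (carrier R - p) M"

text \<open>The maximal ideal \<open>pR\<^sub>p\<close> of \<open>R\<^sub>p\<close>.\<close>

definition max_ideal_at :: "('a, 'r) ring_scheme \<Rightarrow> 'a set \<Rightarrow> ('a \<times> 'a) set set"
  where "max_ideal_at R p =
    {fraction (carrier R - p) (regular_module R) a s | a s. a \<in> p \<and> s \<in> carrier R - p}"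


section \<open>Dimension and depth\<close>

definition minimal_primes :: "('a, 'r) ring_scheme \<Rightarrow> 'a set set"
  where "minimal_primes R =
    {p. primeideal p R \<and> (\<forall>q. primeideal q R \<longrightarrow> q \<subseteq> p \<longrightarrow> q = p)}"

definition krull_dim :: "('a, 'r) ring_scheme \<Rightarrow> enat"
  where "krull_dim R =
    Sup {enat n | n. \<exists>P :: nat \<Rightarrow> 'a set.
      (\<forall>i\<le>n. primeideal (P i) R) \<and> (\<forall>i<n. P i \<subset> P (Suc i))}"

text \<open>The submodule \<open>(x\<^sub>1, \<dots>, x\<^sub>n) M\<close>.\<close>

definition list_smult :: "('a, 'b, 'm) module_scheme \<Rightarrow> 'a list \<Rightarrow> 'b set"
  where "list_smult M xs =
    {\<Oplus>\<^bsub>M\<^esub>i\<in>{..<length xs}. (xs ! i) \<odot>\<^bsub>M\<^esub> v i | v. v \<in> {..<length xs} \<rightarrow> carrier M}"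

text \<open>
  The first clause says that each \<open>x\<^sub>i\<close> is a nonzerodivisor on \<open>M/(x\<^sub>1, \<dots>, x\<^sub>i\<^sub>-\<^sub>1)M\<close>, the second
  that \<open>M/(x\<^sub>1, \<dots>, x\<^sub>n)M\<close> is nonzero.
\<close>

definition regular_sequence ::
    "('a, 'r) ring_scheme \<Rightarrow> ('a, 'b, 'm) module_scheme \<Rightarrow> 'a list \<Rightarrow> bool"
  where "regular_sequence R M xs \<longleftrightarrow> set xs \<subseteq> carrier R \<and>
    (\<forall>i<length xs. \<forall>v\<in>carrier M.
       (xs ! i) \<odot>\<^bsub>M\<^esub> v \<in> list_smult M (take i xs) \<longrightarrow> v \<in> list_smult M (take i xs)) \<and>
    list_smult M xs \<noteq> carrier M"

definition depth ::
    "('a, 'r) ring_scheme \<Rightarrow> 'a set \<Rightarrow> ('a, 'b, 'm) module_scheme \<Rightarrow> enat"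
  where "depth R I M = Sup {enat (length xs) | xs. regular_sequence R M xs \<and> set xs \<subseteq> I}"

definition cohen_macaulay_ring :: "('a, 'r) ring_scheme \<Rightarrow> bool"
  where "cohen_macaulay_ring R \<longleftrightarrow> cring R \<and> noetherian_ring R \<and>
    (\<forall>p. primeideal p R \<longrightarrow>
      depth (local_ring_at R p) (max_ideal_at R p) (regular_module (local_ring_at R p))
        = krull_dim (local_ring_at R p))"

definition max_cohen_macaulay :: "('a, 'r) ring_scheme \<Rightarrow> ('a, 'b, 'm) module_scheme \<Rightarrow> bool"
  where "max_cohen_macaulay R M \<longleftrightarrow> fin_gen_module R M \<and>
    (\<forall>p. primeideal p R \<longrightarrow>
      carrier (module_at R p M) = {\<zero>\<^bsub>module_at R p M\<^esub>} \<or>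
      depth (local_ring_at R p) (max_ideal_at R p) (module_at R p M)
        = krull_dim (local_ring_at R p))"


section \<open>Subcategories\<close>

text \<open>
  A full subcategory closed under isomorphisms is given by its set of objects.  To have a set, the
  modules over a ring of type \<^typ>\<open>'a ring\<close> are taken with elements in \<^typ>\<open>'a list set\<close>.  This is no
  restriction for finitely generated modules, each of which has an isomorphic copy there:
\<close>

lemma fin_gen_module_copy:
  fixes R :: "('a, 'r) ring_scheme" and M :: "('a, 'b, 'm) module_scheme"
  assumes "fin_gen_module R M"
  shows "\<exists>N :: ('a, 'a list set) module. module R N \<and> module_isomorphic R M N"
proof -
  interpret module R M using assms by (simp add: fin_gen_module_def)
  obtain B where B: "finite B" "B \<subseteq> carrier M"
    "carrier M = {\<Oplus>\<^bsub>M\<^esub>b\<in>B. r b \<odot>\<^bsub>M\<^esub> b | r. r \<in> B \<rightarrow> carrier R}"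
    using assms unfolding fin_gen_module_def by (elim conjE exE)
  obtain gs where gs: "set gs = B" using B(1) finite_list by blast
  define \<phi> where "\<phi> m = {map r gs | r. r \<in> B \<rightarrow> carrier R \<and> (\<Oplus>\<^bsub>M\<^esub>b\<in>B. r b \<odot>\<^bsub>M\<^esub> b) = m}" for m
  have inj: "inj_on \<phi> (carrier M)"
  proof (rule inj_onI)
    fix m n assume m: "m \<in> carrier M" and eq: "\<phi> m = \<phi> n"
    obtain r where r: "r \<in> B \<rightarrow> carrier R" "(\<Oplus>\<^bsub>M\<^esub>b\<in>B. r b \<odot>\<^bsub>M\<^esub> b) = m"
      using m unfolding B(3) by blast
    then have "map r gs \<in> \<phi> m" unfolding \<phi>_def by blast
    then have "map r gs \<in> \<phi> n" using eq by simp
    then obtain r' where r': "map r gs = map r' gs" "r' \<in> B \<rightarrow> carrier R"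
      "(\<Oplus>\<^bsub>M\<^esub>b\<in>B. r' b \<odot>\<^bsub>M\<^esub> b) = n" unfolding \<phi>_def by blast
    have "(\<Oplus>\<^bsub>M\<^esub>b\<in>B. r b \<odot>\<^bsub>M\<^esub> b) = (\<Oplus>\<^bsub>M\<^esub>b\<in>B. r' b \<odot>\<^bsub>M\<^esub> b)"
      using r'(1,2) B(2) gs by (intro M.finsum_cong') (auto simp: Pi_def)
    then show "m = n" using r r' by simp
  qed
  define \<psi> where "\<psi> = inv_into (carrier M) \<phi>"
  have \<psi>: "\<psi> (\<phi> m) = m" if "m \<in> carrier M" for m
    using that inj by (simp add: \<psi>_def)
  define N :: "('a, 'a list set) module" where "N =
    \<lparr>carrier = \<phi> ` carrier M, monoid.mult = undefined, one = undefined, ring.zero = \<phi> \<zero>\<^bsub>M\<^esub>,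
     ring.add = (\<lambda>U V. \<phi> (\<psi> U \<oplus>\<^bsub>M\<^esub> \<psi> V)), smult = (\<lambda>a U. \<phi> (a \<odot>\<^bsub>M\<^esub> \<psi> U))\<rparr>"
  have ops: "\<zero>\<^bsub>N\<^esub> = \<phi> \<zero>\<^bsub>M\<^esub>"
    "\<And>m n. m \<in> carrier M \<Longrightarrow> n \<in> carrier M \<Longrightarrow> \<phi> m \<oplus>\<^bsub>N\<^esub> \<phi> n = \<phi> (m \<oplus>\<^bsub>M\<^esub> n)"
    "\<And>a m. m \<in> carrier M \<Longrightarrow> a \<odot>\<^bsub>N\<^esub> \<phi> m = \<phi> (a \<odot>\<^bsub>M\<^esub> m)"
    by (simp_all add: N_def \<psi>)
  have cN: "carrier N = \<phi> ` carrier M" by (simp add: N_def)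
  have "abelian_group N"
  proof (rule abelian_groupI)
    fix x assume "x \<in> carrier N"
    then obtain m where m: "m \<in> carrier M" "x = \<phi> m" unfolding cN by blast
    then have "\<phi> (\<ominus>\<^bsub>M\<^esub> m) \<oplus>\<^bsub>N\<^esub> x = \<zero>\<^bsub>N\<^esub>"
      by (simp add: ops M.l_neg)
    then show "\<exists>y\<in>carrier N. y \<oplus>\<^bsub>N\<^esub> x = \<zero>\<^bsub>N\<^esub>"
      using m cN M.a_inv_closed by blast
  qed (unfold cN, auto simp: ops M.a_ac)
  then have "module R N"
    by (rule moduleI[OF R.is_cring], unfold cN)
      (auto simp: ops smult_l_distr smult_r_distr smult_assoc1)
  moreover have "\<phi> \<in> module_hom R M N"
    by (simp add: module_hom_def hom_def ops cN)
  moreover have "bij_betw \<phi> (carrier M) (carrier N)"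
    using inj by (simp add: cN bij_betw_def)
  ultimately show ?thesis unfolding module_isomorphic_def by blast
qed

definition cm :: "('a, 'r) ring_scheme \<Rightarrow> ('a, 'a list set) module set"
  where "cm R = {M. max_cohen_macaulay R M}"

definition conflation ::
    "('a, 'r) ring_scheme \<Rightarrow> ('a, 'b) module set \<Rightarrow>
      ('a, 'b) module \<Rightarrow> ('a, 'b) module \<Rightarrow> ('a, 'b) module \<Rightarrow> ('b \<Rightarrow> 'b) \<Rightarrow> ('b \<Rightarrow> 'b) \<Rightarrow> bool"
  where "conflation R E A B C f g \<longleftrightarrow> A \<in> E \<and> B \<in> E \<and> C \<in> E \<and>
    f \<in> module_hom R A B \<and> g \<in> module_hom R B C \<and>
    inj_on f (carrier A) \<and> f ` carrier A = a_kernel B C g \<and> g ` carrier B = carrier C"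

definition additive_subcategory :: "('a, 'r) ring_scheme \<Rightarrow> ('a, 'b) module set \<Rightarrow> bool"
  where "additive_subcategory R S \<longleftrightarrow>
    (\<forall>M\<in>S. module R M) \<and>
    (\<forall>M\<in>S. \<forall>N. module R N \<and> module_isomorphic R M N \<longrightarrow> N \<in> S) \<and>
    (\<forall>Z. module R Z \<and> carrier Z = {\<zero>\<^bsub>Z\<^esub>} \<longrightarrow> Z \<in> S) \<and>
    (\<forall>M\<in>S. \<forall>N\<in>S. \<forall>L. module R L \<and> module_isomorphic R (direct_sum M N) L \<longrightarrow> L \<in> S)"

definition serre_subcategory ::
    "('a, 'r) ring_scheme \<Rightarrow> ('a, 'b) module set \<Rightarrow> ('a, 'b) module set \<Rightarrow> bool"
  where "serre_subcategory R E S \<longleftrightarrow> S \<subseteq> E \<and> additive_subcategory R S \<and>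
    (\<forall>A B C f g. conflation R E A B C f g \<longrightarrow> (B \<in> S \<longleftrightarrow> A \<in> S \<and> C \<in> S))"

end

theory Submission
  imports Defs
begin

text \<open>
  Over a one-dimensional Cohen-Macaulay ring \<open>R\<close>, a finitely generated module is maximal
  Cohen-Macaulay exactly if all its associated primes are minimal primes of \<open>R\<close>
  (\<open>max_cohen_macaulay_iff_unmixed\<close>): a nonminimal associated prime \<open>p\<close> of \<open>M\<close> forces
  \<open>depth M\<^sub>p = 0\<close>, and if there is none, then an element of \<open>p\<close> that is regular on \<open>R\<^sub>p\<close> is
  regular on \<open>M\<^sub>p\<close>.  In particular \<open>R/p\<close> is maximal Cohen-Macaulay for each minimal prime \<open>p\<close>.  The
  bijection sends a Serre subcategory \<open>S\<close> to the set of minimal primes \<open>p\<close> with \<open>R/p\<close> in \<open>S\<close>; its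
  inverse sends a set \<open>W\<close> of minimal primes to the modules in \<open>cm R\<close> whose support meets the minimal
  primes only in \<open>W\<close>.  These modules form a Serre subcategory because localization is exact.

  What remains is to recover \<open>S\<close> from its set of primes, that is, to show that a module \<open>M\<close> of \<open>cm R\<close>
  lies in \<open>S\<close> if and only if \<open>R/p\<close> lies in \<open>S\<close> for every minimal prime \<open>p\<close> in the support of \<open>M\<close>.

  For the direction from the \<open>R/p\<close> to \<open>M\<close> (\<open>has_copy_in_of_residue_rings\<close>), take a submodule \<open>N\<close> of
  \<open>M\<close> that is maximal among those in \<open>S\<close> with \<open>M/N\<close> in \<open>cm R\<close>.  If \<open>M/N\<close> is nonzero, it has an
  associated prime \<open>p\<close>, which is minimal.  The elements of \<open>M/N\<close> killed by \<open>p\<close> form a nonzero quotient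
  of some \<open>(R/p)\<^sup>n\<close> with kernel in \<open>cm R\<close>, hence a module in \<open>S\<close>, and their preimage in \<open>M\<close>
  contradicts the choice of \<open>N\<close>.

  For the direction from \<open>M\<close> to \<open>R/p\<close> (\<open>residue_ring_has_copy_in_of_supports\<close>), a
  submodule of \<open>M\<close> and a quotient of it, both in \<open>S\<close>, lead to a module \<open>Y\<close> killed by \<open>p\<close>, of which
  some multiple \<open>t Y \<cong> Y\<close> is a nonzero submodule of a copy \<open>Rx\<close> of \<open>R/p\<close>.  So some nonzero submodule of
  \<open>R/p\<close> lies in \<open>S\<close>, and it has to be enlarged to all of \<open>R/p\<close>.  The step is
  \<open>adjoin_simple_has_copy_in\<close>: if \<open>K\<close> is in \<open>S\<close> and \<open>K' \<supset> K\<close> with \<open>K'/K \<cong> R/m\<close>, \<open>m\<close> maximal, then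
  Nakayama gives a surjection \<open>K \<rightarrow> R/m\<close> with some kernel \<open>N\<close>, and the fibre product \<open>E\<close> of \<open>K'\<close> and
  \<open>K\<close> over \<open>R/m\<close> has two conflations, \<open>0 \<rightarrow> K \<rightarrow> E \<rightarrow> K \<rightarrow> 0\<close> and \<open>0 \<rightarrow> N \<rightarrow> E \<rightarrow> K' \<rightarrow> 0\<close>.  The first
  puts \<open>E\<close> into \<open>S\<close>, the second then \<open>K'\<close>.
\<close>

section \<open>Submodules of finitely generated modules\<close>

lemma (in module) submodule_zero: "submodule N R M \<Longrightarrow> \<zero>\<^bsub>M\<^esub> \<in> N"
  using subgroup.one_closed[OF submodule.axioms(1)] by fastforce

lemma (in module) submodule_subset: "submodule N R M \<Longrightarrow> N \<subseteq> carrier M"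
  by (rule submoduleE(1))

lemma (in module) submodule_mem: "submodule N R M \<Longrightarrow> x \<in> N \<Longrightarrow> x \<in> carrier M"
  using submodule_subset by blast

lemma (in module) submodule_add_iff:
  assumes "submodule N R M" "n \<in> N" "x \<in> carrier M"
  shows "n \<oplus>\<^bsub>M\<^esub> x \<in> N \<longleftrightarrow> x \<in> N" and "x \<oplus>\<^bsub>M\<^esub> n \<in> N \<longleftrightarrow> x \<in> N"
proof -
  have n: "n \<in> carrier M" using submodule_mem assms by blast
  show *: "n \<oplus>\<^bsub>M\<^esub> x \<in> N \<longleftrightarrow> x \<in> N"
  proof
    assume "n \<oplus>\<^bsub>M\<^esub> x \<in> N"
    then have "(\<ominus>\<^bsub>M\<^esub> n) \<oplus>\<^bsub>M\<^esub> (n \<oplus>\<^bsub>M\<^esub> x) \<in> N"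
      using submoduleE(3,5)[OF assms(1)] assms(2) by blast
    then show "x \<in> N" using n assms(3) by (simp add: M.r_neg1)
  qed (use submoduleE(5)[OF assms(1)] assms in blast)
  show "x \<oplus>\<^bsub>M\<^esub> n \<in> N \<longleftrightarrow> x \<in> N"
    using * n assms(3) by (simp add: M.a_comm)
qed

lemma (in module) submoduleI_smult:
  assumes "N \<subseteq> carrier M" "\<zero>\<^bsub>M\<^esub> \<in> N"
    and "\<And>x y. x \<in> N \<Longrightarrow> y \<in> N \<Longrightarrow> x \<oplus>\<^bsub>M\<^esub> y \<in> N"
    and smult: "\<And>a x. a \<in> carrier R \<Longrightarrow> x \<in> N \<Longrightarrow> a \<odot>\<^bsub>M\<^esub> x \<in> N"
  shows "submodule N R M"
proof (rule submoduleI)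
  fix x assume x: "x \<in> N"
  have "(\<ominus> \<one>) \<odot>\<^bsub>M\<^esub> x \<in> N" using smult x by simp
  moreover have "x \<in> carrier M" using x assms(1) by blast
  ultimately show "\<ominus>\<^bsub>M\<^esub> x \<in> N" by (simp add: smult_l_minus)
qed (use assms in auto)

lemma (in module) smult_left_commute:
  "a \<in> carrier R \<Longrightarrow> b \<in> carrier R \<Longrightarrow> x \<in> carrier M \<Longrightarrow>
    a \<odot>\<^bsub>M\<^esub> (b \<odot>\<^bsub>M\<^esub> x) = b \<odot>\<^bsub>M\<^esub> (a \<odot>\<^bsub>M\<^esub> x)"
  by (simp add: smult_assoc1[symmetric] R.m_comm)

lemma (in module) zero_submodule: "submodule {\<zero>\<^bsub>M\<^esub>} R M"
  by (rule submoduleI_smult) auto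

lemma (in module) smult_image_submodule:
  assumes a: "a \<in> carrier R" and N: "submodule N R M"
  shows "submodule ((\<lambda>x. a \<odot>\<^bsub>M\<^esub> x) ` N) R M"
proof (rule submoduleI_smult)
  show "(\<lambda>x. a \<odot>\<^bsub>M\<^esub> x) ` N \<subseteq> carrier M" using submodule_subset[OF N] a by auto
  show "\<zero>\<^bsub>M\<^esub> \<in> (\<lambda>x. a \<odot>\<^bsub>M\<^esub> x) ` N"
    using submodule_zero[OF N] a by (intro image_eqI[of _ _ "\<zero>\<^bsub>M\<^esub>"]) auto
next
  fix u v assume "u \<in> (\<lambda>x. a \<odot>\<^bsub>M\<^esub> x) ` N" "v \<in> (\<lambda>x. a \<odot>\<^bsub>M\<^esub> x) ` N"
  then obtain x y where "x \<in> N" "y \<in> N" "u = a \<odot>\<^bsub>M\<^esub> x" "v = a \<odot>\<^bsub>M\<^esub> y" by blast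
  then show "u \<oplus>\<^bsub>M\<^esub> v \<in> (\<lambda>x. a \<odot>\<^bsub>M\<^esub> x) ` N"
    using submodule_mem[OF N] submoduleE(5)[OF N] a
    by (intro image_eqI[of _ _ "x \<oplus>\<^bsub>M\<^esub> y"]) (auto simp: smult_r_distr)
next
  fix b u assume b: "b \<in> carrier R" "u \<in> (\<lambda>x. a \<odot>\<^bsub>M\<^esub> x) ` N"
  then obtain x where "x \<in> N" "u = a \<odot>\<^bsub>M\<^esub> x" by blast
  then show "b \<odot>\<^bsub>M\<^esub> u \<in> (\<lambda>x. a \<odot>\<^bsub>M\<^esub> x) ` N"
    using submodule_mem[OF N] submoduleE(4)[OF N] a b
    by (intro image_eqI[of _ _ "b \<odot>\<^bsub>M\<^esub> x"]) (auto simp: smult_left_commute)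
qed

definition adjoin :: "('a, 'r) ring_scheme \<Rightarrow> ('a, 'b, 'm) module_scheme \<Rightarrow> 'b set \<Rightarrow> 'b \<Rightarrow> 'b set"
  where "adjoin R M N x = {n \<oplus>\<^bsub>M\<^esub> r \<odot>\<^bsub>M\<^esub> x | n r. n \<in> N \<and> r \<in> carrier R}"

lemma (in module) adjoin_submodule:
  assumes N: "submodule N R M" and x: "x \<in> carrier M"
  shows "submodule (adjoin R M N x) R M"
proof (rule submoduleI_smult)
  note Nm = submodule_mem[OF N] and NE = submoduleE[OF N]
  show "adjoin R M N x \<subseteq> carrier M" using Nm x by (auto simp: adjoin_def)
  have "\<zero>\<^bsub>M\<^esub> = \<zero>\<^bsub>M\<^esub> \<oplus>\<^bsub>M\<^esub> \<zero> \<odot>\<^bsub>M\<^esub> x" using x by simp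
  then show "\<zero>\<^bsub>M\<^esub> \<in> adjoin R M N x" using submodule_zero[OF N] unfolding adjoin_def by blast
next
  note Nm = submodule_mem[OF N] and NE = submoduleE[OF N]
  fix u v assume "u \<in> adjoin R M N x" "v \<in> adjoin R M N x"
  then obtain n r m s where *: "n \<in> N" "m \<in> N" "r \<in> carrier R" "s \<in> carrier R"
    "u = n \<oplus>\<^bsub>M\<^esub> r \<odot>\<^bsub>M\<^esub> x" "v = m \<oplus>\<^bsub>M\<^esub> s \<odot>\<^bsub>M\<^esub> x" unfolding adjoin_def by blast
  then have "u \<oplus>\<^bsub>M\<^esub> v = (n \<oplus>\<^bsub>M\<^esub> m) \<oplus>\<^bsub>M\<^esub> (r \<oplus> s) \<odot>\<^bsub>M\<^esub> x"
    using x Nm by (simp add: smult_l_distr M.a_ac)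
  then show "u \<oplus>\<^bsub>M\<^esub> v \<in> adjoin R M N x"
    using NE(5) * unfolding adjoin_def by blast
next
  note Nm = submodule_mem[OF N] and NE = submoduleE[OF N]
  fix a u assume a: "a \<in> carrier R" "u \<in> adjoin R M N x"
  then obtain n r where *: "n \<in> N" "r \<in> carrier R"
    "u = n \<oplus>\<^bsub>M\<^esub> r \<odot>\<^bsub>M\<^esub> x" unfolding adjoin_def by blast
  then have "a \<odot>\<^bsub>M\<^esub> u = a \<odot>\<^bsub>M\<^esub> n \<oplus>\<^bsub>M\<^esub> (a \<otimes> r) \<odot>\<^bsub>M\<^esub> x"
    using x Nm a by (simp add: smult_r_distr smult_assoc1)
  then show "a \<odot>\<^bsub>M\<^esub> u \<in> adjoin R M N x"
    using NE(4) * a unfolding adjoin_def by blast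
qed

lemma (in module) adjoin_mem:
  assumes N: "submodule N R M" and x: "x \<in> carrier M"
  shows "x \<in> adjoin R M N x" "N \<subseteq> adjoin R M N x"
    "\<And>r. r \<in> carrier R \<Longrightarrow> r \<odot>\<^bsub>M\<^esub> x \<in> adjoin R M N x"
proof -
  show *: "\<And>r. r \<in> carrier R \<Longrightarrow> r \<odot>\<^bsub>M\<^esub> x \<in> adjoin R M N x"
    using submodule_zero[OF N] x M.l_zero[symmetric] unfolding adjoin_def by blast
  show "x \<in> adjoin R M N x" using *[of \<one>] x by simp
  show "N \<subseteq> adjoin R M N x"
  proof
    fix n assume n: "n \<in> N"
    then have "n = n \<oplus>\<^bsub>M\<^esub> \<zero> \<odot>\<^bsub>M\<^esub> x" using x submodule_mem[OF N] by simp
    then show "n \<in> adjoin R M N x" using n unfolding adjoin_def by blast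
  qed
qed

lemma (in module) adjoin_least:
  assumes "submodule P R M" "N \<subseteq> P" "x \<in> P"
  shows "adjoin R M N x \<subseteq> P"
  using assms submoduleE(4,5)[OF assms(1)] unfolding adjoin_def by blast

definition mspan :: "('a, 'r) ring_scheme \<Rightarrow> ('a, 'b, 'm) module_scheme \<Rightarrow> 'b set \<Rightarrow> 'b set"
  where "mspan R M B = \<Inter>{N. submodule N R M \<and> B \<subseteq> N}"

lemma (in module) mspan_submodule:
  assumes "B \<subseteq> carrier M" shows "submodule (mspan R M B) R M"
proof (rule submoduleI_smult)
  show "mspan R M B \<subseteq> carrier M"
    using carrier_is_submodule assms unfolding mspan_def by blast
qed (auto simp: mspan_def submodule_zero submoduleE)

lemma (in module) mspan_superset: "B \<subseteq> mspan R M B"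
  unfolding mspan_def by blast

lemma (in module) mspan_least: "submodule N R M \<Longrightarrow> B \<subseteq> N \<Longrightarrow> mspan R M B \<subseteq> N"
  unfolding mspan_def by blast

lemma (in module) finsum_mem_submodule:
  assumes N: "submodule N R M" and "finite A" "f \<in> A \<rightarrow> N"
  shows "(\<Oplus>\<^bsub>M\<^esub>i\<in>A. f i) \<in> N"
  using assms(2,3)
proof (induction A)
  case empty then show ?case using submodule_zero[OF N] by simp
next
  case (insert x F)
  then have "f \<in> F \<rightarrow> carrier M" "f x \<in> carrier M" using submodule_mem[OF N] by auto
  then show ?case using insert submoduleE(5)[OF N] by (simp add: Pi_def)
qed

text \<open>
  Finite generation is stated through finite linear combinations; from here on only the description by
  least submodules is used, since inductions and homomorphisms interact with it directly.
\<close>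

lemma (in module) linear_combinations_eq_mspan:
  assumes B: "finite B" "B \<subseteq> carrier M"
  shows "{\<Oplus>\<^bsub>M\<^esub>b\<in>B. r b \<odot>\<^bsub>M\<^esub> b | r. r \<in> B \<rightarrow> carrier R} = mspan R M B" (is "?L = _")
proof
    have "submodule ?L R M"
    proof (rule submoduleI_smult)
      show "?L \<subseteq> carrier M" using B(2) by (auto intro!: M.finsum_closed)
      have "(\<Oplus>\<^bsub>M\<^esub>b\<in>B. \<zero> \<odot>\<^bsub>M\<^esub> b) = (\<Oplus>\<^bsub>M\<^esub>b\<in>B. \<zero>\<^bsub>M\<^esub>)"
        using B(2) by (intro M.finsum_cong') auto
      then have "\<zero>\<^bsub>M\<^esub> = (\<Oplus>\<^bsub>M\<^esub>b\<in>B. (\<lambda>_. \<zero>) b \<odot>\<^bsub>M\<^esub> b)" by simp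
      then show "\<zero>\<^bsub>M\<^esub> \<in> ?L"
        by (intro CollectI exI[of _ "\<lambda>_. \<zero>"]) auto
    next
      fix x y assume "x \<in> ?L" "y \<in> ?L"
      then obtain r s where *: "r \<in> B \<rightarrow> carrier R" "s \<in> B \<rightarrow> carrier R"
        "x = (\<Oplus>\<^bsub>M\<^esub>b\<in>B. r b \<odot>\<^bsub>M\<^esub> b)" "y = (\<Oplus>\<^bsub>M\<^esub>b\<in>B. s b \<odot>\<^bsub>M\<^esub> b)" by blast
      have "x \<oplus>\<^bsub>M\<^esub> y = (\<Oplus>\<^bsub>M\<^esub>b\<in>B. r b \<odot>\<^bsub>M\<^esub> b \<oplus>\<^bsub>M\<^esub> s b \<odot>\<^bsub>M\<^esub> b)"
        unfolding * using *(1,2) B(2) by (intro M.finsum_addf[symmetric]) auto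
      also have "\<dots> = (\<Oplus>\<^bsub>M\<^esub>b\<in>B. (r b \<oplus> s b) \<odot>\<^bsub>M\<^esub> b)"
        using *(1,2) B(2) by (intro M.finsum_cong') (auto simp: smult_l_distr Pi_def subset_eq)
      finally have "x \<oplus>\<^bsub>M\<^esub> y = (\<Oplus>\<^bsub>M\<^esub>b\<in>B. (\<lambda>b. r b \<oplus> s b) b \<odot>\<^bsub>M\<^esub> b)" .
      then show "x \<oplus>\<^bsub>M\<^esub> y \<in> ?L"
        using *(1,2) by (intro CollectI exI[of _ "\<lambda>b. r b \<oplus> s b"]) auto
    next
      fix a x assume a: "a \<in> carrier R" and "x \<in> ?L"
      then obtain r where *: "r \<in> B \<rightarrow> carrier R" "x = (\<Oplus>\<^bsub>M\<^esub>b\<in>B. r b \<odot>\<^bsub>M\<^esub> b)" by blast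
      have "a \<odot>\<^bsub>M\<^esub> x = (\<Oplus>\<^bsub>M\<^esub>b\<in>B. a \<odot>\<^bsub>M\<^esub> (r b \<odot>\<^bsub>M\<^esub> b))"
        unfolding * using *(1) B a by (intro finsum_smult_ldistr) auto
      also have "\<dots> = (\<Oplus>\<^bsub>M\<^esub>b\<in>B. (a \<otimes> r b) \<odot>\<^bsub>M\<^esub> b)"
        using *(1) B(2) a by (intro M.finsum_cong') (auto simp: smult_assoc1 Pi_def subset_eq)
      finally have "a \<odot>\<^bsub>M\<^esub> x = (\<Oplus>\<^bsub>M\<^esub>b\<in>B. (\<lambda>b. a \<otimes> r b) b \<odot>\<^bsub>M\<^esub> b)" .
      then show "a \<odot>\<^bsub>M\<^esub> x \<in> ?L"
        using *(1) a by (intro CollectI exI[of _ "\<lambda>b. a \<otimes> r b"]) auto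
    qed
    moreover have "B \<subseteq> ?L"
    proof
      fix c assume c: "c \<in> B"
      have "(\<Oplus>\<^bsub>M\<^esub>b\<in>B. (if b = c then \<one> else \<zero>) \<odot>\<^bsub>M\<^esub> b)
          = (\<Oplus>\<^bsub>M\<^esub>b\<in>B. if c = b then b else \<zero>\<^bsub>M\<^esub>)"
        using B(2) by (intro M.finsum_cong') (auto simp: subset_eq)
      also have "\<dots> = c"
        using B c by (intro M.add.finprod_singleton) auto
      finally show "c \<in> ?L"
        by (intro CollectI exI[of _ "\<lambda>b. if b = c then \<one> else \<zero>"]) auto
    qed
    ultimately show "mspan R M B \<subseteq> ?L" by (rule mspan_least)
    have "(\<Oplus>\<^bsub>M\<^esub>b\<in>B. r b \<odot>\<^bsub>M\<^esub> b) \<in> mspan R M B" if "r \<in> B \<rightarrow> carrier R" for r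
      using that B submoduleE(4)[OF mspan_submodule[OF B(2)] _ subsetD[OF mspan_superset]]
      by (intro finsum_mem_submodule mspan_submodule) (auto simp: Pi_def)
    then show "?L \<subseteq> mspan R M B" by blast
qed

lemma fin_gen_module_iff_mspan:
  "fin_gen_module R M \<longleftrightarrow>
    module R M \<and> (\<exists>B. finite B \<and> B \<subseteq> carrier M \<and> mspan R M B = carrier M)"
  unfolding fin_gen_module_def
  by (intro conj_cong refl ex_cong1) (auto simp: module.linear_combinations_eq_mspan)

lemma (in module) mspan_insert:
  assumes "B \<subseteq> carrier M" "x \<in> carrier M"
  shows "mspan R M (insert x B) = adjoin R M (mspan R M B) x"
proof
  have B: "submodule (mspan R M B) R M" by (rule mspan_submodule) fact
  show "mspan R M (insert x B) \<subseteq> adjoin R M (mspan R M B) x"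
    using adjoin_mem[OF B assms(2)] mspan_superset[of B]
    by (intro mspan_least adjoin_submodule B assms(2)) auto
  have "submodule (mspan R M (insert x B)) R M" using assms by (intro mspan_submodule) auto
  then show "adjoin R M (mspan R M B) x \<subseteq> mspan R M (insert x B)"
    using mspan_superset[of "insert x B"] by (intro adjoin_least mspan_least) auto
qed

lemma (in module) mspan_empty: "mspan R M {} = {\<zero>\<^bsub>M\<^esub>}"
  using mspan_least[OF zero_submodule, of "{}"] submodule_zero[OF mspan_submodule[of "{}"]] by auto

text \<open>
  This ideal is \<open>((N + P) : x)\<close>.  For \<open>P = 0\<close> it is the ideal \<open>(N : x)\<close>; in general it plays the
  part of the ideal of leading coefficients when generators of \<open>N\<close> are sought in \<open>P + R x\<close>.
\<close>

lemma (in module) coefficient_ideal: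
  assumes N: "submodule N R M" and P: "submodule P R M" and x: "x \<in> carrier M"
  shows "ideal {r \<in> carrier R. \<exists>m\<in>P. m \<oplus>\<^bsub>M\<^esub> r \<odot>\<^bsub>M\<^esub> x \<in> N} R" (is "ideal ?I R")
proof (rule idealI)
  note Nm = submodule_mem[OF N] and NE = submoduleE[OF N]
  note Pm = submodule_mem[OF P] and PE = submoduleE[OF P]
  have smult: "a \<otimes> r \<in> ?I" if ar: "a \<in> carrier R" "r \<in> ?I" for a r
  proof -
    obtain m where m: "m \<in> P" "m \<oplus>\<^bsub>M\<^esub> r \<odot>\<^bsub>M\<^esub> x \<in> N" and r: "r \<in> carrier R" using ar by blast
    have "a \<odot>\<^bsub>M\<^esub> (m \<oplus>\<^bsub>M\<^esub> r \<odot>\<^bsub>M\<^esub> x) = a \<odot>\<^bsub>M\<^esub> m \<oplus>\<^bsub>M\<^esub> (a \<otimes> r) \<odot>\<^bsub>M\<^esub> x"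
      using x Pm m r ar by (simp add: smult_r_distr smult_assoc1)
    then have "a \<odot>\<^bsub>M\<^esub> m \<oplus>\<^bsub>M\<^esub> (a \<otimes> r) \<odot>\<^bsub>M\<^esub> x \<in> N" using NE(4) m ar by metis
    then show ?thesis using PE(4) m r ar by blast
  qed
  show "ring R" by (rule R.ring_axioms)
  show "subgroup ?I (add_monoid R)"
  proof (rule R.add.subgroupI)
    show "?I \<subseteq> carrier R" by auto
    have "\<zero> \<in> ?I"
      using x submodule_zero[OF P] submodule_zero[OF N] by (auto intro!: bexI[of _ "\<zero>\<^bsub>M\<^esub>"])
    then show "?I \<noteq> {}" by blast
    show "\<ominus> a \<in> ?I" if a: "a \<in> ?I" for a
    proof -
      have "(\<ominus> \<one>) \<otimes> a \<in> ?I" by (rule smult) (use a in auto)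
      then show ?thesis using a by (simp add: R.l_minus)
    qed
    show "a \<oplus> b \<in> ?I" if ab: "a \<in> ?I" "b \<in> ?I" for a b
    proof -
      obtain m n where *: "m \<in> P" "m \<oplus>\<^bsub>M\<^esub> a \<odot>\<^bsub>M\<^esub> x \<in> N" "n \<in> P" "n \<oplus>\<^bsub>M\<^esub> b \<odot>\<^bsub>M\<^esub> x \<in> N"
        and c: "a \<in> carrier R" "b \<in> carrier R" using ab by blast
      have "(m \<oplus>\<^bsub>M\<^esub> a \<odot>\<^bsub>M\<^esub> x) \<oplus>\<^bsub>M\<^esub> (n \<oplus>\<^bsub>M\<^esub> b \<odot>\<^bsub>M\<^esub> x) = (m \<oplus>\<^bsub>M\<^esub> n) \<oplus>\<^bsub>M\<^esub> (a \<oplus> b) \<odot>\<^bsub>M\<^esub> x"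
        using * c x Pm by (simp add: smult_l_distr M.a_ac)
      then have "(m \<oplus>\<^bsub>M\<^esub> n) \<oplus>\<^bsub>M\<^esub> (a \<oplus> b) \<odot>\<^bsub>M\<^esub> x \<in> N" using NE(5) * by metis
      then show ?thesis using PE(5) * c by auto
    qed
  qed
  fix a r assume a: "a \<in> ?I" and r: "r \<in> carrier R"
  show *: "r \<otimes> a \<in> ?I" by (rule smult[OF r a])
  have "a \<otimes> r = r \<otimes> a" using a r by (intro R.m_comm) auto
  then show "a \<otimes> r \<in> ?I" using * by (rule ssubst)
qed

text \<open>
  Induction on the generators, as in Hilbert's basis theorem: inside \<open>P + R x\<close>, a submodule \<open>N\<close> is
  generated by \<open>N \<inter> P\<close>, which is covered by the induction hypothesis, and by lifts to \<open>N\<close> of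
  generators of the ideal of coefficients of \<open>x\<close>.
\<close>

lemma (in module) submodule_of_mspan_finitely_generated:
  assumes R: "noetherian_ring R" and "finite B" "B \<subseteq> carrier M"
    and "submodule N R M" "N \<subseteq> mspan R M B"
  shows "\<exists>C. finite C \<and> C \<subseteq> carrier M \<and> N = mspan R M C"
  using assms(2-)
proof (induction B arbitrary: N)
  case empty
  then show ?case using submodule_zero[OF empty(2)] by (intro exI[of _ "{}"]) (auto simp: mspan_empty)
next
  case (insert x B)
  have x: "x \<in> carrier M" and B: "B \<subseteq> carrier M" using insert by auto
  note N = insert.prems(2)
  define P where "P = mspan R M B"
  have P: "submodule P R M" unfolding P_def by (rule mspan_submodule[OF B])
  have NP: "N \<subseteq> adjoin R M P x" using insert.prems(3) mspan_insert[OF B x] P_def by simp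
  have "submodule (N \<inter> P) R M"
    using submodule_zero[OF N] submodule_zero[OF P] submoduleE[OF N] submoduleE[OF P]
    by (intro submoduleI_smult) auto
  then obtain C where C: "finite C" "C \<subseteq> carrier M" "N \<inter> P = mspan R M C"
    using insert.IH[OF B, of "N \<inter> P"] P_def by auto
  define I where "I Q = {r \<in> carrier R. \<exists>m\<in>P. m \<oplus>\<^bsub>M\<^esub> r \<odot>\<^bsub>M\<^esub> x \<in> Q}" for Q
  have I: "ideal (I Q) R" if "submodule Q R M" for Q
    unfolding I_def by (rule coefficient_ideal[OF that P x])
  obtain A where A: "A \<subseteq> carrier R" "finite A" "I N = Idl A"
    using noetherian_ring.finetely_gen[OF R I[OF N]] by blast
  have "A \<subseteq> I N" using R.genideal_self[OF A(1)] A(3) by simp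
  then have "\<forall>a\<in>A. \<exists>y. y \<in> N \<and> (\<exists>m\<in>P. y = m \<oplus>\<^bsub>M\<^esub> a \<odot>\<^bsub>M\<^esub> x)" unfolding I_def by blast
  from bchoice[OF this]
  obtain y where y: "\<forall>a\<in>A. y a \<in> N \<and> (\<exists>m\<in>P. y a = m \<oplus>\<^bsub>M\<^esub> a \<odot>\<^bsub>M\<^esub> x)" ..
  define D where "D = C \<union> y ` A"
  have CN: "C \<subseteq> N" using C(3) mspan_superset[of C] by blast
  have DN: "D \<subseteq> N" unfolding D_def using CN y by blast
  then have Dc: "D \<subseteq> carrier M" using submodule_subset[OF N] by blast
  note D = mspan_submodule[OF Dc]
  \<comment> \<open>Every coefficient of \<open>x\<close> in an element of \<open>N\<close> already occurs in the span of \<open>D\<close>, so an element of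
    \<open>N\<close> differs from one in this span by an element of \<open>N \<inter> P\<close>.\<close>
  have "A \<subseteq> I (mspan R M D)"
  proof
    fix a assume a: "a \<in> A"
    then obtain m where "m \<in> P" "y a = m \<oplus>\<^bsub>M\<^esub> a \<odot>\<^bsub>M\<^esub> x" using y by blast
    moreover have "y a \<in> mspan R M D" using a mspan_superset[of D] unfolding D_def by blast
    ultimately show "a \<in> I (mspan R M D)" using a A(1) unfolding I_def by auto
  qed
  then have IN: "I N \<subseteq> I (mspan R M D)" unfolding A(3) by (rule R.genideal_minimal[OF I[OF D]])
  have "N \<subseteq> mspan R M D"
  proof
    fix n assume n: "n \<in> N"
    then obtain m r where m: "m \<in> P" "r \<in> carrier R" "n = m \<oplus>\<^bsub>M\<^esub> r \<odot>\<^bsub>M\<^esub> x"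
      using NP unfolding adjoin_def by blast
    then have "r \<in> I N" using n unfolding I_def by blast
    then obtain m' where m': "m' \<in> P" "m' \<oplus>\<^bsub>M\<^esub> r \<odot>\<^bsub>M\<^esub> x \<in> mspan R M D" using IN unfolding I_def by blast
    have mc: "m \<in> carrier M" "m' \<in> carrier M" using m m' submodule_mem[OF P] by auto
    have eq: "n = (m \<oplus>\<^bsub>M\<^esub> (\<ominus>\<^bsub>M\<^esub> m')) \<oplus>\<^bsub>M\<^esub> (m' \<oplus>\<^bsub>M\<^esub> r \<odot>\<^bsub>M\<^esub> x)"
      using m mc x by (simp add: M.a_assoc M.r_neg1)
    have "m \<oplus>\<^bsub>M\<^esub> (\<ominus>\<^bsub>M\<^esub> m') \<in> N"
      using n m'(2) mspan_least[OF N DN] submodule_add_iff(2)[OF N, of "m' \<oplus>\<^bsub>M\<^esub> r \<odot>\<^bsub>M\<^esub> x" "m \<oplus>\<^bsub>M\<^esub> (\<ominus>\<^bsub>M\<^esub> m')"]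
        mc eq by auto
    moreover have "m \<oplus>\<^bsub>M\<^esub> (\<ominus>\<^bsub>M\<^esub> m') \<in> P" using m m' submoduleE[OF P] by blast
    ultimately have "m \<oplus>\<^bsub>M\<^esub> (\<ominus>\<^bsub>M\<^esub> m') \<in> mspan R M D"
      using C(3) mspan_least[OF D, of C] mspan_superset[of D] unfolding D_def by blast
    then show "n \<in> mspan R M D" using m'(2) submoduleE(5)[OF D] eq by metis
  qed
  then have "N = mspan R M D" using mspan_least[OF N DN] by blast
  moreover have "finite D" using C(1) A(2) unfolding D_def by simp
  ultimately show ?case using Dc by (intro exI[of _ D]) simp
qed

lemma submodule_finitely_generated:
  assumes "noetherian_ring R" "fin_gen_module R M" "submodule N R M"
  shows "\<exists>C. finite C \<and> C \<subseteq> carrier M \<and> N = mspan R M C"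
proof -
  interpret module R M using assms(2) by (simp add: fin_gen_module_def)
  obtain B where B: "finite B" "B \<subseteq> carrier M" "mspan R M B = carrier M"
    using assms(2) unfolding fin_gen_module_iff_mspan by (elim conjE exE)
  show ?thesis
    by (rule submodule_of_mspan_finitely_generated[OF assms(1) B(1,2) assms(3)])
      (use submodule_subset[OF assms(3)] B(3) in simp)
qed

text \<open>
  The union of a chain is generated by finitely many elements, all of which already lie in one member
  of the chain, so that Zorn's lemma applies.
\<close>

lemma submodule_family_has_maximal:
  assumes R: "noetherian_ring R" and M: "fin_gen_module R M"
    and F: "\<And>N. N \<in> F \<Longrightarrow> submodule N R M" and ne: "F \<noteq> {}"
  shows "\<exists>N\<in>F. \<forall>P\<in>F. N \<subseteq> P \<longrightarrow> P = N"
proof (rule subset_Zorn)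
  interpret module R M using M by (simp add: fin_gen_module_def)
  fix C assume C: "subset.chain F C"
  show "\<exists>U\<in>F. \<forall>V\<in>C. V \<subseteq> U"
  proof (cases "C = {}")
    case True then show ?thesis using ne by blast
  next
    case False
    have CF: "C \<subseteq> F" and lin: "\<And>V W. V \<in> C \<Longrightarrow> W \<in> C \<Longrightarrow> V \<subseteq> W \<or> W \<subseteq> V"
      using C unfolding subset.chain_def by (auto simp: subset_iff)
    note CE = submoduleE[OF F[OF subsetD[OF CF]]]
    have "submodule (\<Union>C) R M"
    proof (rule submoduleI_smult)
      show "\<Union>C \<subseteq> carrier M" using CE(1) by blast
      show "\<zero>\<^bsub>M\<^esub> \<in> \<Union>C" using False submodule_zero[OF F] CF by blast
      show "x \<oplus>\<^bsub>M\<^esub> y \<in> \<Union>C" if xy: "x \<in> \<Union>C" "y \<in> \<Union>C" for x y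
      proof -
        obtain V W where VW: "V \<in> C" "W \<in> C" "x \<in> V" "y \<in> W" using xy by blast
        then show ?thesis using lin[OF VW(1,2)] CE(5)[OF VW(1), of x y] CE(5)[OF VW(2), of x y] by blast
      qed
    qed (use CE(4) in blast)
    then obtain B where B: "finite B" "\<Union>C = mspan R M B"
      using submodule_finitely_generated[OF R M] by blast
    have "\<exists>V\<in>C. D \<subseteq> V" if "finite D" "D \<subseteq> \<Union>C" for D
      using that
    proof (induction D)
      case empty then show ?case using False by blast
    next
      case (insert d D)
      then obtain V W where "V \<in> C" "D \<subseteq> V" "W \<in> C" "d \<in> W" by blast
      then show ?case using lin[of V W] by blast
    qed
    then obtain V where V: "V \<in> C" "B \<subseteq> V" using B mspan_superset[of B] by metis
    then have "\<Union>C \<subseteq> V" unfolding B(2) using CF F by (intro mspan_least) auto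
    then show ?thesis using V CF by blast
  qed
qed

section \<open>Prime ideals as annihilators\<close>

lemma (in noetherian_ring) ideal_family_has_maximal:
  assumes F: "\<And>I. I \<in> F \<Longrightarrow> ideal I R" and ne: "F \<noteq> {}"
  shows "\<exists>I\<in>F. \<forall>J\<in>F. I \<subseteq> J \<longrightarrow> J = I"
proof (rule subset_Zorn)
  fix C assume C: "subset.chain F C"
  show "\<exists>U\<in>F. \<forall>V\<in>C. V \<subseteq> U"
  proof (cases "C = {}")
    case True then show ?thesis using ne by blast
  next
    case False
    have CF: "C \<subseteq> F" using C unfolding subset.chain_def by blast
    have "C \<subseteq> {I. ideal I R}" using F CF by auto
    then have "subset.chain {I. ideal I R} C" using C by (simp add: subset_chain_def)
    then have "\<Union>C \<in> C" using ideal_chain_is_trivial[OF False] by blast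
    then show ?thesis using CF by blast
  qed
qed

text \<open>
  The ideal \<open>(N : x)\<close>, which is the annihilator of the residue class of \<open>x\<close> in \<open>M/N\<close>.  Arguments
  about \<open>M/N\<close> become arguments about pairs of submodules of \<open>M\<close> in this way.
\<close>

definition colon :: "('a, 'r) ring_scheme \<Rightarrow> ('a, 'b, 'm) module_scheme \<Rightarrow> 'b set \<Rightarrow> 'b \<Rightarrow> 'a set"
  where "colon R M N x = {r \<in> carrier R. r \<odot>\<^bsub>M\<^esub> x \<in> N}"

definition annihilator :: "('a, 'r) ring_scheme \<Rightarrow> ('a, 'b, 'm) module_scheme \<Rightarrow> 'b \<Rightarrow> 'a set"
  where "annihilator R M x = {r \<in> carrier R. r \<odot>\<^bsub>M\<^esub> x = \<zero>\<^bsub>M\<^esub>}"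

lemma colon_zero: "colon R M {\<zero>\<^bsub>M\<^esub>} x = annihilator R M x"
  by (simp add: colon_def annihilator_def)

lemma (in module) colon_ideal:
  assumes N: "submodule N R M" and x: "x \<in> carrier M"
  shows "ideal (colon R M N x) R"
proof -
  have "colon R M N x = {r \<in> carrier R. \<exists>m\<in>{\<zero>\<^bsub>M\<^esub>}. m \<oplus>\<^bsub>M\<^esub> r \<odot>\<^bsub>M\<^esub> x \<in> N}"
    using x by (auto simp: colon_def)
  then show ?thesis using coefficient_ideal[OF N zero_submodule x] by simp
qed

lemma (in module) colon_smult_mono:
  assumes N: "submodule N R M" and x: "x \<in> carrier M" and c: "c \<in> carrier R"
  shows "colon R M N x \<subseteq> colon R M N (c \<odot>\<^bsub>M\<^esub> x)"
proof
  fix r assume "r \<in> colon R M N x"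
  then have r: "r \<in> carrier R" "r \<odot>\<^bsub>M\<^esub> x \<in> N" by (auto simp: colon_def)
  then have "c \<odot>\<^bsub>M\<^esub> (r \<odot>\<^bsub>M\<^esub> x) \<in> N" using submoduleE(4)[OF N c] by blast
  then show "r \<in> colon R M N (c \<odot>\<^bsub>M\<^esub> x)" using r x c by (simp add: colon_def smult_left_commute)
qed

text \<open>
  An ideal \<open>(N : y)\<close> that is maximal among those avoiding \<open>U\<close>, with \<open>y\<close> a multiple of \<open>x\<close>, is prime.
  The set \<open>U = {1}\<close> yields an associated prime of \<open>M/N\<close>, the complement of a prime \<open>p\<close> yields one
  inside \<open>p\<close>, and \<open>M = R\<close> yields primes above a given ideal.
\<close>

lemma (in module) prime_colon_exists:
  assumes R: "noetherian_ring R" and N: "submodule N R M" and x: "x \<in> carrier M"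
    and U: "\<one> \<in> U" "U \<subseteq> carrier R" "\<And>a b. a \<in> U \<Longrightarrow> b \<in> U \<Longrightarrow> a \<otimes> b \<in> U"
    and disj: "colon R M N x \<inter> U = {}"
  shows "\<exists>c\<in>carrier R. primeideal (colon R M N (c \<odot>\<^bsub>M\<^esub> x)) R \<and> colon R M N (c \<odot>\<^bsub>M\<^esub> x) \<inter> U = {}"
proof -
  define F where "F = {colon R M N (c \<odot>\<^bsub>M\<^esub> x) | c. c \<in> carrier R \<and> colon R M N (c \<odot>\<^bsub>M\<^esub> x) \<inter> U = {}}"
  have "colon R M N (\<one> \<odot>\<^bsub>M\<^esub> x) \<in> F" using disj x
    unfolding F_def by (intro CollectI exI[of _ \<one>] conjI refl) simp_all
  then have ne: "F \<noteq> {}" by blast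
  have "ideal I R" if "I \<in> F" for I
  proof -
    obtain c where "c \<in> carrier R" "I = colon R M N (c \<odot>\<^bsub>M\<^esub> x)"
      using \<open>I \<in> F\<close> unfolding F_def by (elim CollectE exE conjE)
    then show ?thesis using colon_ideal[OF N] x by simp
  qed
  then have "\<exists>I\<in>F. \<forall>J\<in>F. I \<subseteq> J \<longrightarrow> J = I"
    by (rule noetherian_ring.ideal_family_has_maximal[OF R _ ne])
  then obtain I where I: "I \<in> F" "\<forall>J\<in>F. I \<subseteq> J \<longrightarrow> J = I" by (elim bexE)
  obtain c where c: "c \<in> carrier R" "I = colon R M N (c \<odot>\<^bsub>M\<^esub> x)" "I \<inter> U = {}"
    using I(1) unfolding F_def by blast
  define y where "y = c \<odot>\<^bsub>M\<^esub> x"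
  have y: "y \<in> carrier M" "I = colon R M N y" using c x by (auto simp: y_def)
  have maxy: "colon R M N (d \<odot>\<^bsub>M\<^esub> y) = I"
    if d: "d \<in> carrier R" "colon R M N (d \<odot>\<^bsub>M\<^esub> y) \<inter> U = {}" for d
  proof -
    have "d \<odot>\<^bsub>M\<^esub> y = (d \<otimes> c) \<odot>\<^bsub>M\<^esub> x" using d c x by (simp add: y_def smult_assoc1)
    then have "colon R M N (d \<odot>\<^bsub>M\<^esub> y) \<in> F" using d c unfolding F_def by auto
    then show ?thesis using I(2) colon_smult_mono[OF N y(1) d(1)] y(2) by blast
  qed
  have "primeideal I R"
  proof (rule primeidealI)
    show "ideal I R" using y colon_ideal[OF N] by blast
    show "cring R" by (rule R.is_cring)
    show "carrier R \<noteq> I" using U(1,2) c(3) by blast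
    fix a b assume a: "a \<in> carrier R" and b: "b \<in> carrier R" and ab: "a \<otimes> b \<in> I"
    show "a \<in> I \<or> b \<in> I"
    proof (cases "colon R M N (a \<odot>\<^bsub>M\<^esub> y) \<inter> U = {}")
      case True
      have "b \<odot>\<^bsub>M\<^esub> (a \<odot>\<^bsub>M\<^esub> y) \<in> N"
        using ab a b y by (simp add: colon_def smult_assoc1 smult_left_commute[of b a])
      then have "b \<in> colon R M N (a \<odot>\<^bsub>M\<^esub> y)" using b by (simp add: colon_def)
      then show ?thesis using maxy[OF a True] by blast
    next
      case False
      then obtain s where s: "s \<in> U" "s \<in> carrier R" "s \<odot>\<^bsub>M\<^esub> (a \<odot>\<^bsub>M\<^esub> y) \<in> N" by (auto simp: colon_def)
      have "colon R M N (s \<odot>\<^bsub>M\<^esub> y) \<inter> U = {}"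
      proof -
        have False if u: "u \<in> U" "u \<in> colon R M N (s \<odot>\<^bsub>M\<^esub> y)" for u
        proof -
          have uc: "u \<in> carrier R" using u U by blast
          then have "(u \<otimes> s) \<odot>\<^bsub>M\<^esub> y \<in> N" using u s y by (simp add: colon_def smult_assoc1)
          then have "u \<otimes> s \<in> I" using uc s y by (simp add: colon_def)
          then show False using U(3)[OF u(1) s(1)] c(3) by blast
        qed
        then show ?thesis by blast
      qed
      then have "colon R M N (s \<odot>\<^bsub>M\<^esub> y) = I" by (rule maxy[OF s(2)])
      moreover have "a \<in> colon R M N (s \<odot>\<^bsub>M\<^esub> y)"
        using s a y by (simp add: colon_def smult_left_commute[of a s])
      ultimately show ?thesis by blast
    qed
  qed
  then show ?thesis using c by auto
qed

lemma regular_module_simps [simp]: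
  "carrier (regular_module R) = carrier R" "\<zero>\<^bsub>regular_module R\<^esub> = \<zero>\<^bsub>R\<^esub>"
  "x \<oplus>\<^bsub>regular_module R\<^esub> y = x \<oplus>\<^bsub>R\<^esub> y" "x \<odot>\<^bsub>regular_module R\<^esub> y = x \<otimes>\<^bsub>R\<^esub> y"
  by (simp_all add: regular_module_def)

lemma (in cring) regular_module_is_module: "module R (regular_module R)"
proof (rule moduleI)
  show "abelian_group (regular_module R)"
  proof (rule abelian_groupI)
    fix x assume "x \<in> carrier (regular_module R)"
    then show "\<exists>y\<in>carrier (regular_module R). y \<oplus>\<^bsub>regular_module R\<^esub> x = \<zero>\<^bsub>regular_module R\<^esub>"
      by (auto intro!: bexI[of _ "\<ominus> x"] simp: l_neg)
  qed (auto simp: a_ac)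
qed (auto simp: is_cring m_assoc l_distr r_distr)

lemma (in cring) ideal_is_submodule:
  assumes "ideal I R" shows "submodule I R (regular_module R)"
proof -
  interpret module R "regular_module R" by (rule regular_module_is_module)
  interpret I: ideal I R by fact
  show ?thesis by (rule submoduleI_smult) (auto simp: I.I_l_closed)
qed

lemma (in cring) regular_module_fin_gen: "fin_gen_module R (regular_module R)"
proof -
  interpret rm: module R "regular_module R" by (rule regular_module_is_module)
  have P: "submodule (mspan R (regular_module R) {\<one>}) R (regular_module R)"
    by (rule rm.mspan_submodule) simp
  have "carrier R \<subseteq> mspan R (regular_module R) {\<one>}"
  proof
    fix a assume a: "a \<in> carrier R"
    have "a \<odot>\<^bsub>regular_module R\<^esub> \<one> \<in> mspan R (regular_module R) {\<one>}"
      by (rule rm.submoduleE(4)[OF P a]) (use rm.mspan_superset[of "{\<one>}"] in blast)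
    then show "a \<in> mspan R (regular_module R) {\<one>}" using a by simp
  qed
  then show ?thesis
    unfolding fin_gen_module_iff_mspan using rm.submodule_subset[OF P] rm.module_axioms
    by (intro conjI exI[of _ "{\<one>}"]) auto
qed

lemma (in cring) prime_above_disjoint:
  assumes R: "noetherian_ring R" and J: "ideal J R"
    and U: "\<one> \<in> U" "U \<subseteq> carrier R" "\<And>a b. a \<in> U \<Longrightarrow> b \<in> U \<Longrightarrow> a \<otimes> b \<in> U"
    and disj: "J \<inter> U = {}"
  shows "\<exists>q. primeideal q R \<and> J \<subseteq> q \<and> q \<inter> U = {}"
proof -
  interpret rm: module R "regular_module R" by (rule regular_module_is_module)
  interpret J: ideal J R by fact
  have J1: "colon R (regular_module R) J \<one> = J" by (auto simp: colon_def J.a_Hcarr)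
  have Js: "submodule J R (regular_module R)" by (rule ideal_is_submodule) fact
  obtain c where c: "c \<in> carrier R" "primeideal (colon R (regular_module R) J (c \<otimes> \<one>)) R"
    "colon R (regular_module R) J (c \<otimes> \<one>) \<inter> U = {}"
    using rm.prime_colon_exists[OF R Js _ U, of \<one>] J1 disj by auto
  moreover have "J \<subseteq> colon R (regular_module R) J (c \<otimes> \<one>)"
    using rm.colon_smult_mono[OF Js, of \<one> c] c(1) J1 by simp
  ultimately show ?thesis by blast
qed

lemma (in primeideal) complement_multiplicative:
  "\<one> \<in> carrier R - I" "carrier R - I \<subseteq> carrier R"
  "\<And>a b. a \<in> carrier R - I \<Longrightarrow> b \<in> carrier R - I \<Longrightarrow> a \<otimes> b \<in> carrier R - I"
  using I_notcarr one_imp_carrier I_prime by auto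

text \<open>
  The case in which \<open>U\<close> is the complement of \<open>p\<close>: a prime in the support of \<open>M/N\<close> contains an
  associated prime.
\<close>

lemma (in module) prime_colon_below:
  assumes R: "noetherian_ring R" and N: "submodule N R M" and x: "x \<in> carrier M"
    and p: "primeideal p R" and sub: "colon R M N x \<subseteq> p"
  shows "\<exists>c\<in>carrier R. primeideal (colon R M N (c \<odot>\<^bsub>M\<^esub> x)) R \<and> colon R M N (c \<odot>\<^bsub>M\<^esub> x) \<subseteq> p"
proof -
  have "colon R M N x \<inter> (carrier R - p) = {}" using sub by blast
  from prime_colon_exists[OF R N x primeideal.complement_multiplicative[OF p] this]
  show ?thesis unfolding colon_def by blast
qed

text \<open>
  An associated prime inside a minimal prime is equal to it, so minimal primes in the support of \<open>M/N\<close>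
  are associated.
\<close>

lemma (in module) minimal_prime_is_colon:
  assumes R: "noetherian_ring R" and N: "submodule N R M" and x: "x \<in> carrier M"
    and p: "p \<in> minimal_primes R" and sub: "colon R M N x \<subseteq> p"
  shows "\<exists>c\<in>carrier R. colon R M N (c \<odot>\<^bsub>M\<^esub> x) = p"
  using prime_colon_below[OF R N x _ sub] p unfolding minimal_primes_def by blast

lemma no_prime_chain_of_length_two:
  assumes "krull_dim R = 1" "primeideal p R" "primeideal q R" "primeideal m R" "p \<subset> q" "q \<subset> m"
  shows False
proof -
  define P where "P i = (if i = 0 then p else if i = 1 then q else m)" for i :: nat
  have "(\<forall>i\<le>2. primeideal (P i) R) \<and> (\<forall>i<2. P i \<subset> P (Suc i))"
    using assms(2-) by (auto simp: P_def less_Suc_eq numeral_2_eq_2)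
  then have "enat 2 \<le> krull_dim R" unfolding krull_dim_def by (intro Sup_upper) blast
  then show False using assms(1) by (simp add: one_enat_def)
qed

lemma prime_below_prime_minimal:
  assumes "krull_dim R = 1" "primeideal q R" "primeideal m R" "q \<subset> m"
  shows "q \<in> minimal_primes R"
  using no_prime_chain_of_length_two[OF assms(1) _ assms(2,3) _ assms(4)] assms(2)
  unfolding minimal_primes_def by blast

lemma minimal_primesD: "p \<in> minimal_primes R \<Longrightarrow> primeideal p R"
  by (simp add: minimal_primes_def)

lemma minimal_primes_antichain:
  "p \<in> minimal_primes R \<Longrightarrow> primeideal q R \<Longrightarrow> q \<subseteq> p \<Longrightarrow> q = p"
  by (simp add: minimal_primes_def)

text \<open>
  If \<open>(M/N)\<^sub>m = 0\<close>, the product of the denominators that work for the finitely many generators works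
  for all of \<open>M\<close>.
\<close>

lemma (in module) uniform_multiplier:
  assumes m: "primeideal m R" and M: "fin_gen_module R M" and N: "submodule N R M"
    and loc: "\<And>x. x \<in> carrier M \<Longrightarrow> \<exists>u\<in>carrier R - m. u \<odot>\<^bsub>M\<^esub> x \<in> N"
  shows "\<exists>u\<in>carrier R - m. \<forall>x\<in>carrier M. u \<odot>\<^bsub>M\<^esub> x \<in> N"
proof -
  note U = primeideal.complement_multiplicative[OF m]
  obtain B where B: "finite B" "B \<subseteq> carrier M" "mspan R M B = carrier M"
    using M unfolding fin_gen_module_iff_mspan by (elim conjE exE)
  have "\<exists>u\<in>carrier R - m. \<forall>x\<in>B. u \<odot>\<^bsub>M\<^esub> x \<in> N"
    using B(1,2)
  proof (induction B)
    case empty then show ?case using U(1) by blast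
  next
    case (insert b B)
    then obtain u v where uv: "u \<in> carrier R - m" "\<forall>x\<in>B. u \<odot>\<^bsub>M\<^esub> x \<in> N"
      "v \<in> carrier R - m" "v \<odot>\<^bsub>M\<^esub> b \<in> N" using loc[of b] by blast
    have "(v \<otimes> u) \<odot>\<^bsub>M\<^esub> x \<in> N" if x: "x \<in> insert b B" for x
    proof (cases "x = b")
      case True
      then have "(v \<otimes> u) \<odot>\<^bsub>M\<^esub> x = u \<odot>\<^bsub>M\<^esub> (v \<odot>\<^bsub>M\<^esub> x)"
        using uv insert.prems by (simp add: smult_assoc1 smult_left_commute[of v u])
      then show ?thesis using True uv submoduleE(4)[OF N, of u] by auto
    next
      case False
      then have "(v \<otimes> u) \<odot>\<^bsub>M\<^esub> x = v \<odot>\<^bsub>M\<^esub> (u \<odot>\<^bsub>M\<^esub> x)"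
        using uv x insert.prems by (intro smult_assoc1) auto
      then show ?thesis using False x uv submoduleE(4)[OF N, of v] by auto
    qed
    then show ?case using U(3)[OF uv(3,1)] by blast
  qed
  then obtain u where u: "u \<in> carrier R - m" "\<forall>x\<in>B. u \<odot>\<^bsub>M\<^esub> x \<in> N" by blast
  have "submodule {x \<in> carrier M. u \<odot>\<^bsub>M\<^esub> x \<in> N} R M"
    using u(1) submodule_zero[OF N] submoduleE[OF N]
    by (intro submoduleI_smult) (auto simp: smult_r_distr smult_left_commute[of u])
  then have "mspan R M B \<subseteq> {x \<in> carrier M. u \<odot>\<^bsub>M\<^esub> x \<in> N}" by (rule mspan_least) (use u B in blast)
  then show ?thesis using B(3) u(1) by blast
qed

text \<open>
  A form of Nakayama's lemma that avoids determinants.  Let \<open>N\<close> be maximal among the submodules with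
  \<open>N\<^sub>m \<noteq> M\<^sub>m\<close>.  If \<open>a x\<close> were outside \<open>N\<close> for some \<open>a \<in> m\<close>, maximality would give \<open>u \<notin> m\<close> with
  \<open>u M \<subseteq> N + R a x\<close>.  Applied to \<open>x\<close> itself this reads \<open>(u - r a) x \<in> N\<close> for some \<open>r\<close>, where
  \<open>v = u - r a\<close> is outside \<open>m\<close>.  Then \<open>v u M \<subseteq> N\<close>, contrary to the choice of \<open>N\<close>.
\<close>

lemma (in module) nakayama_submodule:
  assumes R: "noetherian_ring R" and M: "fin_gen_module R M" and m: "primeideal m R"
    and nz: "x0 \<in> carrier M" "annihilator R M x0 \<subseteq> m"
  shows "\<exists>N. submodule N R M \<and>
    (\<forall>u\<in>carrier R - m. \<exists>x\<in>carrier M. u \<odot>\<^bsub>M\<^esub> x \<notin> N) \<and>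
    (\<forall>P. submodule P R M \<longrightarrow> N \<subset> P \<longrightarrow> (\<exists>u\<in>carrier R - m. \<forall>x\<in>carrier M. u \<odot>\<^bsub>M\<^esub> x \<in> P)) \<and>
    (\<forall>a\<in>m. \<forall>x\<in>carrier M. a \<odot>\<^bsub>M\<^esub> x \<in> N)"
proof -
  interpret m: primeideal m R by fact
  define F where "F = {N. submodule N R M \<and> (\<forall>u\<in>carrier R - m. \<exists>x\<in>carrier M. u \<odot>\<^bsub>M\<^esub> x \<notin> N)}"
  have "\<forall>u\<in>carrier R - m. \<exists>x\<in>carrier M. u \<odot>\<^bsub>M\<^esub> x \<notin> {\<zero>\<^bsub>M\<^esub>}"
    using nz unfolding annihilator_def by blast
  then have "{\<zero>\<^bsub>M\<^esub>} \<in> F" unfolding F_def using zero_submodule by blast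
  then have ne: "F \<noteq> {}" by blast
  have "submodule P R M" if "P \<in> F" for P using that by (simp add: F_def)
  then have "\<exists>N\<in>F. \<forall>P\<in>F. N \<subseteq> P \<longrightarrow> P = N"
    by (rule submodule_family_has_maximal[OF R M _ ne])
  then obtain N where N: "N \<in> F" "\<forall>P\<in>F. N \<subseteq> P \<longrightarrow> P = N" by (elim bexE)
  from N(1) have Ns: "submodule N R M" and nfull: "\<forall>u\<in>carrier R - m. \<exists>x\<in>carrier M. u \<odot>\<^bsub>M\<^esub> x \<notin> N"
    unfolding F_def by auto
  have big: "\<exists>u\<in>carrier R - m. \<forall>x\<in>carrier M. u \<odot>\<^bsub>M\<^esub> x \<in> P" if "submodule P R M" "N \<subset> P" for P
  proof (rule ccontr)
    assume "\<not> ?thesis"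
    then have "P \<in> F" using that(1) unfolding F_def by blast
    then show False using N(2) that(2) by blast
  qed
  have "a \<odot>\<^bsub>M\<^esub> x \<in> N" if a: "a \<in> m" and x: "x \<in> carrier M" for a x
  proof (rule ccontr)
    assume ax: "a \<odot>\<^bsub>M\<^esub> x \<notin> N"
    have ac: "a \<in> carrier R" using a by (rule m.a_Hcarr)
    have axc: "a \<odot>\<^bsub>M\<^esub> x \<in> carrier M" using ac x by simp
    have "N \<subset> adjoin R M N (a \<odot>\<^bsub>M\<^esub> x)" using adjoin_mem[OF Ns axc] ax by blast
    from big[OF adjoin_submodule[OF Ns axc] this]
    obtain u where u: "u \<in> carrier R - m" "\<forall>y\<in>carrier M. u \<odot>\<^bsub>M\<^esub> y \<in> adjoin R M N (a \<odot>\<^bsub>M\<^esub> x)" ..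
    have "u \<odot>\<^bsub>M\<^esub> x \<in> adjoin R M N (a \<odot>\<^bsub>M\<^esub> x)" using u x by blast
    then obtain n r where nr: "n \<in> N" "r \<in> carrier R" "u \<odot>\<^bsub>M\<^esub> x = n \<oplus>\<^bsub>M\<^esub> r \<odot>\<^bsub>M\<^esub> (a \<odot>\<^bsub>M\<^esub> x)"
      unfolding adjoin_def by blast
    define v where "v = u \<ominus> r \<otimes> a"
    have uc: "u \<in> carrier R" using u by blast
    have nc: "n \<in> carrier M" using nr submodule_mem[OF Ns] by blast
    have vc: "v \<in> carrier R" using uc nr ac by (simp add: v_def)
    have "v \<notin> m"
    proof
      assume "v \<in> m"
      moreover have "r \<otimes> a \<in> m" using a nr(2) by (rule m.I_l_closed)
      ultimately have "v \<oplus> r \<otimes> a \<in> m" by (rule m.a_closed)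
      moreover have "v \<oplus> r \<otimes> a = u" using uc nr ac by (simp add: v_def a_minus_def R.a_assoc R.l_neg)
      ultimately show False using u by blast
    qed
    have "v \<odot>\<^bsub>M\<^esub> x = u \<odot>\<^bsub>M\<^esub> x \<oplus>\<^bsub>M\<^esub> (\<ominus>\<^bsub>M\<^esub> (r \<odot>\<^bsub>M\<^esub> (a \<odot>\<^bsub>M\<^esub> x)))"
      using uc nr ac x by (simp add: v_def a_minus_def smult_l_distr smult_l_minus smult_assoc1)
    also have "\<dots> = n" unfolding nr(3) using nc nr(2) axc by (simp add: M.a_assoc M.r_neg)
    finally have vx: "v \<odot>\<^bsub>M\<^esub> x \<in> N" using nr by simp
    have "(v \<otimes> u) \<odot>\<^bsub>M\<^esub> y \<in> N" if y: "y \<in> carrier M" for y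
    proof -
      have "u \<odot>\<^bsub>M\<^esub> y \<in> adjoin R M N (a \<odot>\<^bsub>M\<^esub> x)" using u y by blast
      then obtain n' s where ns: "n' \<in> N" "s \<in> carrier R" "u \<odot>\<^bsub>M\<^esub> y = n' \<oplus>\<^bsub>M\<^esub> s \<odot>\<^bsub>M\<^esub> (a \<odot>\<^bsub>M\<^esub> x)"
        unfolding adjoin_def by blast
      have "(v \<otimes> u) \<odot>\<^bsub>M\<^esub> y = v \<odot>\<^bsub>M\<^esub> n' \<oplus>\<^bsub>M\<^esub> v \<odot>\<^bsub>M\<^esub> (s \<odot>\<^bsub>M\<^esub> (a \<odot>\<^bsub>M\<^esub> x))"
        using vc uc y ns axc submodule_mem[OF Ns] by (simp add: smult_assoc1 smult_r_distr)
      also have "v \<odot>\<^bsub>M\<^esub> (s \<odot>\<^bsub>M\<^esub> (a \<odot>\<^bsub>M\<^esub> x)) = s \<odot>\<^bsub>M\<^esub> (a \<odot>\<^bsub>M\<^esub> (v \<odot>\<^bsub>M\<^esub> x))"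
        using vc ns ac x by (simp add: smult_left_commute[of v])
      finally show ?thesis
        using vx vc ns ac submoduleE(4,5)[OF Ns] by simp
    qed
    then show False using nfull m.complement_multiplicative(3)[of v u] \<open>v \<notin> m\<close> vc u by blast
  qed
  then show ?thesis using Ns nfull big by blast
qed

section \<open>Localization\<close>

locale localization = module R M for R (structure) and M (structure) +
  fixes S :: "'a set"
  assumes one_mem: "\<one> \<in> S" and S_subset: "S \<subseteq> carrier R"
    and mult_mem: "a \<in> S \<Longrightarrow> b \<in> S \<Longrightarrow> a \<otimes> b \<in> S"
begin

lemma S_carrier [simp]: "s \<in> S \<Longrightarrow> s \<in> carrier R"
  using S_subset by blast

text \<open>
  The factor \<open>u\<close> in the relation is what makes it transitive when \<open>S\<close> contains zero divisors.
\<close>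

lemma fraction_rel_equiv: "equiv (carrier M \<times> S) (fraction_rel S M)"
proof (rule equivI)
  show "fraction_rel S M \<subseteq> (carrier M \<times> S) \<times> (carrier M \<times> S)"
    by (auto simp: fraction_rel_def)
  show "refl_on (carrier M \<times> S) (fraction_rel S M)"
    using one_mem by (auto simp: refl_on_def fraction_rel_def)
  show "sym (fraction_rel S M)"
    unfolding sym_def fraction_rel_def by (auto intro: sym)
  show "trans (fraction_rel S M)"
  proof (rule transI)
    fix p q r assume pq: "(p, q) \<in> fraction_rel S M" and qr: "(q, r) \<in> fraction_rel S M"
    obtain x s y t z w where pqr: "p = (x, s)" "q = (y, t)" "r = (z, w)" by (metis surj_pair)
    obtain u v where *: "x \<in> carrier M" "s \<in> S" "y \<in> carrier M" "t \<in> S" "z \<in> carrier M" "w \<in> S"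
      "u \<in> S" "u \<odot>\<^bsub>M\<^esub> (t \<odot>\<^bsub>M\<^esub> x) = u \<odot>\<^bsub>M\<^esub> (s \<odot>\<^bsub>M\<^esub> y)"
      "v \<in> S" "v \<odot>\<^bsub>M\<^esub> (w \<odot>\<^bsub>M\<^esub> y) = v \<odot>\<^bsub>M\<^esub> (t \<odot>\<^bsub>M\<^esub> z)"
      using pq qr unfolding pqr fraction_rel_def by auto
    have "(u \<otimes> v \<otimes> t) \<odot>\<^bsub>M\<^esub> (w \<odot>\<^bsub>M\<^esub> x) = (v \<otimes> w) \<odot>\<^bsub>M\<^esub> (u \<odot>\<^bsub>M\<^esub> (t \<odot>\<^bsub>M\<^esub> x))"
      using *(1-7,9) by (simp add: smult_assoc1[symmetric] R.m_ac)
    also have "\<dots> = (u \<otimes> s) \<odot>\<^bsub>M\<^esub> (v \<odot>\<^bsub>M\<^esub> (w \<odot>\<^bsub>M\<^esub> y))"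
      unfolding *(8) using *(1-7,9) by (simp add: smult_assoc1[symmetric] R.m_ac)
    also have "\<dots> = (u \<otimes> v \<otimes> t) \<odot>\<^bsub>M\<^esub> (s \<odot>\<^bsub>M\<^esub> z)"
      unfolding *(10) using *(1-7,9) by (simp add: smult_assoc1[symmetric] R.m_ac)
    finally have "(u \<otimes> v \<otimes> t) \<odot>\<^bsub>M\<^esub> (w \<odot>\<^bsub>M\<^esub> x) = (u \<otimes> v \<otimes> t) \<odot>\<^bsub>M\<^esub> (s \<odot>\<^bsub>M\<^esub> z)" .
    moreover have "u \<otimes> v \<otimes> t \<in> S" using * mult_mem by simp
    ultimately show "(p, r) \<in> fraction_rel S M"
      using * unfolding pqr fraction_rel_def by blast
  qed
qed

lemma fraction_eq_iff:
  assumes "x \<in> carrier M" "s \<in> S" "y \<in> carrier M" "t \<in> S"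
  shows "fraction S M x s = fraction S M y t \<longleftrightarrow>
    (\<exists>u\<in>S. u \<odot>\<^bsub>M\<^esub> (t \<odot>\<^bsub>M\<^esub> x) = u \<odot>\<^bsub>M\<^esub> (s \<odot>\<^bsub>M\<^esub> y))"
proof -
  have "fraction S M x s = fraction S M y t \<longleftrightarrow> ((x, s), (y, t)) \<in> fraction_rel S M"
    unfolding fraction_def using assms by (intro eq_equiv_class_iff[OF fraction_rel_equiv]) auto
  then show ?thesis using assms by (simp add: fraction_rel_def)
qed

lemma fraction_eqI:
  assumes "x \<in> carrier M" "s \<in> S" "y \<in> carrier M" "t \<in> S" "t \<odot>\<^bsub>M\<^esub> x = s \<odot>\<^bsub>M\<^esub> y"
  shows "fraction S M x s = fraction S M y t"
  using assms one_mem by (auto simp: fraction_eq_iff)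

lemma fraction_mem_self: "x \<in> carrier M \<Longrightarrow> s \<in> S \<Longrightarrow> (x, s) \<in> fraction S M x s"
  unfolding fraction_def by (rule equiv_class_self[OF fraction_rel_equiv]) simp

lemma fraction_memD:
  assumes "(y, t) \<in> fraction S M x s"
  shows "y \<in> carrier M" "t \<in> S" "\<exists>u\<in>S. u \<odot>\<^bsub>M\<^esub> (t \<odot>\<^bsub>M\<^esub> x) = u \<odot>\<^bsub>M\<^esub> (s \<odot>\<^bsub>M\<^esub> y)"
  using assms by (auto simp: fraction_def fraction_rel_def)

lemma carrier_localize_module:
  "carrier (localize_module R S M) = {fraction S M x s | x s. x \<in> carrier M \<and> s \<in> S}"
  by (auto simp: localize_module_def quotient_def fraction_def)

lemma fraction_in_carrier:
  "x \<in> carrier M \<Longrightarrow> s \<in> S \<Longrightarrow> fraction S M x s \<in> carrier (localize_module R S M)"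
  unfolding carrier_localize_module by blast

lemma localize_module_zero: "\<zero>\<^bsub>localize_module R S M\<^esub> = fraction S M \<zero>\<^bsub>M\<^esub> \<one>"
  by (simp add: localize_module_def)

lemma fraction_eq_zero_iff:
  assumes "x \<in> carrier M" "s \<in> S"
  shows "fraction S M x s = \<zero>\<^bsub>localize_module R S M\<^esub> \<longleftrightarrow> (\<exists>u\<in>S. u \<odot>\<^bsub>M\<^esub> x = \<zero>\<^bsub>M\<^esub>)"
  using assms one_mem by (simp add: localize_module_zero fraction_eq_iff cong: bex_cong)

lemma add_fraction:
  assumes "x \<in> carrier M" "s \<in> S" "y \<in> carrier M" "t \<in> S"
  shows "fraction S M x s \<oplus>\<^bsub>localize_module R S M\<^esub> fraction S M y t
    = fraction S M (t \<odot>\<^bsub>M\<^esub> x \<oplus>\<^bsub>M\<^esub> s \<odot>\<^bsub>M\<^esub> y) (s \<otimes> t)"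
proof -
  have "fraction S M (t' \<odot>\<^bsub>M\<^esub> x' \<oplus>\<^bsub>M\<^esub> s' \<odot>\<^bsub>M\<^esub> y') (s' \<otimes> t')
      = fraction S M (t \<odot>\<^bsub>M\<^esub> x \<oplus>\<^bsub>M\<^esub> s \<odot>\<^bsub>M\<^esub> y) (s \<otimes> t)"
    if x': "(x', s') \<in> fraction S M x s" and y': "(y', t') \<in> fraction S M y t" for x' s' y' t'
  proof -
    note c = fraction_memD[OF x'] fraction_memD[OF y']
    obtain u v where uv: "u \<in> S" "u \<odot>\<^bsub>M\<^esub> (s' \<odot>\<^bsub>M\<^esub> x) = u \<odot>\<^bsub>M\<^esub> (s \<odot>\<^bsub>M\<^esub> x')"
      "v \<in> S" "v \<odot>\<^bsub>M\<^esub> (t' \<odot>\<^bsub>M\<^esub> y) = v \<odot>\<^bsub>M\<^esub> (t \<odot>\<^bsub>M\<^esub> y')" using c(3,6) by blast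
    have 1: "(u \<otimes> v) \<odot>\<^bsub>M\<^esub> ((s \<otimes> t) \<odot>\<^bsub>M\<^esub> (t' \<odot>\<^bsub>M\<^esub> x')) = (u \<otimes> v) \<odot>\<^bsub>M\<^esub> ((s' \<otimes> t') \<odot>\<^bsub>M\<^esub> (t \<odot>\<^bsub>M\<^esub> x))"
    proof -
      have "(u \<otimes> v) \<odot>\<^bsub>M\<^esub> ((s \<otimes> t) \<odot>\<^bsub>M\<^esub> (t' \<odot>\<^bsub>M\<^esub> x')) = (v \<otimes> t \<otimes> t') \<odot>\<^bsub>M\<^esub> (u \<odot>\<^bsub>M\<^esub> (s \<odot>\<^bsub>M\<^esub> x'))"
        using assms c uv(1,3) by (simp add: smult_assoc1[symmetric] R.m_ac)
      also have "\<dots> = (u \<otimes> v) \<odot>\<^bsub>M\<^esub> ((s' \<otimes> t') \<odot>\<^bsub>M\<^esub> (t \<odot>\<^bsub>M\<^esub> x))"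
        unfolding uv(2)[symmetric] using assms c uv(1,3) by (simp add: smult_assoc1[symmetric] R.m_ac)
      finally show ?thesis .
    qed
    have 2: "(u \<otimes> v) \<odot>\<^bsub>M\<^esub> ((s \<otimes> t) \<odot>\<^bsub>M\<^esub> (s' \<odot>\<^bsub>M\<^esub> y')) = (u \<otimes> v) \<odot>\<^bsub>M\<^esub> ((s' \<otimes> t') \<odot>\<^bsub>M\<^esub> (s \<odot>\<^bsub>M\<^esub> y))"
    proof -
      have "(u \<otimes> v) \<odot>\<^bsub>M\<^esub> ((s \<otimes> t) \<odot>\<^bsub>M\<^esub> (s' \<odot>\<^bsub>M\<^esub> y')) = (u \<otimes> s \<otimes> s') \<odot>\<^bsub>M\<^esub> (v \<odot>\<^bsub>M\<^esub> (t \<odot>\<^bsub>M\<^esub> y'))"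
        using assms c uv(1,3) by (simp add: smult_assoc1[symmetric] R.m_ac)
      also have "\<dots> = (u \<otimes> v) \<odot>\<^bsub>M\<^esub> ((s' \<otimes> t') \<odot>\<^bsub>M\<^esub> (s \<odot>\<^bsub>M\<^esub> y))"
        unfolding uv(4)[symmetric] using assms c uv(1,3) by (simp add: smult_assoc1[symmetric] R.m_ac)
      finally show ?thesis .
    qed
    have "(u \<otimes> v) \<odot>\<^bsub>M\<^esub> ((s \<otimes> t) \<odot>\<^bsub>M\<^esub> (t' \<odot>\<^bsub>M\<^esub> x' \<oplus>\<^bsub>M\<^esub> s' \<odot>\<^bsub>M\<^esub> y'))
        = (u \<otimes> v) \<odot>\<^bsub>M\<^esub> ((s' \<otimes> t') \<odot>\<^bsub>M\<^esub> (t \<odot>\<^bsub>M\<^esub> x \<oplus>\<^bsub>M\<^esub> s \<odot>\<^bsub>M\<^esub> y))"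
      using assms c uv(1,3) 1 2 by (simp add: smult_r_distr)
    then show ?thesis
      using assms c uv(1,3) mult_mem by (subst fraction_eq_iff) auto
  qed
  then have "(\<Union>(x, s)\<in>fraction S M x s. \<Union>(y, t)\<in>fraction S M y t.
      fraction S M (t \<odot>\<^bsub>M\<^esub> x \<oplus>\<^bsub>M\<^esub> s \<odot>\<^bsub>M\<^esub> y) (s \<otimes> t)) = fraction S M (t \<odot>\<^bsub>M\<^esub> x \<oplus>\<^bsub>M\<^esub> s \<odot>\<^bsub>M\<^esub> y) (s \<otimes> t)"
    using fraction_mem_self[OF assms(1,2)] fraction_mem_self[OF assms(3,4)] by fast
  then show ?thesis by (simp add: localize_module_def)
qed

lemma smult_fraction:
  assumes "a \<in> carrier R" "s \<in> S" "y \<in> carrier M" "t \<in> S"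
  shows "fraction S (regular_module R) a s \<odot>\<^bsub>localize_module R S M\<^esub> fraction S M y t
    = fraction S M (a \<odot>\<^bsub>M\<^esub> y) (s \<otimes> t)"
proof -
  have "fraction S M (a' \<odot>\<^bsub>M\<^esub> y') (s' \<otimes> t') = fraction S M (a \<odot>\<^bsub>M\<^esub> y) (s \<otimes> t)"
    if a': "(a', s') \<in> fraction S (regular_module R) a s" and y': "(y', t') \<in> fraction S M y t" for a' s' y' t'
  proof -
    note c = fraction_memD[OF y']
    obtain u v where uv: "u \<in> S" "u \<otimes> (s' \<otimes> a) = u \<otimes> (s \<otimes> a')" "a' \<in> carrier R" "s' \<in> S"
      "v \<in> S" "v \<odot>\<^bsub>M\<^esub> (t' \<odot>\<^bsub>M\<^esub> y) = v \<odot>\<^bsub>M\<^esub> (t \<odot>\<^bsub>M\<^esub> y')"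
      using c(3) a' by (auto simp: fraction_def fraction_rel_def)
    have "(u \<otimes> v) \<odot>\<^bsub>M\<^esub> ((s \<otimes> t) \<odot>\<^bsub>M\<^esub> (a' \<odot>\<^bsub>M\<^esub> y')) = (u \<otimes> (s \<otimes> a')) \<odot>\<^bsub>M\<^esub> (v \<odot>\<^bsub>M\<^esub> (t \<odot>\<^bsub>M\<^esub> y'))"
      using assms c uv(1,3,4,5) by (simp add: smult_assoc1[symmetric] R.m_ac)
    also have "\<dots> = (u \<otimes> v) \<odot>\<^bsub>M\<^esub> ((s' \<otimes> t') \<odot>\<^bsub>M\<^esub> (a \<odot>\<^bsub>M\<^esub> y))"
      unfolding uv(2)[symmetric] uv(6)[symmetric] using assms c uv(1,3,4,5)
      by (simp add: smult_assoc1[symmetric] R.m_ac)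
    finally show ?thesis
      using assms c uv mult_mem by (subst fraction_eq_iff) auto
  qed
  moreover have "(a, s) \<in> fraction S (regular_module R) a s"
    using assms one_mem by (auto simp: fraction_def fraction_rel_def)
  ultimately have "(\<Union>(a, s)\<in>fraction S (regular_module R) a s. \<Union>(y, t)\<in>fraction S M y t.
      fraction S M (a \<odot>\<^bsub>M\<^esub> y) (s \<otimes> t)) = fraction S M (a \<odot>\<^bsub>M\<^esub> y) (s \<otimes> t)"
    using fraction_mem_self[OF assms(3,4)] by fast
  then show ?thesis by (simp add: localize_module_def)
qed

lemma fraction_cancel:
  assumes "x \<in> carrier M" "s \<in> S" "t \<in> S"
  shows "fraction S M (t \<odot>\<^bsub>M\<^esub> x) (t \<otimes> s) = fraction S M x s"
  using assms mult_mem by (intro fraction_eqI) (auto simp: smult_assoc1[symmetric] R.m_comm)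

lemma add_fraction_same:
  assumes "x \<in> carrier M" "y \<in> carrier M" "s \<in> S"
  shows "fraction S M x s \<oplus>\<^bsub>localize_module R S M\<^esub> fraction S M y s = fraction S M (x \<oplus>\<^bsub>M\<^esub> y) s"
  using assms by (simp add: add_fraction smult_r_distr[symmetric] fraction_cancel)

text \<open>
  With a common denominator, the laws of an abelian group are inherited from \<open>M\<close> through
  \<open>x/s + y/s = (x + y)/s\<close>.
\<close>

lemma common_denominator:
  assumes "U \<in> carrier (localize_module R S M)" "V \<in> carrier (localize_module R S M)"
    "W \<in> carrier (localize_module R S M)"
  shows "\<exists>x y z s. x \<in> carrier M \<and> y \<in> carrier M \<and> z \<in> carrier M \<and> s \<in> S \<and>
    U = fraction S M x s \<and> V = fraction S M y s \<and> W = fraction S M z s"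
proof -
  obtain x s y t z r where *: "x \<in> carrier M" "s \<in> S" "y \<in> carrier M" "t \<in> S" "z \<in> carrier M" "r \<in> S"
    "U = fraction S M x s" "V = fraction S M y t" "W = fraction S M z r"
    using assms unfolding carrier_localize_module by blast
  have "U = fraction S M ((t \<otimes> r) \<odot>\<^bsub>M\<^esub> x) ((t \<otimes> r) \<otimes> s)"
    "V = fraction S M ((s \<otimes> r) \<odot>\<^bsub>M\<^esub> y) ((s \<otimes> r) \<otimes> t)"
    "W = fraction S M ((s \<otimes> t) \<odot>\<^bsub>M\<^esub> z) ((s \<otimes> t) \<otimes> r)"
    using * mult_mem by (simp_all add: fraction_cancel)
  moreover have "(s \<otimes> r) \<otimes> t = (t \<otimes> r) \<otimes> s" "(s \<otimes> t) \<otimes> r = (t \<otimes> r) \<otimes> s"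
    using * by (simp_all add: R.m_ac)
  moreover have "(t \<otimes> r) \<otimes> s \<in> S" using * mult_mem by simp
  ultimately show ?thesis using * by (metis S_carrier smult_closed R.m_closed)
qed

lemma localize_module_abelian_group: "abelian_group (localize_module R S M)"
proof (rule abelian_groupI)
  let ?L = "localize_module R S M"
  note zero = localize_module_zero
  show "\<zero>\<^bsub>?L\<^esub> \<in> carrier ?L" using one_mem by (simp add: zero fraction_in_carrier)
  fix U assume U: "U \<in> carrier ?L"
  then obtain x s where x: "x \<in> carrier M" "s \<in> S" "U = fraction S M x s"
    unfolding carrier_localize_module by blast
  have z: "\<zero>\<^bsub>?L\<^esub> = fraction S M \<zero>\<^bsub>M\<^esub> s"
    unfolding zero using x one_mem by (intro fraction_eqI) auto
  show "\<zero>\<^bsub>?L\<^esub> \<oplus>\<^bsub>?L\<^esub> U = U" unfolding z x(3) using x by (simp add: add_fraction_same)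
  have "fraction S M (\<ominus>\<^bsub>M\<^esub> x) s \<oplus>\<^bsub>?L\<^esub> U = \<zero>\<^bsub>?L\<^esub>"
    unfolding z x(3) using x by (simp add: add_fraction_same M.l_neg)
  then show "\<exists>V\<in>carrier ?L. V \<oplus>\<^bsub>?L\<^esub> U = \<zero>\<^bsub>?L\<^esub>"
    using x fraction_in_carrier by (intro bexI) auto
  fix V assume V: "V \<in> carrier ?L"
  obtain x y z s where *: "x \<in> carrier M" "y \<in> carrier M" "z \<in> carrier M" "s \<in> S"
    "U = fraction S M x s" "V = fraction S M y s" using common_denominator[OF U V V] by blast
  show "U \<oplus>\<^bsub>?L\<^esub> V \<in> carrier ?L" using * by (simp add: add_fraction_same fraction_in_carrier)
  show "U \<oplus>\<^bsub>?L\<^esub> V = V \<oplus>\<^bsub>?L\<^esub> U" using * by (simp add: add_fraction_same M.a_comm)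
  fix W assume W: "W \<in> carrier ?L"
  obtain x y z s where "x \<in> carrier M" "y \<in> carrier M" "z \<in> carrier M" "s \<in> S"
    "U = fraction S M x s" "V = fraction S M y s" "W = fraction S M z s"
    using common_denominator[OF U V W] by blast
  then show "U \<oplus>\<^bsub>?L\<^esub> V \<oplus>\<^bsub>?L\<^esub> W = U \<oplus>\<^bsub>?L\<^esub> (V \<oplus>\<^bsub>?L\<^esub> W)"
    by (simp add: add_fraction_same M.a_assoc)
qed

end

text \<open>
  As an additive group, the localized ring is the localization of \<open>R\<close> as a module over itself, and its
  multiplication is the scalar multiplication there.  Facts about fractions in modules thus serve for
  the ring as well.
\<close>

lemma localize_ring_eq_regular:
  "carrier (localize_ring R S) = carrier (localize_module R S (regular_module R))"
  "\<zero>\<^bsub>localize_ring R S\<^esub> = \<zero>\<^bsub>localize_module R S (regular_module R)\<^esub>"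
  "ring.add (localize_ring R S) = ring.add (localize_module R S (regular_module R))"
  "monoid.mult (localize_ring R S) = smult (localize_module R S (regular_module R))"
  by (simp_all add: localize_ring_def localize_module_def)

lemma localize_ring_one: "\<one>\<^bsub>localize_ring R S\<^esub> = fraction S (regular_module R) \<one>\<^bsub>R\<^esub> \<one>\<^bsub>R\<^esub>"
  by (simp add: localize_ring_def)

lemma (in localization) localize_ring_is_cring: "cring (localize_ring R S)"
proof -
  interpret reg: localization R "regular_module R" S
    by (intro localization.intro localization_axioms.intro R.regular_module_is_module
        one_mem S_subset mult_mem)
  let ?L = "localize_ring R S" and ?fr = "fraction S (regular_module R)"
  note eqs = localize_ring_eq_regular
  interpret L: abelian_group "localize_module R S (regular_module R)"
    by (rule reg.localize_module_abelian_group)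
  have mult: "?fr a s \<otimes>\<^bsub>?L\<^esub> ?fr b t = ?fr (a \<otimes> b) (s \<otimes> t)"
    if "a \<in> carrier R" "s \<in> S" "b \<in> carrier R" "t \<in> S" for a s b t
    using that reg.smult_fraction[of a s b t] by (simp add: eqs)
  have frac: "\<exists>a s. a \<in> carrier R \<and> s \<in> S \<and> U = ?fr a s" if "U \<in> carrier ?L" for U
    using that unfolding eqs(1) reg.carrier_localize_module by auto
  have closed: "?fr a s \<in> carrier ?L" if "a \<in> carrier R" "s \<in> S" for a s
    using reg.fraction_in_carrier[of a s] that by (simp add: eqs)
  show ?thesis
  proof (rule cringI)
    show "abelian_group ?L"
    proof (rule abelian_groupI)
      fix U assume "U \<in> carrier ?L"
      then show "\<exists>V\<in>carrier ?L. V \<oplus>\<^bsub>?L\<^esub> U = \<zero>\<^bsub>?L\<^esub>"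
        unfolding eqs by (intro bexI[of _ "\<ominus>\<^bsub>localize_module R S (regular_module R)\<^esub> U"]) (auto simp: L.l_neg)
    qed (auto simp: eqs L.a_ac)
    show "comm_monoid ?L"
    proof (rule comm_monoidI)
      show "\<one>\<^bsub>?L\<^esub> \<in> carrier ?L" using closed one_mem by (simp add: localize_ring_one)
      fix U assume "U \<in> carrier ?L"
      then obtain a s where U: "a \<in> carrier R" "s \<in> S" "U = ?fr a s" using frac by blast
      show "\<one>\<^bsub>?L\<^esub> \<otimes>\<^bsub>?L\<^esub> U = U" using U one_mem by (simp add: localize_ring_one mult)
      fix V assume "V \<in> carrier ?L"
      then obtain b t where V: "b \<in> carrier R" "t \<in> S" "V = ?fr b t" using frac by blast
      show "U \<otimes>\<^bsub>?L\<^esub> V \<in> carrier ?L" using U V by (simp add: mult closed mult_mem)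
      show "U \<otimes>\<^bsub>?L\<^esub> V = V \<otimes>\<^bsub>?L\<^esub> U" using U V by (simp add: mult R.m_comm)
      fix W assume "W \<in> carrier ?L"
      then obtain c w where W: "c \<in> carrier R" "w \<in> S" "W = ?fr c w" using frac by blast
      show "U \<otimes>\<^bsub>?L\<^esub> V \<otimes>\<^bsub>?L\<^esub> W = U \<otimes>\<^bsub>?L\<^esub> (V \<otimes>\<^bsub>?L\<^esub> W)"
        using U V W by (simp add: mult mult_mem R.m_assoc)
    qed
    fix U V W assume UV: "U \<in> carrier ?L" "V \<in> carrier ?L" and "W \<in> carrier ?L"
    then obtain c w where W: "c \<in> carrier R" "w \<in> S" "W = ?fr c w" using frac by blast
    obtain a b s where *: "a \<in> carrier R" "b \<in> carrier R" "s \<in> S" "U = ?fr a s" "V = ?fr b s"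
      using reg.common_denominator[of U V V] UV unfolding eqs(1) by auto
    have add: "?fr x t \<oplus>\<^bsub>?L\<^esub> ?fr y t = ?fr (x \<oplus> y) t"
      if "x \<in> carrier R" "y \<in> carrier R" "t \<in> S" for x y t
      using that reg.add_fraction_same[of x y t] by (simp add: eqs)
    show "(U \<oplus>\<^bsub>?L\<^esub> V) \<otimes>\<^bsub>?L\<^esub> W = U \<otimes>\<^bsub>?L\<^esub> W \<oplus>\<^bsub>?L\<^esub> V \<otimes>\<^bsub>?L\<^esub> W"
      using * W by (simp add: mult add mult_mem R.l_distr)
  qed
qed


lemma (in module) localization_at_prime:
  assumes "primeideal p R" shows "localization R M (carrier R - p)"
  by (intro localization.intro localization_axioms.intro module_axioms
      primeideal.complement_multiplicative[OF assms])

text \<open>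
  The extension of \<open>q\<close> to \<open>R\<^sub>m\<close>; for \<open>q = m\<close> it is the maximal ideal.  A denominator is outside \<open>m\<close>,
  hence outside \<open>q\<close>, and can be cancelled modulo \<open>q\<close>.  So the numerators that occur are those in \<open>q\<close>,
  and proper inclusions of primes are preserved.
\<close>

lemma (in cring) extended_prime:
  assumes m: "primeideal m R" and q: "primeideal q R" and qm: "q \<subseteq> m"
  defines "Q \<equiv> {fraction (carrier R - m) (regular_module R) a s | a s. a \<in> q \<and> s \<in> carrier R - m}"
  shows "primeideal Q (local_ring_at R m)"
    and "\<And>a s. a \<in> carrier R \<Longrightarrow> s \<in> carrier R - m \<Longrightarrow>
      fraction (carrier R - m) (regular_module R) a s \<in> Q \<longleftrightarrow> a \<in> q"
proof -
  let ?S = "carrier R - m" and ?L = "local_ring_at R m"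
  let ?fr = "fraction ?S (regular_module R)"
  interpret rm: module R "regular_module R" by (rule regular_module_is_module)
  interpret loc: localization R "regular_module R" ?S by (rule rm.localization_at_prime[OF m])
  interpret L: cring ?L by (rule loc.localize_ring_is_cring)
  interpret q: primeideal q R by fact
  note eqs = localize_ring_eq_regular
  have mem: "?fr a s \<in> Q \<longleftrightarrow> a \<in> q" if as: "a \<in> carrier R" "s \<in> ?S" for a s
  proof
    assume "?fr a s \<in> Q"
    then obtain b t where b: "b \<in> q" "t \<in> ?S" "?fr a s = ?fr b t" unfolding Q_def by blast
    have bc: "b \<in> carrier R" using b by (simp add: q.a_Hcarr)
    obtain u where u: "u \<in> ?S" "u \<otimes> (t \<otimes> a) = u \<otimes> (s \<otimes> b)"
      using b as bc loc.fraction_eq_iff[of a s b t] by auto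
    have "u \<otimes> (s \<otimes> b) \<in> q" using u as b by (intro q.I_l_closed) auto
    then have "u \<otimes> (t \<otimes> a) \<in> q" using u by simp
    then have "u \<in> q \<or> t \<in> q \<or> a \<in> q"
      using u(1) b(2) as by (metis q.I_prime DiffD1 m_closed)
    then show "a \<in> q" using u b qm by blast
  qed (use as in \<open>auto simp: Q_def\<close>)
  show "\<And>a s. a \<in> carrier R \<Longrightarrow> s \<in> ?S \<Longrightarrow> ?fr a s \<in> Q \<longleftrightarrow> a \<in> q" by (rule mem)
  have mult: "?fr a s \<otimes>\<^bsub>?L\<^esub> ?fr b t = ?fr (a \<otimes> b) (s \<otimes> t)"
    if "a \<in> carrier R" "s \<in> ?S" "b \<in> carrier R" "t \<in> ?S" for a s b t
    using that loc.smult_fraction[of a s b t] by (simp add: eqs)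
  have add: "?fr a s \<oplus>\<^bsub>?L\<^esub> ?fr b t = ?fr (t \<otimes> a \<oplus> s \<otimes> b) (s \<otimes> t)"
    if "a \<in> carrier R" "s \<in> ?S" "b \<in> carrier R" "t \<in> ?S" for a s b t
    using that loc.add_fraction[of a s b t] by (simp add: eqs)
  have frac: "\<exists>a s. a \<in> carrier R \<and> s \<in> ?S \<and> U = ?fr a s" if "U \<in> carrier ?L" for U
    using that unfolding eqs(1) loc.carrier_localize_module by auto
  have closed: "?fr a s \<in> carrier ?L" if "a \<in> carrier R" "s \<in> ?S" for a s
    using loc.fraction_in_carrier[of a s] that by (simp add: eqs)
  have QL: "Q \<subseteq> carrier ?L" unfolding Q_def using closed q.a_Hcarr by blast
  have smul: "V \<otimes>\<^bsub>?L\<^esub> U \<in> Q" if U: "U \<in> Q" and V: "V \<in> carrier ?L" for U V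
  proof -
    obtain a s b t where *: "a \<in> q" "s \<in> ?S" "U = ?fr a s" "b \<in> carrier R" "t \<in> ?S" "V = ?fr b t"
      using U frac[OF V] unfolding Q_def by blast
    have "b \<otimes> a \<in> q" using * by (intro q.I_l_closed) auto
    then show ?thesis
      using * loc.mult_mem[of t s] q.a_Hcarr by (simp add: mult mem)
  qed
  show "primeideal Q ?L"
  proof (rule primeidealI)
    show "cring ?L" by (rule L.is_cring)
    show "ideal Q ?L"
    proof (rule idealI)
      show "ring ?L" by (rule L.ring_axioms)
      show "subgroup Q (add_monoid ?L)"
      proof (rule L.add.subgroupI)
        show "Q \<subseteq> carrier ?L" by (rule QL)
        have "\<one> \<in> ?S" by (rule loc.one_mem)
        then show "Q \<noteq> {}" unfolding Q_def using q.zero_closed by blast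
        show "\<ominus>\<^bsub>?L\<^esub> U \<in> Q" if "U \<in> Q" for U
        proof -
          have "(\<ominus>\<^bsub>?L\<^esub> \<one>\<^bsub>?L\<^esub>) \<otimes>\<^bsub>?L\<^esub> U \<in> Q" using that by (rule smul) simp
          then show ?thesis using that QL by (simp add: L.l_minus subset_iff)
        qed
        show "U \<oplus>\<^bsub>?L\<^esub> V \<in> Q" if UV: "U \<in> Q" "V \<in> Q" for U V
        proof -
          obtain a s b t where *: "a \<in> q" "s \<in> ?S" "U = ?fr a s" "b \<in> q" "t \<in> ?S" "V = ?fr b t"
            using UV unfolding Q_def by blast
          have "t \<otimes> a \<oplus> s \<otimes> b \<in> q" using * by (intro q.a_closed q.I_l_closed) auto
          then show ?thesis using * loc.mult_mem[of s t] q.a_Hcarr by (simp add: add mem)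
        qed
      qed
      fix U V assume UV: "U \<in> Q" "V \<in> carrier ?L"
      show "V \<otimes>\<^bsub>?L\<^esub> U \<in> Q" by (rule smul[OF UV])
      then show "U \<otimes>\<^bsub>?L\<^esub> V \<in> Q" using UV QL L.m_comm[of U V] by auto
    qed
    have "?fr \<one> \<one> \<notin> Q" using loc.one_mem mem[of \<one> \<one>] qm by auto
    then show "carrier ?L \<noteq> Q" using closed loc.one_mem by auto
    fix U V assume UV: "U \<in> carrier ?L" "V \<in> carrier ?L" "U \<otimes>\<^bsub>?L\<^esub> V \<in> Q"
    obtain a s b t where *: "a \<in> carrier R" "s \<in> ?S" "U = ?fr a s" "b \<in> carrier R" "t \<in> ?S" "V = ?fr b t"
      using frac[OF UV(1)] frac[OF UV(2)] by blast
    have "a \<otimes> b \<in> q" using UV(3) * loc.mult_mem[of s t] by (simp add: mult mem)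
    then show "U \<in> Q \<or> V \<in> Q" using * q.I_prime by (simp add: mem)
  qed
qed

text \<open>
  Only this bound on the dimension of \<open>R\<^sub>m\<close> is obtained from a chain of primes.  The opposite bound
  comes from the depth, which over a Cohen-Macaulay ring equals the dimension.
\<close>

lemma (in cring) krull_dim_local_ring_ge_1:
  assumes m: "primeideal m R" and q: "primeideal q R" and qm: "q \<subset> m"
  shows "1 \<le> krull_dim (local_ring_at R m)"
proof -
  let ?S = "carrier R - m"
  let ?fr = "fraction ?S (regular_module R)"
  define E where "E r = {?fr a s | a s. a \<in> r \<and> s \<in> ?S}" for r
  have Eq: "primeideal (E q) (local_ring_at R m)" and Em: "primeideal (E m) (local_ring_at R m)"
    unfolding E_def using extended_prime(1)[OF m q] extended_prime(1)[OF m m] qm by blast+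
  interpret m: primeideal m R by fact
  obtain a where a: "a \<in> m" "a \<notin> q" using qm by blast
  have "\<one> \<in> ?S" by (rule m.complement_multiplicative(1))
  then have "?fr a \<one> \<in> E m" unfolding E_def using a(1) by blast
  moreover have "?fr a \<one> \<notin> E q"
    unfolding E_def using extended_prime(2)[OF m q _ m.a_Hcarr[OF a(1)] \<open>\<one> \<in> ?S\<close>] qm a(2) by simp
  moreover have "E q \<subseteq> E m" unfolding E_def using qm by blast
  ultimately have "E q \<subset> E m" by blast
  define P where "P i = (if i = 0 then E q else E m)" for i :: nat
  have "(\<forall>i\<le>1. primeideal (P i) (local_ring_at R m)) \<and> (\<forall>i<1. P i \<subset> P (Suc i))"
    using Eq Em \<open>E q \<subset> E m\<close> by (auto simp: P_def)
  then have "enat 1 \<le> krull_dim (local_ring_at R m)" unfolding krull_dim_def by (intro Sup_upper) blast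
  then show ?thesis by (simp add: one_enat_def)
qed

section \<open>Depth over localizations\<close>

context localization
begin

lemma list_smult_Nil: "list_smult (localize_module R S M) [] = {\<zero>\<^bsub>localize_module R S M\<^esub>}"
proof -
  interpret L: abelian_group "localize_module R S M" by (rule localize_module_abelian_group)
  show ?thesis unfolding list_smult_def by simp
qed

lemma smult_localize_closed:
  assumes "U \<in> carrier (localize_ring R S)" "V \<in> carrier (localize_module R S M)"
  shows "U \<odot>\<^bsub>localize_module R S M\<^esub> V \<in> carrier (localize_module R S M)"
proof -
  interpret reg: localization R "regular_module R" S
    by (intro localization.intro localization_axioms.intro R.regular_module_is_module
        one_mem S_subset mult_mem)
  obtain a s x t where "a \<in> carrier R" "s \<in> S" "U = fraction S (regular_module R) a s"
    "x \<in> carrier M" "t \<in> S" "V = fraction S M x t"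
    using assms unfolding localize_ring_eq_regular(1) carrier_localize_module reg.carrier_localize_module
    by auto
  then show ?thesis using mult_mem by (simp add: smult_fraction fraction_in_carrier)
qed

lemma list_smult_single:
  assumes "U \<in> carrier (localize_ring R S)"
  shows "list_smult (localize_module R S M) [U]
    = {U \<odot>\<^bsub>localize_module R S M\<^esub> V | V. V \<in> carrier (localize_module R S M)}"
proof -
  let ?L = "localize_module R S M"
  interpret L: abelian_group ?L by (rule localize_module_abelian_group)
  have eq: "(\<Oplus>\<^bsub>?L\<^esub>i\<in>{..<length [U]}. ([U] ! i) \<odot>\<^bsub>?L\<^esub> v i) = U \<odot>\<^bsub>?L\<^esub> v 0"
    if "v 0 \<in> carrier ?L" for v
    using smult_localize_closed[OF assms that] by (simp add: lessThan_Suc)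
  show ?thesis
  proof (intro equalityI subsetI)
    fix W assume "W \<in> list_smult ?L [U]"
    then obtain v where v: "v \<in> {..<length [U]} \<rightarrow> carrier ?L"
      "W = (\<Oplus>\<^bsub>?L\<^esub>i\<in>{..<length [U]}. ([U] ! i) \<odot>\<^bsub>?L\<^esub> v i)" unfolding list_smult_def by blast
    have v0: "v 0 \<in> carrier ?L" using v(1) by auto
    then have "W = U \<odot>\<^bsub>?L\<^esub> v 0" using eq[of v] v(2) by simp
    then show "W \<in> {U \<odot>\<^bsub>?L\<^esub> V | V. V \<in> carrier ?L}" using v0 by blast
  next
    fix W assume "W \<in> {U \<odot>\<^bsub>?L\<^esub> V | V. V \<in> carrier ?L}"
    then obtain V where V: "V \<in> carrier ?L" "W = U \<odot>\<^bsub>?L\<^esub> V" by blast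
    then have "W = (\<Oplus>\<^bsub>?L\<^esub>i\<in>{..<length [U]}. ([U] ! i) \<odot>\<^bsub>?L\<^esub> (\<lambda>_. V) i)"
      using eq[of "\<lambda>_. V"] by simp
    then show "W \<in> list_smult ?L [U]"
      unfolding list_smult_def using V(1) by (intro CollectI exI[of _ "\<lambda>_. V"]) auto
  qed
qed

text \<open>
  Clearing denominators translates conditions on the submodule generated by a one-element sequence
  over the localized ring into conditions over \<open>R\<close>.
\<close>

lemma fraction_in_multiples_iff:
  assumes "a \<in> carrier R" "s \<in> S" "x \<in> carrier M" "r \<in> S"
  shows "fraction S M x r \<in> {fraction S (regular_module R) a s \<odot>\<^bsub>localize_module R S M\<^esub> V | V.
      V \<in> carrier (localize_module R S M)} \<longleftrightarrow> (\<exists>u\<in>S. \<exists>y\<in>carrier M. u \<odot>\<^bsub>M\<^esub> x = a \<odot>\<^bsub>M\<^esub> y)"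
    (is "_ \<in> ?X \<longleftrightarrow> ?rhs")
proof
  assume "fraction S M x r \<in> ?X"
  then obtain y t where y: "y \<in> carrier M" "t \<in> S"
    "fraction S M x r = fraction S M (a \<odot>\<^bsub>M\<^esub> y) (s \<otimes> t)"
    unfolding carrier_localize_module using assms by (auto simp: smult_fraction)
  then obtain u where u: "u \<in> S" "u \<odot>\<^bsub>M\<^esub> ((s \<otimes> t) \<odot>\<^bsub>M\<^esub> x) = u \<odot>\<^bsub>M\<^esub> (r \<odot>\<^bsub>M\<^esub> (a \<odot>\<^bsub>M\<^esub> y))"
    using assms mult_mem by (auto simp: fraction_eq_iff)
  have "u \<odot>\<^bsub>M\<^esub> (r \<odot>\<^bsub>M\<^esub> (a \<odot>\<^bsub>M\<^esub> y)) = a \<odot>\<^bsub>M\<^esub> ((u \<otimes> r) \<odot>\<^bsub>M\<^esub> y)"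
    using assms y(1) u(1) by (simp add: smult_assoc1[symmetric] R.m_ac)
  moreover have "(u \<otimes> (s \<otimes> t)) \<odot>\<^bsub>M\<^esub> x = u \<odot>\<^bsub>M\<^esub> ((s \<otimes> t) \<odot>\<^bsub>M\<^esub> x)"
    using assms y u(1) by (intro smult_assoc1) auto
  ultimately have "(u \<otimes> (s \<otimes> t)) \<odot>\<^bsub>M\<^esub> x = a \<odot>\<^bsub>M\<^esub> ((u \<otimes> r) \<odot>\<^bsub>M\<^esub> y)" using u(2) by simp
  moreover have "u \<otimes> (s \<otimes> t) \<in> S" using u y assms mult_mem by simp
  moreover have "(u \<otimes> r) \<odot>\<^bsub>M\<^esub> y \<in> carrier M" using u y assms by simp
  ultimately show ?rhs by blast
next
  assume ?rhs
  then obtain u y where u: "u \<in> S" "y \<in> carrier M" "u \<odot>\<^bsub>M\<^esub> x = a \<odot>\<^bsub>M\<^esub> y" by blast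
  have "fraction S (regular_module R) a s \<odot>\<^bsub>localize_module R S M\<^esub> fraction S M (s \<odot>\<^bsub>M\<^esub> y) (u \<otimes> r)
      = fraction S M (a \<odot>\<^bsub>M\<^esub> (s \<odot>\<^bsub>M\<^esub> y)) (s \<otimes> (u \<otimes> r))"
    using assms u mult_mem by (intro smult_fraction) auto
  also have "\<dots> = fraction S M x r"
  proof (rule fraction_eqI)
    have "r \<odot>\<^bsub>M\<^esub> (a \<odot>\<^bsub>M\<^esub> (s \<odot>\<^bsub>M\<^esub> y)) = (r \<otimes> s) \<odot>\<^bsub>M\<^esub> (u \<odot>\<^bsub>M\<^esub> x)"
      unfolding u(3) using assms u(1,2) by (simp add: smult_assoc1[symmetric] R.m_ac)
    also have "\<dots> = (s \<otimes> (u \<otimes> r)) \<odot>\<^bsub>M\<^esub> x"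
      using assms u(1,2) by (simp add: smult_assoc1[symmetric] R.m_ac)
    finally show "r \<odot>\<^bsub>M\<^esub> (a \<odot>\<^bsub>M\<^esub> (s \<odot>\<^bsub>M\<^esub> y)) = (s \<otimes> (u \<otimes> r)) \<odot>\<^bsub>M\<^esub> x" .
  qed (use assms u mult_mem in auto)
  finally have eq: "fraction S (regular_module R) a s \<odot>\<^bsub>localize_module R S M\<^esub>
      fraction S M (s \<odot>\<^bsub>M\<^esub> y) (u \<otimes> r) = fraction S M x r" .
  have "fraction S M (s \<odot>\<^bsub>M\<^esub> y) (u \<otimes> r) \<in> carrier (localize_module R S M)"
    using assms u mult_mem by (intro fraction_in_carrier) auto
  then show "fraction S M x r \<in> ?X" by (intro CollectI exI conjI) (rule eq[symmetric])
qed

lemma smult_fraction_zero_iff: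
  assumes "a \<in> carrier R" "s \<in> S" "x \<in> carrier M" "r \<in> S"
  shows "fraction S (regular_module R) a s \<odot>\<^bsub>localize_module R S M\<^esub> fraction S M x r
      \<in> {\<zero>\<^bsub>localize_module R S M\<^esub>} \<longleftrightarrow> (\<exists>u\<in>S. u \<odot>\<^bsub>M\<^esub> (a \<odot>\<^bsub>M\<^esub> x) = \<zero>\<^bsub>M\<^esub>)"
  using assms mult_mem by (simp add: smult_fraction fraction_eq_zero_iff)

end

text \<open>
  The image of \<open>a\<close> in \<open>R\<^sub>p\<close> is a nonzerodivisor on \<open>M\<^sub>p\<close>.
\<close>

definition locally_regular ::
    "('a, 'r) ring_scheme \<Rightarrow> 'a set \<Rightarrow> ('a, 'b, 'm) module_scheme \<Rightarrow> 'a \<Rightarrow> bool"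
  where "locally_regular R p M a \<longleftrightarrow> (\<forall>x\<in>carrier M.
    (\<exists>u\<in>carrier R - p. u \<odot>\<^bsub>M\<^esub> (a \<odot>\<^bsub>M\<^esub> x) = \<zero>\<^bsub>M\<^esub>) \<longrightarrow> (\<exists>u\<in>carrier R - p. u \<odot>\<^bsub>M\<^esub> x = \<zero>\<^bsub>M\<^esub>))"

text \<open>
  The prime \<open>p\<close> lies in the support of \<open>M\<close>: for some \<open>x\<close>, the fraction \<open>x/1\<close> in \<open>M\<^sub>p\<close> is nonzero.
\<close>

definition supports :: "('a, 'r) ring_scheme \<Rightarrow> ('a, 'b, 'm) module_scheme \<Rightarrow> 'a set \<Rightarrow> bool"
  where "supports R M p \<longleftrightarrow> (\<exists>x\<in>carrier M. annihilator R M x \<subseteq> p)"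

lemma (in module) not_supports_iff:
  assumes p: "primeideal p R"
  shows "\<not> supports R M p \<longleftrightarrow> carrier (module_at R p M) = {\<zero>\<^bsub>module_at R p M\<^esub>}"
proof -
  interpret loc: localization R M "carrier R - p" by (rule localization_at_prime[OF p])
  have "\<zero>\<^bsub>module_at R p M\<^esub> \<in> carrier (module_at R p M)"
    unfolding loc.localize_module_zero by (rule loc.fraction_in_carrier[OF M.zero_closed loc.one_mem])
  then have "carrier (module_at R p M) = {\<zero>\<^bsub>module_at R p M\<^esub>} \<longleftrightarrow>
      (\<forall>W\<in>carrier (module_at R p M). W = \<zero>\<^bsub>module_at R p M\<^esub>)" by blast
  also have "\<dots> \<longleftrightarrow> (\<forall>x\<in>carrier M. \<forall>s\<in>carrier R - p. fraction (carrier R - p) M x s = \<zero>\<^bsub>module_at R p M\<^esub>)"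
    unfolding loc.carrier_localize_module by auto
  also have "\<dots> \<longleftrightarrow> (\<forall>x\<in>carrier M. \<exists>u\<in>carrier R - p. u \<odot>\<^bsub>M\<^esub> x = \<zero>\<^bsub>M\<^esub>)"
    using loc.fraction_eq_zero_iff loc.one_mem by blast
  also have "\<dots> \<longleftrightarrow> \<not> supports R M p" unfolding supports_def annihilator_def by blast
  finally show ?thesis by blast
qed

text \<open>
  The condition on the first member of a regular sequence over \<open>R\<^sub>p\<close>, read off for its numerator.
\<close>

lemma (in module) regular_sequence_at_first:
  assumes p: "primeideal p R"
    and xs: "regular_sequence (local_ring_at R p) (module_at R p M) (V # Vs)"
    and V: "V = fraction (carrier R - p) (regular_module R) a s" "a \<in> p" "s \<in> carrier R - p"
  shows "locally_regular R p M a"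
proof -
  interpret loc: localization R M "carrier R - p" by (rule localization_at_prime[OF p])
  interpret p: primeideal p R by fact
  show ?thesis unfolding locally_regular_def
  proof (intro ballI impI)
    fix x assume x: "x \<in> carrier M" and "\<exists>u\<in>carrier R - p. u \<odot>\<^bsub>M\<^esub> (a \<odot>\<^bsub>M\<^esub> x) = \<zero>\<^bsub>M\<^esub>"
    then have "V \<odot>\<^bsub>module_at R p M\<^esub> fraction (carrier R - p) M x \<one> \<in> {\<zero>\<^bsub>module_at R p M\<^esub>}"
      unfolding V(1) using p.a_Hcarr[OF V(2)] V(3) loc.one_mem
      by (subst loc.smult_fraction_zero_iff) auto
    moreover have "\<forall>W\<in>carrier (module_at R p M). V \<odot>\<^bsub>module_at R p M\<^esub> W \<in> {\<zero>\<^bsub>module_at R p M\<^esub>} \<longrightarrow>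
        W \<in> {\<zero>\<^bsub>module_at R p M\<^esub>}"
      using xs unfolding regular_sequence_def loc.list_smult_Nil[symmetric] by force
    ultimately have "fraction (carrier R - p) M x \<one> = \<zero>\<^bsub>module_at R p M\<^esub>"
      using loc.fraction_in_carrier[OF x loc.one_mem] by blast
    then show "\<exists>u\<in>carrier R - p. u \<odot>\<^bsub>M\<^esub> x = \<zero>\<^bsub>M\<^esub>"
      using loc.fraction_eq_zero_iff[OF x loc.one_mem] by blast
  qed
qed

text \<open>
  Nakayama's lemma for \<open>M\<^sub>p\<close>: if \<open>a M\<^sub>p = M\<^sub>p\<close>, then \<open>M\<close> would be locally contained in the proper
  submodule of \<open>nakayama_submodule\<close>.
\<close>

lemma (in module) local_nakayama:
  assumes R: "noetherian_ring R" and M: "fin_gen_module R M" and p: "primeideal p R"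
    and supp: "supports R M p" and a: "a \<in> p"
  shows "\<exists>x\<in>carrier M. \<forall>u\<in>carrier R - p. \<forall>y\<in>carrier M. u \<odot>\<^bsub>M\<^esub> x \<noteq> a \<odot>\<^bsub>M\<^esub> y"
proof (rule ccontr)
  assume no: "\<not> ?thesis"
  obtain x0 where "x0 \<in> carrier M" "annihilator R M x0 \<subseteq> p" using supp unfolding supports_def by blast
  from nakayama_submodule[OF R M p this]
  obtain N where N: "submodule N R M" "\<forall>u\<in>carrier R - p. \<exists>x\<in>carrier M. u \<odot>\<^bsub>M\<^esub> x \<notin> N"
    "\<forall>a\<in>p. \<forall>x\<in>carrier M. a \<odot>\<^bsub>M\<^esub> x \<in> N" by (elim exE conjE)
  have "\<exists>u\<in>carrier R - p. u \<odot>\<^bsub>M\<^esub> x \<in> N" if x: "x \<in> carrier M" for x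
  proof -
    obtain u y where "u \<in> carrier R - p" "y \<in> carrier M" "u \<odot>\<^bsub>M\<^esub> x = a \<odot>\<^bsub>M\<^esub> y" using no x by blast
    then show ?thesis using N(3) a by metis
  qed
  from uniform_multiplier[OF p M N(1) this] show False using N(2) by blast
qed

lemma (in module) regular_sequence_at_single:
  assumes R: "noetherian_ring R" and M: "fin_gen_module R M" and p: "primeideal p R"
    and supp: "supports R M p" and a: "a \<in> p" and reg: "locally_regular R p M a"
  shows "regular_sequence (local_ring_at R p) (module_at R p M)
    [fraction (carrier R - p) (regular_module R) a \<one>]"
proof -
  interpret loc: localization R M "carrier R - p" by (rule localization_at_prime[OF p])
  interpret rm: module R "regular_module R" by (rule R.regular_module_is_module)
  interpret locr: localization R "regular_module R" "carrier R - p" by (rule rm.localization_at_prime[OF p])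
  interpret p: primeideal p R by fact
  define V where "V = fraction (carrier R - p) (regular_module R) a \<one>"
  have ac: "a \<in> carrier R" using a by (rule p.a_Hcarr)
  have V: "V \<in> carrier (local_ring_at R p)"
    unfolding V_def localize_ring_eq_regular(1)
    using locr.fraction_in_carrier[of a \<one>] ac loc.one_mem by simp
  have inj: "W \<in> {\<zero>\<^bsub>module_at R p M\<^esub>}"
    if W: "W \<in> carrier (module_at R p M)" "V \<odot>\<^bsub>module_at R p M\<^esub> W \<in> {\<zero>\<^bsub>module_at R p M\<^esub>}" for W
  proof -
    obtain x s where x: "x \<in> carrier M" "s \<in> carrier R - p" "W = fraction (carrier R - p) M x s"
      using W(1) unfolding loc.carrier_localize_module by blast
    have "\<exists>u\<in>carrier R - p. u \<odot>\<^bsub>M\<^esub> (a \<odot>\<^bsub>M\<^esub> x) = \<zero>\<^bsub>M\<^esub>"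
      using W(2) loc.smult_fraction_zero_iff[OF ac loc.one_mem x(1,2)] unfolding V_def x(3) by blast
    then have "\<exists>u\<in>carrier R - p. u \<odot>\<^bsub>M\<^esub> x = \<zero>\<^bsub>M\<^esub>" using reg x(1) unfolding locally_regular_def by blast
    then show ?thesis unfolding x(3) using loc.fraction_eq_zero_iff[OF x(1,2)] by blast
  qed
  obtain x where x: "x \<in> carrier M"
    "\<forall>u\<in>carrier R - p. \<forall>y\<in>carrier M. u \<odot>\<^bsub>M\<^esub> x \<noteq> a \<odot>\<^bsub>M\<^esub> y"
    using local_nakayama[OF R M p supp a] by blast
  then have "fraction (carrier R - p) M x \<one> \<notin> list_smult (module_at R p M) [V]"
    unfolding loc.list_smult_single[OF V] unfolding V_def
    using loc.fraction_in_multiples_iff[OF ac loc.one_mem x(1) loc.one_mem] by blast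
  then have "list_smult (module_at R p M) [V] \<noteq> carrier (module_at R p M)"
    using loc.fraction_in_carrier[OF x(1) loc.one_mem] by blast
  then show ?thesis
    using V inj unfolding V_def[symmetric] regular_sequence_def by (simp add: loc.list_smult_Nil)
qed


text \<open>
  The condition on the second member: its numerator \<open>c\<close> acts injectively on \<open>M\<^sub>p/a M\<^sub>p\<close>.
\<close>

lemma (in module) regular_sequence_at_second:
  assumes p: "primeideal p R"
    and xs: "regular_sequence (local_ring_at R p) (module_at R p M) (V # W # Vs)"
    and V: "V = fraction (carrier R - p) (regular_module R) a s" "a \<in> p" "s \<in> carrier R - p"
    and W: "W = fraction (carrier R - p) (regular_module R) c t" "c \<in> p" "t \<in> carrier R - p"
    and x: "x \<in> carrier M" and cx: "\<exists>u\<in>carrier R - p. \<exists>y\<in>carrier M. u \<odot>\<^bsub>M\<^esub> (c \<odot>\<^bsub>M\<^esub> x) = a \<odot>\<^bsub>M\<^esub> y"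
  shows "\<exists>u\<in>carrier R - p. \<exists>y\<in>carrier M. u \<odot>\<^bsub>M\<^esub> x = a \<odot>\<^bsub>M\<^esub> y"
proof -
  interpret loc: localization R M "carrier R - p" by (rule localization_at_prime[OF p])
  interpret p: primeideal p R by fact
  have ac: "a \<in> carrier R" "c \<in> carrier R" using V(2) W(2) p.a_Hcarr by auto
  have "V \<in> carrier (local_ring_at R p)" using xs unfolding regular_sequence_def by simp
  note VM = loc.list_smult_single[OF this]
  have "W \<odot>\<^bsub>module_at R p M\<^esub> fraction (carrier R - p) M x \<one> = fraction (carrier R - p) M (c \<odot>\<^bsub>M\<^esub> x) (t \<otimes> \<one>)"
    unfolding W(1) by (rule loc.smult_fraction[OF ac(2) W(3) x loc.one_mem])
  moreover have "fraction (carrier R - p) M (c \<odot>\<^bsub>M\<^esub> x) (t \<otimes> \<one>) \<in> list_smult (module_at R p M) [V]"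
    unfolding VM unfolding V(1)
    unfolding loc.fraction_in_multiples_iff[OF ac(1) V(3) smult_closed[OF ac(2) x]
      loc.mult_mem[OF W(3) loc.one_mem]] by (rule cx)
  ultimately have "W \<odot>\<^bsub>module_at R p M\<^esub> fraction (carrier R - p) M x \<one> \<in> list_smult (module_at R p M) [V]"
    by simp
  moreover have "\<forall>v\<in>carrier (module_at R p M). W \<odot>\<^bsub>module_at R p M\<^esub> v \<in> list_smult (module_at R p M) [V] \<longrightarrow>
      v \<in> list_smult (module_at R p M) [V]"
  proof -
    have "\<forall>i<length (V # W # Vs). \<forall>v\<in>carrier (module_at R p M).
       ((V # W # Vs) ! i) \<odot>\<^bsub>module_at R p M\<^esub> v \<in> list_smult (module_at R p M) (take i (V # W # Vs)) \<longrightarrow>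
       v \<in> list_smult (module_at R p M) (take i (V # W # Vs))"
      using xs unfolding regular_sequence_def by blast
    from this[THEN spec, of 1] show ?thesis by simp
  qed
  ultimately have "fraction (carrier R - p) M x \<one> \<in> list_smult (module_at R p M) [V]"
    using loc.fraction_in_carrier[OF x loc.one_mem] by blast
  then show ?thesis
    unfolding VM unfolding V(1) using loc.fraction_in_multiples_iff[OF ac(1) V(3) x loc.one_mem] by simp
qed

lemma (in module) minimal_prime_is_annihilator:
  assumes R: "noetherian_ring R" and p: "p \<in> minimal_primes R" and supp: "supports R M p"
  shows "\<exists>x\<in>carrier M. annihilator R M x = p"
proof -
  obtain x where x: "x \<in> carrier M" "annihilator R M x \<subseteq> p" using supp unfolding supports_def by blast
  then obtain c where c: "c \<in> carrier R" "annihilator R M (c \<odot>\<^bsub>M\<^esub> x) = p"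
    using minimal_prime_is_colon[OF R zero_submodule x(1) p] unfolding colon_zero by blast
  have "c \<odot>\<^bsub>M\<^esub> x \<in> carrier M" using c x by simp
  then show ?thesis using c(2) by (rule rev_bexI)
qed

text \<open>
  The prime \<open>q\<close> is the annihilator of some element, and \<open>a \<in> q\<close> kills that element although it is
  nonzero in \<open>M\<^sub>p\<close>.
\<close>

lemma (in module) not_locally_regular_of_minimal:
  assumes R: "noetherian_ring R" and p: "primeideal p R" and q: "q \<in> minimal_primes R" "q \<subseteq> p"
    and supp: "supports R M q" and a: "a \<in> q"
  shows "\<not> locally_regular R p M a"
proof
  assume reg: "locally_regular R p M a"
  obtain x where x: "x \<in> carrier M" "annihilator R M x = q"
    using minimal_prime_is_annihilator[OF R q(1) supp] by blast
  have "a \<odot>\<^bsub>M\<^esub> x = \<zero>\<^bsub>M\<^esub>" using a unfolding x(2)[symmetric] by (simp add: annihilator_def)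
  then have "\<exists>u\<in>carrier R - p. u \<odot>\<^bsub>M\<^esub> (a \<odot>\<^bsub>M\<^esub> x) = \<zero>\<^bsub>M\<^esub>"
    using primeideal.complement_multiplicative(1)[OF p] by auto
  then obtain u where "u \<in> carrier R - p" "u \<odot>\<^bsub>M\<^esub> x = \<zero>\<^bsub>M\<^esub>"
    using reg x(1) unfolding locally_regular_def by blast
  then show False using q(2) x(2) unfolding annihilator_def by blast
qed

lemma (in module) supports_of_annihilating:
  assumes M: "fin_gen_module R M" and q: "primeideal q R"
    and sub: "\<And>s. s \<in> carrier R \<Longrightarrow> (\<forall>x\<in>carrier M. s \<odot>\<^bsub>M\<^esub> x = \<zero>\<^bsub>M\<^esub>) \<Longrightarrow> s \<in> q"
  shows "supports R M q"
proof (rule ccontr)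
  assume "\<not> supports R M q"
  then have "\<exists>u\<in>carrier R - q. u \<odot>\<^bsub>M\<^esub> x \<in> {\<zero>\<^bsub>M\<^esub>}" if "x \<in> carrier M" for x
    using that unfolding supports_def annihilator_def by blast
  from uniform_multiplier[OF q M zero_submodule this] show False using sub by blast
qed

text \<open>
  In \<open>M\<^sub>p/a M\<^sub>p\<close> every element \<open>c\<close> of \<open>p\<close> is nilpotent.  Otherwise there is a prime \<open>q\<close> that contains
  \<open>(a M : M)\<close> and avoids all \<open>u c\<^sup>n\<close> with \<open>u \<notin> p\<close>.  It is properly contained in \<open>p\<close>, hence minimal,
  and it lies in the support of \<open>M\<close> because it contains the annihilator of \<open>M\<close>.  As it contains \<open>a\<close>,
  this contradicts the regularity of \<open>a\<close>.
\<close>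

lemma (in module) power_multiplies_into_multiples:
  assumes R: "noetherian_ring R" and dim: "krull_dim R = 1" and M: "fin_gen_module R M"
    and p: "primeideal p R"
    and a: "a \<in> p" and reg: "locally_regular R p M a" and c: "c \<in> p"
  shows "\<exists>n. \<exists>u\<in>carrier R - p. \<forall>x\<in>carrier M. \<exists>y\<in>carrier M. u \<odot>\<^bsub>M\<^esub> (c [^] (n::nat) \<odot>\<^bsub>M\<^esub> x) = a \<odot>\<^bsub>M\<^esub> y"
proof (rule ccontr)
  assume no: "\<not> ?thesis"
  interpret p: primeideal p R by fact
  have ac: "a \<in> carrier R" "c \<in> carrier R" using a c p.a_Hcarr by auto
  define aM where "aM = (\<lambda>y. a \<odot>\<^bsub>M\<^esub> y) ` carrier M"
  have aM: "submodule aM R M" unfolding aM_def by (rule smult_image_submodule[OF ac(1) carrier_is_submodule])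
  \<comment> \<open>The ideal \<open>(a M : M)\<close>.\<close>
  define J where "J = \<Inter> (colon R M aM ` carrier M)"
  have "ideal J R" unfolding J_def
    using colon_ideal[OF aM] M.zero_closed by (intro R.i_Intersect) auto
  have Jiff: "r \<in> J \<longleftrightarrow> r \<in> carrier R \<and> (\<forall>x\<in>carrier M. r \<odot>\<^bsub>M\<^esub> x \<in> aM)" for r
    using M.zero_closed unfolding J_def colon_def by blast
  define U where "U = {u \<otimes> c [^] (n::nat) | u n. u \<in> carrier R - p}"
  note pm = p.complement_multiplicative
  have Upow: "u \<otimes> c [^] n \<in> U" if "u \<in> carrier R - p" for u and n :: nat
    using that unfolding U_def by blast
  have Up: "u \<in> U" if "u \<in> carrier R - p" for u using Upow[OF that, of 0] that by simp
  have disj: "J \<inter> U = {}"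
  proof -
    have False if "u \<in> carrier R - p" "u \<otimes> c [^] n \<in> J" for u and n :: nat
    proof -
      have "\<forall>x\<in>carrier M. \<exists>y\<in>carrier M. u \<odot>\<^bsub>M\<^esub> (c [^] n \<odot>\<^bsub>M\<^esub> x) = a \<odot>\<^bsub>M\<^esub> y"
      proof
        fix x assume x: "x \<in> carrier M"
        have "(u \<otimes> c [^] n) \<odot>\<^bsub>M\<^esub> x \<in> aM" using that(2) x unfolding Jiff by blast
        then have "u \<odot>\<^bsub>M\<^esub> (c [^] n \<odot>\<^bsub>M\<^esub> x) \<in> aM" using x that(1) ac by (simp add: smult_assoc1)
        then show "\<exists>y\<in>carrier M. u \<odot>\<^bsub>M\<^esub> (c [^] n \<odot>\<^bsub>M\<^esub> x) = a \<odot>\<^bsub>M\<^esub> y" unfolding aM_def by blast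
      qed
      then show False using no that(1) by blast
    qed
    then show ?thesis unfolding U_def by blast
  qed
  have "\<one> \<in> U" using Up pm(1) by blast
  moreover have "U \<subseteq> carrier R" unfolding U_def using ac by auto
  moreover have "v \<otimes> w \<in> U" if vw: "v \<in> U" "w \<in> U" for v w
  proof -
    obtain u1 u2 and n1 n2 :: nat where *: "u1 \<in> carrier R - p" "u2 \<in> carrier R - p"
      "v = u1 \<otimes> c [^] n1" "w = u2 \<otimes> c [^] n2" using vw unfolding U_def by blast
    have "v \<otimes> w = (u1 \<otimes> u2) \<otimes> c [^] (n1 + n2)"
      using * ac by (simp add: R.nat_pow_mult[symmetric] R.m_ac)
    then show ?thesis using Upow[OF pm(3)[OF *(1,2)]] by simp
  qed
  ultimately obtain q where q: "primeideal q R" "J \<subseteq> q" "q \<inter> U = {}"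
    using R.prime_above_disjoint[OF R \<open>ideal J R\<close> _ _ _ disj] by blast
  have "q \<subseteq> carrier R" using q(1) by (auto dest: primeideal.axioms(1) ideal.Icarr)
  then have qp: "q \<subseteq> p" using q(3) Up by blast
  have "\<one> \<otimes> c [^] (1::nat) \<in> U" by (rule Upow[OF pm(1)])
  then have "c \<notin> q" using q(3) ac by auto
  then have "q \<subset> p" using qp c by blast
  then have qmin: "q \<in> minimal_primes R" by (rule prime_below_prime_minimal[OF dim q(1) p])
  have "a \<in> J" unfolding Jiff aM_def using ac by blast
  then have aq: "a \<in> q" using q(2) by blast
  have "supports R M q"
  proof (rule supports_of_annihilating[OF M q(1)])
    fix s assume s: "s \<in> carrier R" "\<forall>x\<in>carrier M. s \<odot>\<^bsub>M\<^esub> x = \<zero>\<^bsub>M\<^esub>"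
    then have "s \<in> J" unfolding Jiff using submodule_zero[OF aM] by simp
    then show "s \<in> q" using q(2) by blast
  qed
  then show False using not_locally_regular_of_minimal[OF R p qmin qp _ aq] reg by blast
qed

lemma depth_leI:
  assumes "\<And>xs. regular_sequence R M xs \<Longrightarrow> set xs \<subseteq> I \<Longrightarrow> length xs \<le> n"
  shows "depth R I M \<le> enat n"
  unfolding depth_def by (rule Sup_least) (use assms in auto)

lemma depth_geI:
  assumes "regular_sequence R M xs" "set xs \<subseteq> I"
  shows "enat (length xs) \<le> depth R I M"
  unfolding depth_def by (rule Sup_upper) (use assms in auto)

lemma depth_ge_1E:
  assumes "1 \<le> depth R I M"
  obtains x xs where "regular_sequence R M (x # xs)" "x \<in> I"
proof -
  have "\<not> depth R I M \<le> enat 0" using assms by (auto simp: zero_enat_def[symmetric])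
  then obtain xs where "regular_sequence R M xs" "set xs \<subseteq> I" "\<not> length xs \<le> 0"
    using depth_leI[of R M I 0] by blast
  then show ?thesis using that by (cases xs) auto
qed

text \<open>
  The prime \<open>p\<close> is an associated prime of \<open>M\<close>, so none of its elements is regular on \<open>M\<^sub>p\<close>.
\<close>

lemma (in module) depth_at_minimal_prime:
  assumes R: "noetherian_ring R" and p: "p \<in> minimal_primes R" and supp: "supports R M p"
  shows "depth (local_ring_at R p) (max_ideal_at R p) (module_at R p M) = 0"
proof (rule ccontr)
  assume "\<not> ?thesis"
  then have "1 \<le> depth (local_ring_at R p) (max_ideal_at R p) (module_at R p M)"
    by (simp add: ileI1 one_eSuc)
  then obtain V Vs where V: "regular_sequence (local_ring_at R p) (module_at R p M) (V # Vs)"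
    "V \<in> max_ideal_at R p" by (rule depth_ge_1E)
  obtain a s where "V = fraction (carrier R - p) (regular_module R) a s" "a \<in> p" "s \<in> carrier R - p"
    using V(2) unfolding max_ideal_at_def by blast
  with regular_sequence_at_first[OF minimal_primesD[OF p] V(1) this]
  show False using not_locally_regular_of_minimal[OF R minimal_primesD[OF p] p subset_refl supp] by blast
qed

lemma (in module) depth_at_nonminimal_prime_ge_1_iff:
  assumes R: "noetherian_ring R" and M: "fin_gen_module R M" and p: "primeideal p R"
    and supp: "supports R M p"
  shows "1 \<le> depth (local_ring_at R p) (max_ideal_at R p) (module_at R p M) \<longleftrightarrow>
    (\<exists>a\<in>p. locally_regular R p M a)"
proof
  assume "1 \<le> depth (local_ring_at R p) (max_ideal_at R p) (module_at R p M)"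
  then obtain V Vs where V: "regular_sequence (local_ring_at R p) (module_at R p M) (V # Vs)"
    "V \<in> max_ideal_at R p" by (rule depth_ge_1E)
  obtain a s where as: "V = fraction (carrier R - p) (regular_module R) a s" "a \<in> p" "s \<in> carrier R - p"
    using V(2) unfolding max_ideal_at_def by blast
  from regular_sequence_at_first[OF p V(1) this] show "\<exists>a\<in>p. locally_regular R p M a" using as(2) by blast
next
  assume "\<exists>a\<in>p. locally_regular R p M a"
  then obtain a where a: "a \<in> p" "locally_regular R p M a" by blast
  have "fraction (carrier R - p) (regular_module R) a \<one> \<in> max_ideal_at R p"
    unfolding max_ideal_at_def using a(1) primeideal.complement_multiplicative(1)[OF p] by blast
  then show "1 \<le> depth (local_ring_at R p) (max_ideal_at R p) (module_at R p M)"
    using depth_geI[OF regular_sequence_at_single[OF R M p supp a]] by (simp add: one_enat_def)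
qed

text \<open>
  If \<open>a, c\<close> began a regular sequence, \<open>c\<close> would be both injective and nilpotent on \<open>M\<^sub>p/a M\<^sub>p\<close>.  Then
  \<open>M\<^sub>p = a M\<^sub>p\<close>, which contradicts Nakayama's lemma.
\<close>

lemma (in module) depth_at_prime_le_1:
  assumes R: "noetherian_ring R" and dim: "krull_dim R = 1" and M: "fin_gen_module R M"
    and p: "primeideal p R" and supp: "supports R M p"
  shows "depth (local_ring_at R p) (max_ideal_at R p) (module_at R p M) \<le> 1"
  unfolding one_enat_def
proof (rule depth_leI, rule ccontr)
  fix xs assume xs: "regular_sequence (local_ring_at R p) (module_at R p M) xs"
    "set xs \<subseteq> max_ideal_at R p" "\<not> length xs \<le> 1"
  obtain V W Vs where Vs: "xs = V # W # Vs" using xs(3) by (cases xs rule: remdups_adj.cases) auto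
  interpret p: primeideal p R by fact
  have VW: "V \<in> max_ideal_at R p" "W \<in> max_ideal_at R p" using xs(2) Vs by auto
  obtain a s where V: "V = fraction (carrier R - p) (regular_module R) a s" "a \<in> p" "s \<in> carrier R - p"
    using VW(1) unfolding max_ideal_at_def by blast
  obtain c t where W: "W = fraction (carrier R - p) (regular_module R) c t" "c \<in> p" "t \<in> carrier R - p"
    using VW(2) unfolding max_ideal_at_def by blast
  note xs1 = xs(1)[unfolded Vs]
  have c: "c \<in> carrier R" using W(2) by (rule p.a_Hcarr)
  have step: "\<exists>u\<in>carrier R - p. \<exists>y\<in>carrier M. u \<odot>\<^bsub>M\<^esub> x = a \<odot>\<^bsub>M\<^esub> y"
    if "x \<in> carrier M" "\<exists>u\<in>carrier R - p. \<exists>y\<in>carrier M. u \<odot>\<^bsub>M\<^esub> (c [^] (n::nat) \<odot>\<^bsub>M\<^esub> x) = a \<odot>\<^bsub>M\<^esub> y" for x n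
    using that
  proof (induction n arbitrary: x)
    case 0
    then show ?case by simp
  next
    case (Suc n)
    have "c [^] Suc n \<odot>\<^bsub>M\<^esub> x = c [^] n \<odot>\<^bsub>M\<^esub> (c \<odot>\<^bsub>M\<^esub> x)" using c Suc.prems(1) by (simp add: smult_assoc1)
    then have "\<exists>u\<in>carrier R - p. \<exists>y\<in>carrier M. u \<odot>\<^bsub>M\<^esub> (c \<odot>\<^bsub>M\<^esub> x) = a \<odot>\<^bsub>M\<^esub> y"
      using Suc.IH[of "c \<odot>\<^bsub>M\<^esub> x"] Suc.prems c by simp
    then show ?case by (rule regular_sequence_at_second[OF p xs1 V W Suc.prems(1)])
  qed
  obtain n u where "u \<in> carrier R - p"
    "\<forall>x\<in>carrier M. \<exists>y\<in>carrier M. u \<odot>\<^bsub>M\<^esub> (c [^] (n::nat) \<odot>\<^bsub>M\<^esub> x) = a \<odot>\<^bsub>M\<^esub> y"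
    using power_multiplies_into_multiples[OF R dim M p V(2) regular_sequence_at_first[OF p xs1 V] W(2)]
    by (elim exE bexE)
  then have "\<exists>u\<in>carrier R - p. \<exists>y\<in>carrier M. u \<odot>\<^bsub>M\<^esub> x = a \<odot>\<^bsub>M\<^esub> y" if "x \<in> carrier M" for x
    using step[OF that] that by blast
  then show False using local_nakayama[OF R M p supp V(2)] by blast
qed

section \<open>Maximal Cohen-Macaulay modules in dimension one\<close>

text \<open>
  All associated primes of \<open>M/N\<close> are minimal primes of \<open>R\<close>.  The formulation says that \<open>M/N\<close> embeds
  into the product of its localizations at minimal primes.  In this form the property visibly passes to
  submodules and extensions.
\<close>

definition unmixed :: "('a, 'r) ring_scheme \<Rightarrow> ('a, 'b, 'm) module_scheme \<Rightarrow> 'b set \<Rightarrow> bool"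
  where "unmixed R M N \<longleftrightarrow>
    (\<forall>x\<in>carrier M. x \<notin> N \<longrightarrow> (\<exists>p\<in>minimal_primes R. colon R M N x \<subseteq> p))"

lemma unmixed_zero_iff:
  "unmixed R M {\<zero>\<^bsub>M\<^esub>} \<longleftrightarrow>
    (\<forall>x\<in>carrier M. x \<noteq> \<zero>\<^bsub>M\<^esub> \<longrightarrow> (\<exists>p\<in>minimal_primes R. annihilator R M x \<subseteq> p))"
  by (simp add: unmixed_def colon_zero)

lemma depth_cong:
  fixes M :: "('a, 'b) module" and N :: "('a, 'b) module"
  assumes "carrier M = carrier N" "\<zero>\<^bsub>M\<^esub> = \<zero>\<^bsub>N\<^esub>" "ring.add M = ring.add N" "smult M = smult N"
  shows "depth R I M = depth R I N"
proof -
  have "list_smult M = list_smult N"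
    using assms unfolding list_smult_def finsum_def by simp
  then have "regular_sequence R M = regular_sequence R N"
    using assms unfolding regular_sequence_def by presburger
  then show ?thesis unfolding depth_def by presburger
qed

text \<open>
  The local ring as a module over itself and the localization of the regular module are different
  records, since their ring multiplications differ, but the depth is computed from fields in which they
  agree.
\<close>

lemma depth_local_ring:
  "depth (local_ring_at R p) (max_ideal_at R p) (regular_module (local_ring_at R p))
    = depth (local_ring_at R p) (max_ideal_at R p) (module_at R p (regular_module R))"
  by (rule depth_cong) (simp_all add: regular_module_def localize_ring_def localize_module_def)

locale one_dim_cm_ring = cring R for R (structure) +
  assumes noetherian: "noetherian_ring R" and dim: "krull_dim R = 1"
    and cm_ring: "cohen_macaulay_ring R"
begin

lemma regular_module_supports:
  assumes p: "primeideal p R" shows "supports R (regular_module R) p"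
proof -
  interpret p: primeideal p R by fact
  have "annihilator R (regular_module R) \<one> \<subseteq> p" by (auto simp: annihilator_def)
  then show ?thesis unfolding supports_def by auto
qed

lemma krull_dim_local_eq_depth:
  assumes p: "primeideal p R"
  shows "krull_dim (local_ring_at R p)
    = depth (local_ring_at R p) (max_ideal_at R p) (module_at R p (regular_module R))"
  using cm_ring p unfolding cohen_macaulay_ring_def depth_local_ring by metis

lemma krull_dim_at_minimal_prime:
  assumes "p \<in> minimal_primes R" shows "krull_dim (local_ring_at R p) = 0"
proof -
  interpret rm: module R "regular_module R" by (rule regular_module_is_module)
  show ?thesis
    using rm.depth_at_minimal_prime[OF noetherian assms] krull_dim_local_eq_depth
      regular_module_supports minimal_primesD[OF assms] by simp
qed

text \<open>
  The chain \<open>q \<subset> p\<close> gives one bound; the other one holds since \<open>dim R\<^sub>p = depth R\<^sub>p \<le> 1\<close>.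
\<close>

lemma krull_dim_at_nonminimal_prime:
  assumes p: "primeideal p R" and nonmin: "p \<notin> minimal_primes R"
  shows "krull_dim (local_ring_at R p) = 1"
proof -
  interpret rm: module R "regular_module R" by (rule regular_module_is_module)
  obtain q where "primeideal q R" "q \<subset> p" using p nonmin unfolding minimal_primes_def by blast
  then have "1 \<le> krull_dim (local_ring_at R p)" by (rule krull_dim_local_ring_ge_1[OF p])
  moreover have "krull_dim (local_ring_at R p) \<le> 1"
    unfolding krull_dim_local_eq_depth[OF p]
    by (rule rm.depth_at_prime_le_1[OF noetherian dim regular_module_fin_gen p regular_module_supports[OF p]])
  ultimately show ?thesis by (rule antisym[rotated])
qed

lemma locally_regular_element_exists:
  assumes p: "primeideal p R" and nonmin: "p \<notin> minimal_primes R"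
  shows "\<exists>a\<in>p. locally_regular R p (regular_module R) a"
proof -
  interpret rm: module R "regular_module R" by (rule regular_module_is_module)
  show ?thesis
    using rm.depth_at_nonminimal_prime_ge_1_iff[OF noetherian regular_module_fin_gen p regular_module_supports[OF p]]
      krull_dim_at_nonminimal_prime[OF p nonmin] krull_dim_local_eq_depth[OF p] by simp
qed

text \<open>
  The case \<open>N = 0\<close>, \<open>U = {1}\<close> of \<open>prime_colon_exists\<close>.
\<close>

lemma prime_annihilator_exists:
  assumes M: "module R M" and x: "x \<in> carrier M" "x \<noteq> \<zero>\<^bsub>M\<^esub>"
  shows "\<exists>y\<in>carrier M. primeideal (annihilator R M y) R \<and> annihilator R M x \<subseteq> annihilator R M y"
proof -
  interpret module R M by fact
  have "colon R M {\<zero>\<^bsub>M\<^esub>} x \<inter> {\<one>} = {}" using x by (simp add: colon_def)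
  then obtain c where c: "c \<in> carrier R" "primeideal (colon R M {\<zero>\<^bsub>M\<^esub>} (c \<odot>\<^bsub>M\<^esub> x)) R"
    using prime_colon_exists[OF noetherian zero_submodule x(1), of "{\<one>}"] by auto
  have "colon R M {\<zero>\<^bsub>M\<^esub>} x \<subseteq> colon R M {\<zero>\<^bsub>M\<^esub>} (c \<odot>\<^bsub>M\<^esub> x)"
    by (rule colon_smult_mono[OF zero_submodule x(1) c(1)])
  then show ?thesis using c x(1) unfolding colon_zero by (intro bexI[of _ "c \<odot>\<^bsub>M\<^esub> x"]) auto
qed

text \<open>
  Let \<open>q\<close> be the annihilator of \<open>y\<close>.  If \<open>q\<close> is not minimal, then \<open>depth M\<^sub>q = dim R\<^sub>q = 1\<close> provides a
  regular element \<open>a \<in> q\<close> on \<open>M\<^sub>q\<close>.  It kills \<open>y\<close>, which is impossible as \<open>y \<noteq> 0\<close> in \<open>M\<^sub>q\<close>.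
\<close>

lemma unmixed_of_max_cohen_macaulay:
  assumes "max_cohen_macaulay R M"
  shows "unmixed R M {\<zero>\<^bsub>M\<^esub>}"
  unfolding unmixed_zero_iff
proof (intro ballI impI)
  have fg: "fin_gen_module R M" using assms by (simp add: max_cohen_macaulay_def)
  interpret module R M using fg by (simp add: fin_gen_module_def)
  fix x assume x: "x \<in> carrier M" "x \<noteq> \<zero>\<^bsub>M\<^esub>"
  obtain y where y: "y \<in> carrier M" "primeideal (annihilator R M y) R" "annihilator R M x \<subseteq> annihilator R M y"
    using prime_annihilator_exists[OF module_axioms x] by blast
  define q where "q = annihilator R M y"
  have q: "primeideal q R" using y q_def by simp
  have supp: "supports R M q" using y(1) q_def unfolding supports_def by blast
  have "q \<in> minimal_primes R"
  proof (rule ccontr)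
    assume nonmin: "q \<notin> minimal_primes R"
    have "depth (local_ring_at R q) (max_ideal_at R q) (module_at R q M) = krull_dim (local_ring_at R q)"
      using assms q supp not_supports_iff[OF q] unfolding max_cohen_macaulay_def by blast
    then have "1 \<le> depth (local_ring_at R q) (max_ideal_at R q) (module_at R q M)"
      using krull_dim_at_nonminimal_prime[OF q nonmin] by simp
    then obtain a where a: "a \<in> q" "locally_regular R q M a"
      using depth_at_nonminimal_prime_ge_1_iff[OF noetherian fg q supp] by blast
    have "\<one> \<odot>\<^bsub>M\<^esub> (a \<odot>\<^bsub>M\<^esub> y) = \<zero>\<^bsub>M\<^esub>" using a(1) y(1) by (simp add: q_def annihilator_def)
    then have "\<exists>u\<in>carrier R - q. u \<odot>\<^bsub>M\<^esub> y = \<zero>\<^bsub>M\<^esub>"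
      using a(2) y(1) primeideal.complement_multiplicative(1)[OF q] unfolding locally_regular_def by blast
    then show False unfolding q_def annihilator_def by blast
  qed
  then show "\<exists>p\<in>minimal_primes R. annihilator R M x \<subseteq> p" using y(3) q_def by blast
qed

text \<open>
  Choose \<open>a \<in> p\<close> regular on \<open>R\<^sub>p\<close>.  If \<open>a\<close> were not regular on \<open>M\<^sub>p\<close>, an associated prime \<open>q \<subseteq> p\<close> of \<open>M\<close>
  would contain \<open>a\<close>.  It is minimal, hence also an associated prime of \<open>R\<close>, so that \<open>a \<in> q\<close> is not
  regular on \<open>R\<^sub>p\<close> after all.
\<close>

lemma max_cohen_macaulay_of_unmixed:
  assumes fg: "fin_gen_module R M" and un: "unmixed R M {\<zero>\<^bsub>M\<^esub>}"
  shows "max_cohen_macaulay R M"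
proof -
  interpret module R M using fg by (simp add: fin_gen_module_def)
  interpret rm: module R "regular_module R" by (rule regular_module_is_module)
  have "depth (local_ring_at R p) (max_ideal_at R p) (module_at R p M) = krull_dim (local_ring_at R p)"
    if p: "primeideal p R" and supp: "supports R M p" for p
  proof (cases "p \<in> minimal_primes R")
    case True
    then show ?thesis
      using depth_at_minimal_prime[OF noetherian True supp] krull_dim_at_minimal_prime[OF True] by simp
  next
    case False
    obtain a where a: "a \<in> p" "locally_regular R p (regular_module R) a"
      using locally_regular_element_exists[OF p False] by blast
    have ac: "a \<in> carrier R" using a(1) p by (auto dest: primeideal.axioms(1) ideal.Icarr)
    have "locally_regular R p M a"
      unfolding locally_regular_def
    proof (intro ballI impI, rule ccontr)
      fix x assume x: "x \<in> carrier M" and "\<exists>u\<in>carrier R - p. u \<odot>\<^bsub>M\<^esub> (a \<odot>\<^bsub>M\<^esub> x) = \<zero>\<^bsub>M\<^esub>"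
        and nz: "\<not> (\<exists>u\<in>carrier R - p. u \<odot>\<^bsub>M\<^esub> x = \<zero>\<^bsub>M\<^esub>)"
      then obtain u where u: "u \<in> carrier R - p" "u \<odot>\<^bsub>M\<^esub> (a \<odot>\<^bsub>M\<^esub> x) = \<zero>\<^bsub>M\<^esub>" by blast
      \<comment> \<open>Passing from \<open>x\<close> to \<open>u x\<close> makes \<open>a\<close> annihilate an element that is still nonzero in \<open>M\<^sub>p\<close>.\<close>
      define x' where "x' = u \<odot>\<^bsub>M\<^esub> x"
      have x': "x' \<in> carrier M" using u x by (simp add: x'_def)
      have ax': "a \<odot>\<^bsub>M\<^esub> x' = \<zero>\<^bsub>M\<^esub>" using u x ac by (simp add: x'_def smult_left_commute[of a u])
      have "annihilator R M x' \<subseteq> p"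
      proof
        fix v assume "v \<in> annihilator R M x'"
        then have v: "v \<in> carrier R" "(v \<otimes> u) \<odot>\<^bsub>M\<^esub> x = \<zero>\<^bsub>M\<^esub>"
          using u x by (auto simp: annihilator_def x'_def smult_assoc1)
        then have "v \<otimes> u \<notin> carrier R - p" using nz by blast
        then show "v \<in> p" using primeideal.complement_multiplicative(3)[OF p, of v u] v(1) u(1) by blast
      qed
      then obtain c where c: "c \<in> carrier R" "primeideal (annihilator R M (c \<odot>\<^bsub>M\<^esub> x')) R"
        "annihilator R M (c \<odot>\<^bsub>M\<^esub> x') \<subseteq> p"
        using prime_colon_below[OF noetherian zero_submodule x' p] unfolding colon_zero by blast
      define q where "q = annihilator R M (c \<odot>\<^bsub>M\<^esub> x')"
      have qpr: "primeideal q R" "q \<subseteq> p" using c q_def by auto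
      have aq: "a \<in> q" using ax' x' ac c(1) by (simp add: q_def annihilator_def smult_left_commute[of a c])
      have "\<one> \<notin> q" using primeideal.complement_multiplicative(1)[OF qpr(1)] by blast
      then have "c \<odot>\<^bsub>M\<^esub> x' \<noteq> \<zero>\<^bsub>M\<^esub>" using c(1) x' by (auto simp: q_def annihilator_def)
      then obtain r where "r \<in> minimal_primes R" "q \<subseteq> r"
        using un c(1) x' unfolding unmixed_zero_iff q_def by (metis smult_closed)
      then have "q \<in> minimal_primes R" using minimal_primes_antichain[OF _ qpr(1)] by metis
      then show False
        using rm.not_locally_regular_of_minimal[OF noetherian p _ qpr(2) regular_module_supports[OF qpr(1)] aq] a(2)
        by blast
    qed
    then have "1 \<le> depth (local_ring_at R p) (max_ideal_at R p) (module_at R p M)"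
      using depth_at_nonminimal_prime_ge_1_iff[OF noetherian fg p supp] a(1) by blast
    moreover have "depth (local_ring_at R p) (max_ideal_at R p) (module_at R p M) \<le> 1"
      by (rule depth_at_prime_le_1[OF noetherian dim fg p supp])
    ultimately show ?thesis using krull_dim_at_nonminimal_prime[OF p False] by simp
  qed
  then show ?thesis unfolding max_cohen_macaulay_def using fg not_supports_iff by blast
qed

lemma max_cohen_macaulay_iff_unmixed:
  "max_cohen_macaulay R M \<longleftrightarrow> fin_gen_module R M \<and> unmixed R M {\<zero>\<^bsub>M\<^esub>}"
proof
  assume M: "max_cohen_macaulay R M"
  then have "fin_gen_module R M" unfolding max_cohen_macaulay_def by (rule conjunct1)
  then show "fin_gen_module R M \<and> unmixed R M {\<zero>\<^bsub>M\<^esub>}" using unmixed_of_max_cohen_macaulay[OF M] ..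
qed (use max_cohen_macaulay_of_unmixed in blast)

end

section \<open>Homomorphisms and short exact sequences\<close>

lemma module_homD:
  assumes "h \<in> module_hom R M N"
  shows "x \<in> carrier M \<Longrightarrow> h x \<in> carrier N"
    "x \<in> carrier M \<Longrightarrow> y \<in> carrier M \<Longrightarrow> h (x \<oplus>\<^bsub>M\<^esub> y) = h x \<oplus>\<^bsub>N\<^esub> h y"
    "a \<in> carrier R \<Longrightarrow> x \<in> carrier M \<Longrightarrow> h (a \<odot>\<^bsub>M\<^esub> x) = a \<odot>\<^bsub>N\<^esub> h x"
  using assms by (auto simp: module_hom_def hom_def)

lemma module_homI:
  assumes "\<And>x. x \<in> carrier M \<Longrightarrow> h x \<in> carrier N"
    "\<And>x y. x \<in> carrier M \<Longrightarrow> y \<in> carrier M \<Longrightarrow> h (x \<oplus>\<^bsub>M\<^esub> y) = h x \<oplus>\<^bsub>N\<^esub> h y"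
    "\<And>a x. a \<in> carrier R \<Longrightarrow> x \<in> carrier M \<Longrightarrow> h (a \<odot>\<^bsub>M\<^esub> x) = a \<odot>\<^bsub>N\<^esub> h x"
  shows "h \<in> module_hom R M N"
  using assms by (auto simp: module_hom_def hom_def)

lemma module_hom_zero:
  assumes "module R M" "module R N" "h \<in> module_hom R M N"
  shows "h \<zero>\<^bsub>M\<^esub> = \<zero>\<^bsub>N\<^esub>"
proof -
  interpret M: module R M by fact
  interpret N: module R N by fact
  have "h (\<zero>\<^bsub>R\<^esub> \<odot>\<^bsub>M\<^esub> \<zero>\<^bsub>M\<^esub>) = \<zero>\<^bsub>R\<^esub> \<odot>\<^bsub>N\<^esub> h \<zero>\<^bsub>M\<^esub>" by (rule module_homD(3)[OF assms(3)]) auto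
  moreover have "h \<zero>\<^bsub>M\<^esub> \<in> carrier N" by (rule module_homD(1)[OF assms(3)]) auto
  ultimately show ?thesis by simp
qed

lemma module_hom_inj_zero_iff:
  assumes "module R M" "module R N" "h \<in> module_hom R M N" "inj_on h (carrier M)" "x \<in> carrier M"
  shows "h x = \<zero>\<^bsub>N\<^esub> \<longleftrightarrow> x = \<zero>\<^bsub>M\<^esub>"
proof -
  interpret M: module R M by fact
  show ?thesis using module_hom_zero[OF assms(1-3)] assms(4,5) M.zero_closed by (metis inj_onD)
qed

lemma module_hom_inj_iff:
  assumes "module R M" "module R N" "h \<in> module_hom R M N"
  shows "inj_on h (carrier M) \<longleftrightarrow> (\<forall>x\<in>carrier M. h x = \<zero>\<^bsub>N\<^esub> \<longrightarrow> x = \<zero>\<^bsub>M\<^esub>)"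
proof
  assume "inj_on h (carrier M)"
  then show "\<forall>x\<in>carrier M. h x = \<zero>\<^bsub>N\<^esub> \<longrightarrow> x = \<zero>\<^bsub>M\<^esub>"
    using module_hom_inj_zero_iff[OF assms] by blast
next
  interpret M: module R M by fact
  interpret N: module R N by fact
  assume *: "\<forall>x\<in>carrier M. h x = \<zero>\<^bsub>N\<^esub> \<longrightarrow> x = \<zero>\<^bsub>M\<^esub>"
  show "inj_on h (carrier M)"
  proof (rule inj_onI)
    fix x y assume x: "x \<in> carrier M" and y: "y \<in> carrier M" and eq: "h x = h y"
    have hn: "h (\<ominus>\<^bsub>M\<^esub> y \<oplus>\<^bsub>M\<^esub> z) = h (\<ominus>\<^bsub>M\<^esub> y) \<oplus>\<^bsub>N\<^esub> h z" if "z \<in> carrier M" for z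
      using y that by (intro module_homD(2)[OF assms(3)]) auto
    have "h (\<ominus>\<^bsub>M\<^esub> y \<oplus>\<^bsub>M\<^esub> x) = h (\<ominus>\<^bsub>M\<^esub> y \<oplus>\<^bsub>M\<^esub> y)" using hn x y eq by simp
    also have "\<dots> = \<zero>\<^bsub>N\<^esub>" using module_hom_zero[OF assms] y by (simp add: M.l_neg)
    finally have "\<ominus>\<^bsub>M\<^esub> y \<oplus>\<^bsub>M\<^esub> x = \<zero>\<^bsub>M\<^esub>" using * x y by simp
    then show "x = y" using x y by (metis M.a_inv_closed M.minus_equality M.minus_minus M.a_comm)
  qed
qed

lemma module_hom_vimage_submodule:
  assumes "module R M" "module R N" "h \<in> module_hom R M N" and P: "submodule P R N"
  shows "submodule {x \<in> carrier M. h x \<in> P} R M"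
proof -
  interpret M: module R M by fact
  interpret N: module R N by fact
  show ?thesis
    using N.submodule_zero[OF P] N.submoduleE[OF P] module_homD[OF assms(3)] module_hom_zero[OF assms(1-3)]
    by (intro M.submoduleI_smult) auto
qed

lemma module_hom_image_submodule:
  assumes "module R M" "module R N" "h \<in> module_hom R M N" and P: "submodule P R M"
  shows "submodule (h ` P) R N"
proof -
  interpret M: module R M by fact
  interpret N: module R N by fact
  note Pm = M.submodule_mem[OF P]
  note PE = M.submoduleE[OF P]
  note h = module_homD[OF assms(3)]
  show ?thesis
  proof (rule N.submoduleI_smult)
    show "h ` P \<subseteq> carrier N" using Pm h(1) by blast
    show "\<zero>\<^bsub>N\<^esub> \<in> h ` P" using M.submodule_zero[OF P] module_hom_zero[OF assms(1-3)] by (metis image_eqI)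
  next
    fix u v assume "u \<in> h ` P" "v \<in> h ` P"
    then obtain x y where "x \<in> P" "y \<in> P" "u = h x" "v = h y" by blast
    then show "u \<oplus>\<^bsub>N\<^esub> v \<in> h ` P" using h(2) Pm PE(5) by (intro image_eqI[of _ _ "x \<oplus>\<^bsub>M\<^esub> y"]) auto
  next
    fix a u assume "a \<in> carrier R" "u \<in> h ` P"
    then obtain x where "a \<in> carrier R" "x \<in> P" "u = h x" by blast
    then show "a \<odot>\<^bsub>N\<^esub> u \<in> h ` P" using h(3) Pm PE(4) by (intro image_eqI[of _ _ "a \<odot>\<^bsub>M\<^esub> x"]) auto
  qed
qed

lemma a_kernel_submodule:
  assumes "module R M" "module R N" "h \<in> module_hom R M N"
  shows "submodule (a_kernel M N h) R M"
  using module_hom_vimage_submodule[OF assms module.zero_submodule[OF assms(2)]]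
  by (simp add: a_kernel_def')

lemma fin_gen_module_surj_image:
  assumes M: "fin_gen_module R M" and N: "module R N" and h: "h \<in> module_hom R M N"
    and surj: "h ` carrier M = carrier N"
  shows "fin_gen_module R N"
proof -
  have Mm: "module R M" using M by (simp add: fin_gen_module_def)
  interpret M: module R M by fact
  interpret N: module R N by fact
  obtain B where B: "finite B" "B \<subseteq> carrier M" "mspan R M B = carrier M"
    using M unfolding fin_gen_module_iff_mspan by (elim conjE exE)
  have hB: "h ` B \<subseteq> carrier N" using B(2) surj by blast
  note P = N.mspan_submodule[OF hB]
  have "mspan R M B \<subseteq> {x \<in> carrier M. h x \<in> mspan R N (h ` B)}"
    using B(2) N.mspan_superset[of "h ` B"]
    by (intro M.mspan_least module_hom_vimage_submodule[OF Mm N h P]) blast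
  then have "carrier N \<subseteq> mspan R N (h ` B)" unfolding B(3) surj[symmetric] by blast
  then have "mspan R N (h ` B) = carrier N" using N.submodule_subset[OF P] by blast
  then show ?thesis unfolding fin_gen_module_iff_mspan using N B(1) hB by blast
qed

lemma module_hom_comp:
  assumes "f \<in> module_hom R A B" "g \<in> module_hom R B C"
  shows "g \<circ> f \<in> module_hom R A C"
  using module_homD[OF assms(1)] module_homD[OF assms(2)] by (intro module_homI) auto

lemma module_hom_inv_into:
  assumes A: "module R A" and h: "h \<in> module_hom R A B" and bij: "bij_betw h (carrier A) (carrier B)"
  shows "inv_into (carrier A) h \<in> module_hom R B A"
proof -
  interpret A: module R A by fact
  let ?k = "inv_into (carrier A) h"
  have inv: "?k (h x) = x" if "x \<in> carrier A" for x
    using that bij by (simp add: bij_betw_def)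
  have surj: "\<exists>x\<in>carrier A. y = h x" if "y \<in> carrier B" for y
    using that bij by (auto simp: bij_betw_def)
  show ?thesis
  proof (rule module_homI)
    fix x assume "x \<in> carrier B"
    then obtain a where a: "a \<in> carrier A" "x = h a" using surj by blast
    then show "?k x \<in> carrier A" by (simp add: inv)
    fix r assume r: "r \<in> carrier R"
    show "?k (r \<odot>\<^bsub>B\<^esub> x) = r \<odot>\<^bsub>A\<^esub> ?k x"
      using a r inv[of "r \<odot>\<^bsub>A\<^esub> a"] module_homD(3)[OF h r a(1)] by (simp add: inv)
  next
    fix x y assume "x \<in> carrier B" "y \<in> carrier B"
    then obtain a b where a: "a \<in> carrier A" "x = h a" "b \<in> carrier A" "y = h b" using surj by metis
    then show "?k (x \<oplus>\<^bsub>B\<^esub> y) = ?k x \<oplus>\<^bsub>A\<^esub> ?k y"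
      using inv[of "a \<oplus>\<^bsub>A\<^esub> b"] module_homD(2)[OF h a(1,3)] by (simp add: inv)
  qed
qed

lemma module_isomorphic_sym:
  assumes "module R A" "module_isomorphic R A B" shows "module_isomorphic R B A"
  using assms module_hom_inv_into[OF assms(1)] bij_betw_inv_into unfolding module_isomorphic_def by metis

lemma module_isomorphic_trans:
  assumes "module_isomorphic R A B" "module_isomorphic R B C" shows "module_isomorphic R A C"
  using assms module_hom_comp bij_betw_trans unfolding module_isomorphic_def by metis

lemma module_isomorphicI:
  assumes "h \<in> module_hom R A B" "inj_on h (carrier A)" "h ` carrier A = carrier B"
  shows "module_isomorphic R A B"
  using assms unfolding module_isomorphic_def bij_betw_def by blast

lemma annihilator_inj_hom:
  assumes "module R A" "module R B" "f \<in> module_hom R A B" "inj_on f (carrier A)" "x \<in> carrier A"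
  shows "annihilator R B (f x) = annihilator R A x"
proof -
  interpret A: module R A by fact
  have "r \<odot>\<^bsub>B\<^esub> f x = \<zero>\<^bsub>B\<^esub> \<longleftrightarrow> r \<odot>\<^bsub>A\<^esub> x = \<zero>\<^bsub>A\<^esub>" if "r \<in> carrier R" for r
    using module_hom_inj_zero_iff[OF assms(1-4), of "r \<odot>\<^bsub>A\<^esub> x"] that assms(5)
      module_homD(3)[OF assms(3) that assms(5)] by simp
  then show ?thesis unfolding annihilator_def by blast
qed

lemma unmixed_inj_hom:
  assumes "module R A" "module R B" "f \<in> module_hom R A B" "inj_on f (carrier A)"
    and "unmixed R B {\<zero>\<^bsub>B\<^esub>}"
  shows "unmixed R A {\<zero>\<^bsub>A\<^esub>}"
  unfolding unmixed_zero_iff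
proof (intro ballI impI)
  fix x assume x: "x \<in> carrier A" "x \<noteq> \<zero>\<^bsub>A\<^esub>"
  then have "f x \<noteq> \<zero>\<^bsub>B\<^esub>" using module_hom_inj_zero_iff[OF assms(1-4)] by simp
  then have "\<exists>p\<in>minimal_primes R. annihilator R B (f x) \<subseteq> p"
    using assms(5) module_homD(1)[OF assms(3) x(1)] unfolding unmixed_zero_iff by blast
  then show "\<exists>p\<in>minimal_primes R. annihilator R A x \<subseteq> p"
    unfolding annihilator_inj_hom[OF assms(1-4) x(1)] .
qed

lemma supports_inj_hom:
  assumes "module R A" "module R B" "f \<in> module_hom R A B" "inj_on f (carrier A)"
    and "supports R A p"
  shows "supports R B p"
proof -
  obtain x where x: "x \<in> carrier A" "annihilator R A x \<subseteq> p" using assms(5) unfolding supports_def by blast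
  then have "annihilator R B (f x) \<subseteq> p" unfolding annihilator_inj_hom[OF assms(1-4) x(1)] by simp
  then show ?thesis using module_homD(1)[OF assms(3) x(1)] unfolding supports_def by blast
qed

text \<open>
  Short exact sequences between modules whose elements may have different types, as occur with
  quotients and direct sums; for elements of one type this is the exactness in a conflation.
\<close>

definition short_exact ::
    "('a, 'r) ring_scheme \<Rightarrow> ('a, 'b, 'l) module_scheme \<Rightarrow> ('a, 'c, 'm) module_scheme \<Rightarrow>
      ('a, 'd, 'n) module_scheme \<Rightarrow> ('b \<Rightarrow> 'c) \<Rightarrow> ('c \<Rightarrow> 'd) \<Rightarrow> bool"
  where "short_exact R A B C f g \<longleftrightarrow> f \<in> module_hom R A B \<and> g \<in> module_hom R B C \<and>
    inj_on f (carrier A) \<and> f ` carrier A = a_kernel B C g \<and> g ` carrier B = carrier C"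

lemma conflation_iff_short_exact:
  "conflation R E A B C f g \<longleftrightarrow> A \<in> E \<and> B \<in> E \<and> C \<in> E \<and> short_exact R A B C f g"
  by (simp add: conflation_def short_exact_def)

lemma short_exactD:
  assumes "short_exact R A B C f g"
  shows "f \<in> module_hom R A B" "g \<in> module_hom R B C" "inj_on f (carrier A)"
    "x \<in> carrier A \<Longrightarrow> g (f x) = \<zero>\<^bsub>C\<^esub>"
    "y \<in> carrier B \<Longrightarrow> g y = \<zero>\<^bsub>C\<^esub> \<Longrightarrow> \<exists>x\<in>carrier A. y = f x"
    "g ` carrier B = carrier C"
  using assms by (auto simp: short_exact_def a_kernel_def')

lemma short_exactI:
  assumes "f \<in> module_hom R A B" "g \<in> module_hom R B C" "inj_on f (carrier A)"
    "\<And>x. x \<in> carrier A \<Longrightarrow> g (f x) = \<zero>\<^bsub>C\<^esub>"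
    "\<And>y. y \<in> carrier B \<Longrightarrow> g y = \<zero>\<^bsub>C\<^esub> \<Longrightarrow> \<exists>x\<in>carrier A. y = f x"
    "g ` carrier B = carrier C"
  shows "short_exact R A B C f g"
  using assms module_homD(1)[OF assms(1)] by (auto simp: short_exact_def a_kernel_def')

lemma annihilator_hom_mono:
  assumes "module R A" "module R B" "g \<in> module_hom R A B" "x \<in> carrier A"
  shows "annihilator R A x \<subseteq> annihilator R B (g x)"
proof
  fix r assume "r \<in> annihilator R A x"
  then have r: "r \<in> carrier R" "r \<odot>\<^bsub>A\<^esub> x = \<zero>\<^bsub>A\<^esub>" by (auto simp: annihilator_def)
  have "r \<odot>\<^bsub>B\<^esub> g x = g (r \<odot>\<^bsub>A\<^esub> x)" by (rule module_homD(3)[OF assms(3) r(1) assms(4), symmetric])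
  then show "r \<in> annihilator R B (g x)"
    using r module_hom_zero[OF assms(1-3)] by (simp add: annihilator_def)
qed

lemma unmixed_extension:
  assumes A: "module R A" and B: "module R B" and C: "module R C" and ex: "short_exact R A B C f g"
    and uA: "unmixed R A {\<zero>\<^bsub>A\<^esub>}" and uC: "unmixed R C {\<zero>\<^bsub>C\<^esub>}"
  shows "unmixed R B {\<zero>\<^bsub>B\<^esub>}"
  unfolding unmixed_zero_iff
proof (intro ballI impI)
  note e = short_exactD[OF ex]
  fix x assume x: "x \<in> carrier B" "x \<noteq> \<zero>\<^bsub>B\<^esub>"
  show "\<exists>p\<in>minimal_primes R. annihilator R B x \<subseteq> p"
  proof (cases "g x = \<zero>\<^bsub>C\<^esub>")
    case True
    then obtain a where a: "a \<in> carrier A" "x = f a" using e(5) x by blast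
    then have "a \<noteq> \<zero>\<^bsub>A\<^esub>" using x(2) module_hom_zero[OF A B e(1)] by auto
    then show ?thesis
      using uA a annihilator_inj_hom[OF A B e(1,3) a(1)] unfolding unmixed_zero_iff by simp
  next
    case False
    then obtain p where "p \<in> minimal_primes R" "annihilator R C (g x) \<subseteq> p"
      using uC module_homD(1)[OF e(2) x(1)] unfolding unmixed_zero_iff by blast
    then show ?thesis using annihilator_hom_mono[OF B C e(2) x(1)] by blast
  qed
qed

text \<open>
  Localization is exact: if \<open>u\<close> kills the image of \<open>x\<close> in \<open>C\<close> and \<open>v\<close> kills the element of \<open>A\<close> that
  corresponds to \<open>u x\<close>, then \<open>v u\<close> kills \<open>x\<close>.
\<close>

lemma supports_extension_iff:
  assumes A: "module R A" and B: "module R B" and C: "module R C" and ex: "short_exact R A B C f g"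
    and p: "primeideal p R"
  shows "supports R B p \<longleftrightarrow> supports R A p \<or> supports R C p"
proof
  interpret A: module R A by fact
  interpret B: module R B by fact
  interpret C: module R C by fact
  note e = short_exactD[OF ex]
  show "supports R A p \<or> supports R C p" if "supports R B p"
  proof (rule ccontr)
    assume "\<not> (supports R A p \<or> supports R C p)"
    then have nA: "\<And>x. x \<in> carrier A \<Longrightarrow> \<exists>u\<in>carrier R - p. u \<odot>\<^bsub>A\<^esub> x = \<zero>\<^bsub>A\<^esub>"
      and nC: "\<And>x. x \<in> carrier C \<Longrightarrow> \<exists>u\<in>carrier R - p. u \<odot>\<^bsub>C\<^esub> x = \<zero>\<^bsub>C\<^esub>"
      unfolding supports_def annihilator_def by blast+
    obtain x where x: "x \<in> carrier B" "annihilator R B x \<subseteq> p" using \<open>supports R B p\<close> unfolding supports_def by blast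
    obtain u where u: "u \<in> carrier R - p" "u \<odot>\<^bsub>C\<^esub> g x = \<zero>\<^bsub>C\<^esub>" using nC[OF module_homD(1)[OF e(2) x(1)]] by blast
    have "g (u \<odot>\<^bsub>B\<^esub> x) = \<zero>\<^bsub>C\<^esub>" using u module_homD(3)[OF e(2) _ x(1)] by simp
    then obtain a where a: "a \<in> carrier A" "u \<odot>\<^bsub>B\<^esub> x = f a" using e(5)[of "u \<odot>\<^bsub>B\<^esub> x"] u x by auto
    obtain v where v: "v \<in> carrier R - p" "v \<odot>\<^bsub>A\<^esub> a = \<zero>\<^bsub>A\<^esub>" using nA[OF a(1)] by blast
    have "(v \<otimes>\<^bsub>R\<^esub> u) \<odot>\<^bsub>B\<^esub> x = v \<odot>\<^bsub>B\<^esub> f a"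
      using v(1) u(1) x(1) a(2) by (simp add: B.smult_assoc1)
    also have "\<dots> = f (v \<odot>\<^bsub>A\<^esub> a)" using v(1) a(1) module_homD(3)[OF e(1)] by simp
    finally have "(v \<otimes>\<^bsub>R\<^esub> u) \<odot>\<^bsub>B\<^esub> x = f (v \<odot>\<^bsub>A\<^esub> a)" .
    then have "(v \<otimes>\<^bsub>R\<^esub> u) \<odot>\<^bsub>B\<^esub> x = \<zero>\<^bsub>B\<^esub>" unfolding v(2) module_hom_zero[OF A B e(1)] .
    then have "v \<otimes>\<^bsub>R\<^esub> u \<in> p" using x(2) v u unfolding annihilator_def by auto
    then show False using primeideal.complement_multiplicative(3)[OF p v(1) u(1)] by blast
  qed
  assume "supports R A p \<or> supports R C p"
  then show "supports R B p"
  proof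
    assume "supports R C p"
    then obtain c where c: "c \<in> carrier C" "annihilator R C c \<subseteq> p" unfolding supports_def by blast
    then obtain b where b: "b \<in> carrier B" "c = g b" using e(6) by blast
    then show ?thesis using annihilator_hom_mono[OF B C e(2) b(1)] c(2) unfolding supports_def by blast
  qed (rule supports_inj_hom[OF A B e(1,3)])
qed

lemma fin_gen_module_extension:
  assumes A: "fin_gen_module R A" and B: "module R B" and C: "fin_gen_module R C"
    and ex: "short_exact R A B C f g"
  shows "fin_gen_module R B"
proof -
  have Am: "module R A" and Cm: "module R C" using A C by (simp_all add: fin_gen_module_def)
  interpret A: module R A by fact
  interpret B: module R B by fact
  interpret C: module R C by fact
  note e = short_exactD[OF ex]
  obtain G where G: "finite G" "G \<subseteq> carrier A" "mspan R A G = carrier A"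
    using A unfolding fin_gen_module_iff_mspan by (elim conjE exE)
  obtain H where H: "finite H" "H \<subseteq> carrier C" "mspan R C H = carrier C"
    using C unfolding fin_gen_module_iff_mspan by (elim conjE exE)
  obtain K where K: "K \<subseteq> carrier B" "finite K" "H = g ` K"
    using finite_subset_image[OF H(1), of g "carrier B"] H(2) e(6) by metis
  define P where "P = mspan R B (f ` G \<union> K)"
  have fG: "f ` G \<subseteq> carrier B" using G(2) module_homD(1)[OF e(1)] by blast
  have gens: "f ` G \<union> K \<subseteq> carrier B" using fG K(1) by blast
  have P: "submodule P R B" unfolding P_def by (rule B.mspan_submodule[OF gens])
  have GP: "f ` G \<union> K \<subseteq> P" unfolding P_def by (rule B.mspan_superset)
  have "mspan R A G \<subseteq> {x \<in> carrier A. f x \<in> P}"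
    using G(2) GP by (intro A.mspan_least module_hom_vimage_submodule[OF Am B e(1) P]) blast
  then have fP: "f a \<in> P" if "a \<in> carrier A" for a using that G(3) by blast
  have "mspan R C H \<subseteq> g ` P"
    unfolding K(3) using GP by (intro C.mspan_least module_hom_image_submodule[OF B Cm e(2) P]) blast
  then have gP: "carrier C \<subseteq> g ` P" using H(3) by simp
  have "carrier B \<subseteq> P"
  proof
    fix b assume b: "b \<in> carrier B"
    then obtain b' where b': "b' \<in> P" "g b = g b'" using gP module_homD(1)[OF e(2)] by blast
    have b'c: "b' \<in> carrier B" using b' B.submodule_mem[OF P] by blast
    have "g (\<ominus>\<^bsub>B\<^esub> b' \<oplus>\<^bsub>B\<^esub> b) = g (\<ominus>\<^bsub>B\<^esub> b') \<oplus>\<^bsub>C\<^esub> g b'"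
      using module_homD(2)[OF e(2), of "\<ominus>\<^bsub>B\<^esub> b'" b] b b'c b'(2) by simp
    also have "\<dots> = g (\<ominus>\<^bsub>B\<^esub> b' \<oplus>\<^bsub>B\<^esub> b')" using module_homD(2)[OF e(2), of "\<ominus>\<^bsub>B\<^esub> b'" b'] b'c by simp
    also have "\<dots> = \<zero>\<^bsub>C\<^esub>" using b'c module_hom_zero[OF B Cm e(2)] by (simp add: B.l_neg)
    finally obtain a where "a \<in> carrier A" "\<ominus>\<^bsub>B\<^esub> b' \<oplus>\<^bsub>B\<^esub> b = f a"
      using e(5)[of "\<ominus>\<^bsub>B\<^esub> b' \<oplus>\<^bsub>B\<^esub> b"] b b'c by auto
    then have "\<ominus>\<^bsub>B\<^esub> b' \<oplus>\<^bsub>B\<^esub> b \<in> P" using fP by simp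
    then show "b \<in> P" using B.submodule_add_iff(1)[OF P _ b] B.submoduleE(3)[OF P b'(1)] by blast
  qed
  then have "mspan R B (f ` G \<union> K) = carrier B" using B.submodule_subset[OF P] P_def by blast
  then show ?thesis
    unfolding fin_gen_module_iff_mspan using B G(1) K(2) gens
    by (intro conjI exI[of _ "f ` G \<union> K"]) simp_all
qed


lemma short_exact_iso:
  assumes mods: "module R A" "module R B" "module R C" "module R A'" "module R B'" "module R C'"
    and ex: "short_exact R A B C f g"
    and isos: "module_isomorphic R A A'" "module_isomorphic R B B'" "module_isomorphic R C C'"
  shows "\<exists>f' g'. short_exact R A' B' C' f' g'"
proof -
  obtain \<alpha> \<beta> \<gamma> where a: "\<alpha> \<in> module_hom R A' A" "bij_betw \<alpha> (carrier A') (carrier A)"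
    and b: "\<beta> \<in> module_hom R B B'" "bij_betw \<beta> (carrier B) (carrier B')"
    and c: "\<gamma> \<in> module_hom R C C'" "bij_betw \<gamma> (carrier C) (carrier C')"
    using module_isomorphic_sym[OF mods(1) isos(1)] isos(2,3) unfolding module_isomorphic_def by blast
  obtain \<beta>' where b': "\<beta>' \<in> module_hom R B' B" "bij_betw \<beta>' (carrier B') (carrier B)"
    "\<And>x. x \<in> carrier B \<Longrightarrow> \<beta>' (\<beta> x) = x" "\<And>y. y \<in> carrier B' \<Longrightarrow> \<beta> (\<beta>' y) = y"
    using module_hom_inv_into[OF mods(2) b] bij_betw_inv_into[OF b(2)]
      bij_betw_inv_into_left[OF b(2)] bij_betw_inv_into_right[OF b(2)] by blast
  note e = short_exactD[OF ex]
  note ah = module_homD(1)[OF a(1)] and fh = module_homD(1)[OF e(1)] and bh' = module_homD(1)[OF b'(1)]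
  have "short_exact R A' B' C' (\<beta> \<circ> (f \<circ> \<alpha>)) (\<gamma> \<circ> (g \<circ> \<beta>'))"
  proof (rule short_exactI)
    show "\<beta> \<circ> (f \<circ> \<alpha>) \<in> module_hom R A' B'" by (rule module_hom_comp[OF module_hom_comp[OF a(1) e(1)] b(1)])
    show "\<gamma> \<circ> (g \<circ> \<beta>') \<in> module_hom R B' C'" by (rule module_hom_comp[OF module_hom_comp[OF b'(1) e(2)] c(1)])
    show "inj_on (\<beta> \<circ> (f \<circ> \<alpha>)) (carrier A')"
    proof (rule inj_onI)
      fix x y assume xy: "x \<in> carrier A'" "y \<in> carrier A'" "(\<beta> \<circ> (f \<circ> \<alpha>)) x = (\<beta> \<circ> (f \<circ> \<alpha>)) y"
      have "f (\<alpha> x) = \<beta>' (\<beta> (f (\<alpha> x)))" by (rule b'(3)[OF fh[OF ah[OF xy(1)]], symmetric])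
      also have "\<dots> = \<beta>' (\<beta> (f (\<alpha> y)))" using xy(3) by (simp only: comp_apply)
      also have "\<dots> = f (\<alpha> y)" by (rule b'(3)[OF fh[OF ah[OF xy(2)]]])
      finally have "f (\<alpha> x) = f (\<alpha> y)" .
      then have "\<alpha> x = \<alpha> y" using e(3) ah xy by (auto dest: inj_onD)
      then show "x = y" using a(2) xy unfolding bij_betw_def by (auto dest: inj_onD)
    qed
    show "(\<gamma> \<circ> (g \<circ> \<beta>')) ((\<beta> \<circ> (f \<circ> \<alpha>)) x) = \<zero>\<^bsub>C'\<^esub>" if x: "x \<in> carrier A'" for x
      using b'(3)[OF fh[OF ah[OF x]]] e(4)[OF ah[OF x]] module_hom_zero[OF mods(3,6) c(1)] by simp
    show "\<exists>x\<in>carrier A'. y = (\<beta> \<circ> (f \<circ> \<alpha>)) x"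
      if y: "y \<in> carrier B'" and gy: "(\<gamma> \<circ> (g \<circ> \<beta>')) y = \<zero>\<^bsub>C'\<^esub>" for y
    proof -
      have "g (\<beta>' y) = \<zero>\<^bsub>C\<^esub>"
        using gy module_hom_inj_zero_iff[OF mods(3,6) c(1) bij_betw_imp_inj_on[OF c(2)]
            module_homD(1)[OF e(2) bh'[OF y]]] by simp
      then obtain x where x: "x \<in> carrier A" "\<beta>' y = f x" using e(5) bh'[OF y] by blast
      obtain x' where x': "x' \<in> carrier A'" "x = \<alpha> x'" using x(1) a(2) unfolding bij_betw_def by blast
      have "y = \<beta> (f (\<alpha> x'))" using b'(4)[OF y] x(2) x'(2) by simp
      then show ?thesis using x'(1) by auto
    qed
    have "(\<gamma> \<circ> (g \<circ> \<beta>')) ` carrier B' = \<gamma> ` (g ` (\<beta>' ` carrier B'))" by (simp add: image_comp)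
    then show "(\<gamma> \<circ> (g \<circ> \<beta>')) ` carrier B' = carrier C'"
      using b'(2) e(6) c(2) unfolding bij_betw_def by simp
  qed
  then show ?thesis by blast
qed

section \<open>Quotient modules and direct sums\<close>

text \<open>
  Images of modules under operation-preserving maps are modules, which transfers all axioms to
  quotients at once.
\<close>

lemma module_of_surj:
  assumes M: "module R M" and h: "h ` carrier M = carrier Q" "h \<zero>\<^bsub>M\<^esub> = \<zero>\<^bsub>Q\<^esub>"
    "\<And>x y. x \<in> carrier M \<Longrightarrow> y \<in> carrier M \<Longrightarrow> h x \<oplus>\<^bsub>Q\<^esub> h y = h (x \<oplus>\<^bsub>M\<^esub> y)"
    "\<And>a x. a \<in> carrier R \<Longrightarrow> x \<in> carrier M \<Longrightarrow> a \<odot>\<^bsub>Q\<^esub> h x = h (a \<odot>\<^bsub>M\<^esub> x)"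
  shows "module R Q"
proof -
  interpret module R M by fact
  have "abelian_group Q"
  proof (rule abelian_groupI)
    fix x assume "x \<in> carrier Q"
    then obtain m where m: "m \<in> carrier M" "x = h m" using h(1) by blast
    then have "h (\<ominus>\<^bsub>M\<^esub> m) \<oplus>\<^bsub>Q\<^esub> x = \<zero>\<^bsub>Q\<^esub>" by (simp add: h M.l_neg)
    then show "\<exists>y\<in>carrier Q. y \<oplus>\<^bsub>Q\<^esub> x = \<zero>\<^bsub>Q\<^esub>" using m h(1) M.a_inv_closed by blast
  qed (unfold h(1)[symmetric], auto simp: h(2)[symmetric] h(3) M.a_ac)
  then show ?thesis
    by (rule moduleI[OF R.is_cring], unfold h(1)[symmetric])
      (auto simp: h(3,4) smult_l_distr smult_r_distr smult_assoc1)
qed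

definition residue_class :: "('a, 'b, 'm) module_scheme \<Rightarrow> 'b set \<Rightarrow> 'b \<Rightarrow> 'b set"
  where "residue_class M N x = (\<lambda>n. x \<oplus>\<^bsub>M\<^esub> n) ` N"

text \<open>
  The unions over representatives avoid a choice: all representatives contribute the same class.
\<close>

definition quotient_module :: "('a, 'b, 'm) module_scheme \<Rightarrow> 'b set \<Rightarrow> ('a, 'b set) module"
  where "quotient_module M N =
    \<lparr>carrier = residue_class M N ` carrier M, monoid.mult = undefined, one = undefined,
     ring.zero = residue_class M N \<zero>\<^bsub>M\<^esub>,
     ring.add = (\<lambda>U V. \<Union>x\<in>U. \<Union>y\<in>V. residue_class M N (x \<oplus>\<^bsub>M\<^esub> y)),
     smult = (\<lambda>a U. \<Union>x\<in>U. residue_class M N (a \<odot>\<^bsub>M\<^esub> x))\<rparr>"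

lemma (in module) residue_class_eq_iff:
  assumes N: "submodule N R M" and x: "x \<in> carrier M" and y: "y \<in> carrier M"
  shows "residue_class M N x = residue_class M N y \<longleftrightarrow> x \<in> residue_class M N y"
proof
  have "x \<in> residue_class M N x"
    unfolding residue_class_def using submodule_zero[OF N] x by (intro image_eqI[of _ _ "\<zero>\<^bsub>M\<^esub>"]) auto
  then show "x \<in> residue_class M N y" if "residue_class M N x = residue_class M N y" using that by simp
  assume "x \<in> residue_class M N y"
  then obtain n where n: "n \<in> N" "x = y \<oplus>\<^bsub>M\<^esub> n" unfolding residue_class_def by blast
  have nc: "n \<in> carrier M" using n(1) by (rule submodule_mem[OF N])
  show "residue_class M N x = residue_class M N y"
  proof
    show "residue_class M N x \<subseteq> residue_class M N y"
    proof
      fix z assume "z \<in> residue_class M N x"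
      then obtain k where k: "k \<in> N" "z = x \<oplus>\<^bsub>M\<^esub> k" unfolding residue_class_def by blast
      then have "z = y \<oplus>\<^bsub>M\<^esub> (n \<oplus>\<^bsub>M\<^esub> k)" using n nc y submodule_mem[OF N k(1)] by (simp add: M.a_assoc)
      then show "z \<in> residue_class M N y"
        unfolding residue_class_def using submoduleE(5)[OF N n(1) k(1)] by blast
    qed
    show "residue_class M N y \<subseteq> residue_class M N x"
    proof
      fix z assume "z \<in> residue_class M N y"
      then obtain k where k: "k \<in> N" "z = y \<oplus>\<^bsub>M\<^esub> k" unfolding residue_class_def by blast
      then have "z = x \<oplus>\<^bsub>M\<^esub> (\<ominus>\<^bsub>M\<^esub> n \<oplus>\<^bsub>M\<^esub> k)"
        using n nc y submodule_mem[OF N k(1)] by (simp add: M.a_assoc M.r_neg2)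
      then show "z \<in> residue_class M N x"
        unfolding residue_class_def using submoduleE(5)[OF N submoduleE(3)[OF N n(1)] k(1)] by blast
    qed
  qed
qed

lemma (in module) quotient_module_hom:
  assumes N: "submodule N R M"
  shows "module R (quotient_module M N)"
    "residue_class M N \<in> module_hom R M (quotient_module M N)"
    "residue_class M N ` carrier M = carrier (quotient_module M N)"
    "\<And>x. x \<in> carrier M \<Longrightarrow> residue_class M N x = \<zero>\<^bsub>quotient_module M N\<^esub> \<longleftrightarrow> x \<in> N"
proof -
  let ?Q = "quotient_module M N" and ?h = "residue_class M N"
  have self: "x \<in> ?h x" if "x \<in> carrier M" for x
    using residue_class_eq_iff[OF N that that] by simp
  have memD: "y \<in> carrier M" "\<exists>n\<in>N. y = x \<oplus>\<^bsub>M\<^esub> n" if "y \<in> ?h x" "x \<in> carrier M" for x y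
    using that submodule_mem[OF N] unfolding residue_class_def by auto
  have add: "?h x \<oplus>\<^bsub>?Q\<^esub> ?h y = ?h (x \<oplus>\<^bsub>M\<^esub> y)" if x: "x \<in> carrier M" and y: "y \<in> carrier M" for x y
  proof -
    have "?h (x' \<oplus>\<^bsub>M\<^esub> y') = ?h (x \<oplus>\<^bsub>M\<^esub> y)" if x': "x' \<in> ?h x" and y': "y' \<in> ?h y" for x' y'
    proof -
      obtain n k where *: "n \<in> N" "k \<in> N" "x' = x \<oplus>\<^bsub>M\<^esub> n" "y' = y \<oplus>\<^bsub>M\<^esub> k"
        using memD(2)[OF x' x] memD(2)[OF y' y] by blast
      then have "x' \<oplus>\<^bsub>M\<^esub> y' = (x \<oplus>\<^bsub>M\<^esub> y) \<oplus>\<^bsub>M\<^esub> (n \<oplus>\<^bsub>M\<^esub> k)"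
        using x y submodule_mem[OF N] by (simp add: M.a_ac)
      then have "x' \<oplus>\<^bsub>M\<^esub> y' \<in> ?h (x \<oplus>\<^bsub>M\<^esub> y)"
        unfolding residue_class_def using submoduleE(5)[OF N *(1,2)] by blast
      then show ?thesis using residue_class_eq_iff[OF N, of "x' \<oplus>\<^bsub>M\<^esub> y'" "x \<oplus>\<^bsub>M\<^esub> y"]
          memD(1)[OF x' x] memD(1)[OF y' y] x y by simp
    qed
    then have "(\<Union>x'\<in>?h x. \<Union>y'\<in>?h y. ?h (x' \<oplus>\<^bsub>M\<^esub> y')) = ?h (x \<oplus>\<^bsub>M\<^esub> y)"
      by (intro UN_constant_eq[OF self[OF x]] UN_constant_eq[OF self[OF y]] ballI)
    then show ?thesis by (simp add: quotient_module_def)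
  qed
  have smult: "a \<odot>\<^bsub>?Q\<^esub> ?h x = ?h (a \<odot>\<^bsub>M\<^esub> x)" if a: "a \<in> carrier R" and x: "x \<in> carrier M" for a x
  proof -
    have "?h (a \<odot>\<^bsub>M\<^esub> x') = ?h (a \<odot>\<^bsub>M\<^esub> x)" if x': "x' \<in> ?h x" for x'
    proof -
      obtain n where *: "n \<in> N" "x' = x \<oplus>\<^bsub>M\<^esub> n" using memD(2)[OF x' x] by blast
      then have "a \<odot>\<^bsub>M\<^esub> x' = a \<odot>\<^bsub>M\<^esub> x \<oplus>\<^bsub>M\<^esub> a \<odot>\<^bsub>M\<^esub> n"
        using x a submodule_mem[OF N] by (simp add: smult_r_distr)
      then have "a \<odot>\<^bsub>M\<^esub> x' \<in> ?h (a \<odot>\<^bsub>M\<^esub> x)"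
        unfolding residue_class_def using submoduleE(4)[OF N a *(1)] by blast
      then show ?thesis using residue_class_eq_iff[OF N, of "a \<odot>\<^bsub>M\<^esub> x'" "a \<odot>\<^bsub>M\<^esub> x"]
          memD(1)[OF x' x] a x by simp
    qed
    then have "(\<Union>x'\<in>?h x. ?h (a \<odot>\<^bsub>M\<^esub> x')) = ?h (a \<odot>\<^bsub>M\<^esub> x)" by (intro UN_constant_eq[OF self[OF x]] ballI)
    then show ?thesis by (simp add: quotient_module_def)
  qed
  show surj: "?h ` carrier M = carrier ?Q" by (simp add: quotient_module_def)
  have zero: "?h \<zero>\<^bsub>M\<^esub> = \<zero>\<^bsub>?Q\<^esub>" by (simp add: quotient_module_def)
  show "module R ?Q" by (rule module_of_surj[OF module_axioms surj zero add smult])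
  show "?h \<in> module_hom R M ?Q"
    using surj by (intro module_homI) (auto simp: add smult)
  show "?h x = \<zero>\<^bsub>?Q\<^esub> \<longleftrightarrow> x \<in> N" if x: "x \<in> carrier M" for x
  proof -
    have "?h \<zero>\<^bsub>M\<^esub> = N" using submodule_mem[OF N] unfolding residue_class_def by force
    then show ?thesis using residue_class_eq_iff[OF N x M.zero_closed] zero by simp
  qed
qed

lemma (in module) submodule_module: "submodule N R M \<Longrightarrow> module R (M\<lparr>carrier := N\<rparr>)"
  by (rule submodule.submodule_is_module[OF _ module_axioms])

lemma (in module) short_exact_quotient:
  assumes N: "submodule N R M"
  shows "short_exact R (M\<lparr>carrier := N\<rparr>) M (quotient_module M N) (\<lambda>x. x) (residue_class M N)"
proof (rule short_exactI)
  show "(\<lambda>x. x) \<in> module_hom R (M\<lparr>carrier := N\<rparr>) M"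
    using submodule_mem[OF N] by (intro module_homI) auto
qed (use quotient_module_hom[OF N] submodule_mem[OF N] in auto)

lemma short_exact_kernel:
  assumes "g \<in> module_hom R M C" "g ` carrier M = carrier C"
  shows "short_exact R (M\<lparr>carrier := a_kernel M C g\<rparr>) M C (\<lambda>x. x) g"
proof (rule short_exactI)
  show "(\<lambda>x. x) \<in> module_hom R (M\<lparr>carrier := a_kernel M C g\<rparr>) M"
    by (rule module_homI) (auto simp: a_kernel_def')
qed (use assms in \<open>auto simp: a_kernel_def'\<close>)

lemma (in module) annihilator_quotient:
  assumes N: "submodule N R M" and x: "x \<in> carrier M"
  shows "annihilator R (quotient_module M N) (residue_class M N x) = colon R M N x"
proof -
  note q = quotient_module_hom[OF N]
  have "r \<odot>\<^bsub>quotient_module M N\<^esub> residue_class M N x = \<zero>\<^bsub>quotient_module M N\<^esub> \<longleftrightarrow> r \<odot>\<^bsub>M\<^esub> x \<in> N"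
    if "r \<in> carrier R" for r
    using q(4)[of "r \<odot>\<^bsub>M\<^esub> x"] module_homD(3)[OF q(2) that x] that x by simp
  then show ?thesis unfolding annihilator_def colon_def by blast
qed

lemma (in module) unmixed_quotient_iff:
  assumes N: "submodule N R M"
  shows "unmixed R (quotient_module M N) {\<zero>\<^bsub>quotient_module M N\<^esub>} \<longleftrightarrow> unmixed R M N"
  unfolding unmixed_zero_iff quotient_module_hom(3)[OF N, symmetric]
  by (simp add: unmixed_def annihilator_quotient[OF N] quotient_module_hom(4)[OF N])

lemma direct_sum_simps [simp]:
  "carrier (direct_sum M N) = carrier M \<times> carrier N" "\<zero>\<^bsub>direct_sum M N\<^esub> = (\<zero>\<^bsub>M\<^esub>, \<zero>\<^bsub>N\<^esub>)"
  "(x, y) \<oplus>\<^bsub>direct_sum M N\<^esub> (x', y') = (x \<oplus>\<^bsub>M\<^esub> x', y \<oplus>\<^bsub>N\<^esub> y')"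
  "a \<odot>\<^bsub>direct_sum M N\<^esub> (x, y) = (a \<odot>\<^bsub>M\<^esub> x, a \<odot>\<^bsub>N\<^esub> y)"
  by (simp_all add: direct_sum_def)

lemma direct_sum_module:
  assumes "module R M" "module R N" shows "module R (direct_sum M N)"
proof -
  interpret M: module R M by fact
  interpret N: module R N by fact
  have "abelian_group (direct_sum M N)"
  proof (rule abelian_groupI)
    fix z assume "z \<in> carrier (direct_sum M N)"
    then obtain x y where "z = (x, y)" "x \<in> carrier M" "y \<in> carrier N" by auto
    then show "\<exists>w\<in>carrier (direct_sum M N). w \<oplus>\<^bsub>direct_sum M N\<^esub> z = \<zero>\<^bsub>direct_sum M N\<^esub>"
      by (intro bexI[of _ "(\<ominus>\<^bsub>M\<^esub> x, \<ominus>\<^bsub>N\<^esub> y)"]) (auto simp: M.l_neg N.l_neg)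
  qed (auto simp: M.a_ac N.a_ac)
  then show ?thesis
    by (rule moduleI[OF M.R.is_cring])
      (auto simp: M.smult_l_distr N.smult_l_distr M.smult_r_distr N.smult_r_distr M.smult_assoc1 N.smult_assoc1)
qed

lemma direct_sum_short_exact:
  assumes "module R M" "module R N"
  shows "short_exact R M (direct_sum M N) N (\<lambda>x. (x, \<zero>\<^bsub>N\<^esub>)) snd"
proof -
  interpret M: module R M by fact
  interpret N: module R N by fact
  show ?thesis
  proof (rule short_exactI)
    show "(\<lambda>x. (x, \<zero>\<^bsub>N\<^esub>)) \<in> module_hom R M (direct_sum M N)" by (rule module_homI) auto
    show "snd \<in> module_hom R (direct_sum M N) N" by (rule module_homI) auto
    show "snd ` carrier (direct_sum M N) = carrier N"
      using M.zero_closed by (simp add: snd_image_times) blast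
  qed (auto simp: inj_on_def)
qed

lemma (in module) submodule_of_submodule:
  assumes N: "submodule N R M" and P: "submodule P R (M\<lparr>carrier := N\<rparr>)"
  shows "submodule P R M" "P \<subseteq> N"
proof -
  interpret N: module R "M\<lparr>carrier := N\<rparr>" by (rule submodule_module[OF N])
  note PE = N.submoduleE[OF P]
  show "P \<subseteq> N" using PE(1) by simp
  then show "submodule P R M"
    using submodule_subset[OF N] N.submodule_zero[OF P] PE(4,5) by (intro submoduleI_smult) auto
qed

lemma (in module) submodule_in_submodule:
  assumes N: "submodule N R M" and P: "submodule P R M" and sub: "P \<subseteq> N"
  shows "submodule P R (M\<lparr>carrier := N\<rparr>)"
proof -
  interpret N: module R "M\<lparr>carrier := N\<rparr>" by (rule submodule_module[OF N])
  show ?thesis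
    using sub submodule_zero[OF P] submoduleE[OF P] by (intro N.submoduleI_smult) auto
qed

lemma submodule_fin_gen:
  assumes R: "noetherian_ring R" and M: "fin_gen_module R M" and N: "submodule N R M"
  shows "fin_gen_module R (M\<lparr>carrier := N\<rparr>)"
proof -
  interpret M: module R M using M by (simp add: fin_gen_module_def)
  interpret N: module R "M\<lparr>carrier := N\<rparr>" by (rule M.submodule_module[OF N])
  obtain C where C: "finite C" "C \<subseteq> carrier M" "N = mspan R M C"
    using submodule_finitely_generated[OF R M N] by blast
  have CN: "C \<subseteq> carrier (M\<lparr>carrier := N\<rparr>)" using M.mspan_superset[of C] C(3) by simp
  note P = N.mspan_submodule[OF CN]
  have "mspan R M C \<subseteq> mspan R (M\<lparr>carrier := N\<rparr>) C"
    by (rule M.mspan_least[OF M.submodule_of_submodule(1)[OF N P] N.mspan_superset])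
  then have "mspan R (M\<lparr>carrier := N\<rparr>) C = carrier (M\<lparr>carrier := N\<rparr>)"
    using N.submodule_subset[OF P] C(3) by simp
  then show ?thesis unfolding fin_gen_module_iff_mspan using C(1) CN N.module_axioms
    by (intro conjI exI[of _ C])
qed

lemma (in module) quotient_hom_factor:
  assumes N: "submodule N R M" and L: "module R L" and f: "f \<in> module_hom R M L"
    and kill: "\<And>n. n \<in> N \<Longrightarrow> f n = \<zero>\<^bsub>L\<^esub>"
  shows "\<exists>g\<in>module_hom R (quotient_module M N) L. \<forall>x\<in>carrier M. g (residue_class M N x) = f x"
proof -
  interpret L: module R L by fact
  let ?Q = "quotient_module M N" and ?h = "residue_class M N"
  note q = quotient_module_hom[OF N]
  have fib: "f y = f x" if x: "x \<in> carrier M" and y: "y \<in> ?h x" for x y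
  proof -
    obtain n where n: "n \<in> N" "y = x \<oplus>\<^bsub>M\<^esub> n" using y unfolding residue_class_def by blast
    then show ?thesis
      using module_homD(1,2)[OF f] x submodule_mem[OF N n(1)] kill[OF n(1)] by simp
  qed
  define g where "g U = f (SOME y. y \<in> U)" for U
  have g: "g (?h x) = f x" if x: "x \<in> carrier M" for x
  proof -
    have "x \<in> ?h x" using residue_class_eq_iff[OF N x x] by simp
    then have "(SOME y. y \<in> ?h x) \<in> ?h x" by (rule someI)
    then show ?thesis unfolding g_def by (rule fib[OF x])
  qed
  have "g \<in> module_hom R ?Q L"
  proof (rule module_homI)
    fix U assume "U \<in> carrier ?Q"
    then obtain x where x: "x \<in> carrier M" "U = ?h x" using q(3) by blast
    then show "g U \<in> carrier L" using g module_homD(1)[OF f] by simp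
    fix a assume a: "a \<in> carrier R"
    show "g (a \<odot>\<^bsub>?Q\<^esub> U) = a \<odot>\<^bsub>L\<^esub> g U"
      using x a g[of "a \<odot>\<^bsub>M\<^esub> x"] module_homD(3)[OF q(2) a x(1)] module_homD(3)[OF f a x(1)] g[OF x(1)] by simp
  next
    fix U V assume "U \<in> carrier ?Q" "V \<in> carrier ?Q"
    then have "U \<in> ?h ` carrier M" "V \<in> ?h ` carrier M" using q(3) by simp_all
    then obtain x y where x: "x \<in> carrier M" "U = ?h x" "y \<in> carrier M" "V = ?h y" by (elim imageE)
    then show "g (U \<oplus>\<^bsub>?Q\<^esub> V) = g U \<oplus>\<^bsub>L\<^esub> g V"
      using g[of "x \<oplus>\<^bsub>M\<^esub> y"] module_homD(2)[OF q(2) x(1,3)] module_homD(2)[OF f x(1,3)]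
        g[OF x(1)] g[OF x(3)] by simp
  qed
  then show ?thesis using g by blast
qed

lemma (in module) multiples_hom:
  assumes x: "x \<in> carrier M"
  shows "(\<lambda>r. r \<odot>\<^bsub>M\<^esub> x) \<in> module_hom R (regular_module R) M"
  using x by (intro module_homI) (auto simp: smult_l_distr smult_assoc1)

lemma (in module) adjoin_zero:
  assumes x: "x \<in> carrier M"
  shows "adjoin R M {\<zero>\<^bsub>M\<^esub>} x = (\<lambda>r. r \<odot>\<^bsub>M\<^esub> x) ` carrier R"
proof
  show "adjoin R M {\<zero>\<^bsub>M\<^esub>} x \<subseteq> (\<lambda>r. r \<odot>\<^bsub>M\<^esub> x) ` carrier R" using x unfolding adjoin_def by auto
  show "(\<lambda>r. r \<odot>\<^bsub>M\<^esub> x) ` carrier R \<subseteq> adjoin R M {\<zero>\<^bsub>M\<^esub>} x"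
    using adjoin_mem(3)[OF zero_submodule x] by blast
qed

section \<open>Serre subcategories and isomorphic copies\<close>

text \<open>
  Quotients, submodules and direct sums have elements of other types than the objects of \<open>cm R\<close>.  They
  are said to belong to \<open>S\<close> if an isomorphic copy does.
\<close>

definition has_copy_in ::
    "('a, 'r) ring_scheme \<Rightarrow> ('a, 'a list set) module set \<Rightarrow> ('a, 'b, 'm) module_scheme \<Rightarrow> bool"
  where "has_copy_in R S M \<longleftrightarrow> (\<exists>N\<in>S. module_isomorphic R M N)"

context one_dim_cm_ring
begin

lemma mcm_fin_gen: "max_cohen_macaulay R M \<Longrightarrow> fin_gen_module R M"
  by (simp add: max_cohen_macaulay_iff_unmixed)

lemma mcm_module: "max_cohen_macaulay R M \<Longrightarrow> module R M"
  unfolding max_cohen_macaulay_iff_unmixed fin_gen_module_def by (elim conjE)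

lemma mcm_unmixed: "max_cohen_macaulay R M \<Longrightarrow> unmixed R M {\<zero>\<^bsub>M\<^esub>}"
  by (simp add: max_cohen_macaulay_iff_unmixed)

lemma mcm_iso:
  assumes N: "module R N" and M: "max_cohen_macaulay R M" and iso: "module_isomorphic R M N"
  shows "max_cohen_macaulay R N"
proof -
  note Mm = mcm_module[OF M]
  obtain h where h: "h \<in> module_hom R M N" "bij_betw h (carrier M) (carrier N)"
    using iso unfolding module_isomorphic_def by blast
  obtain k where k: "k \<in> module_hom R N M" "bij_betw k (carrier N) (carrier M)"
    using module_isomorphic_sym[OF Mm iso] unfolding module_isomorphic_def by blast
  show ?thesis
    unfolding max_cohen_macaulay_iff_unmixed
    using fin_gen_module_surj_image[OF mcm_fin_gen[OF M] N h(1)] h(2)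
      unmixed_inj_hom[OF N Mm k(1) _ mcm_unmixed[OF M]] k(2)
    by (simp add: bij_betw_def)
qed

lemma mcm_submodule:
  assumes M: "max_cohen_macaulay R M" and N: "submodule N R M"
  shows "max_cohen_macaulay R (M\<lparr>carrier := N\<rparr>)"
proof -
  interpret module R M by (rule mcm_module[OF M])
  note e = short_exactD[OF short_exact_quotient[OF N]]
  show ?thesis
    unfolding max_cohen_macaulay_iff_unmixed
    using submodule_fin_gen[OF noetherian mcm_fin_gen[OF M] N]
      unmixed_inj_hom[OF submodule_module[OF N] module_axioms e(1,3) mcm_unmixed[OF M]] by blast
qed

lemma mcm_quotient:
  assumes M: "fin_gen_module R M" and N: "submodule N R M" and un: "unmixed R M N"
  shows "max_cohen_macaulay R (quotient_module M N)"
proof -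
  interpret module R M using M by (simp add: fin_gen_module_def)
  note q = quotient_module_hom[OF N]
  show ?thesis
    unfolding max_cohen_macaulay_iff_unmixed
    using fin_gen_module_surj_image[OF M q(1-3)] un unmixed_quotient_iff[OF N] by blast
qed

lemma mcm_extension:
  assumes "max_cohen_macaulay R A" "module R B" "max_cohen_macaulay R C" "short_exact R A B C f g"
  shows "max_cohen_macaulay R B"
  unfolding max_cohen_macaulay_iff_unmixed
proof
  show "fin_gen_module R B"
    by (rule fin_gen_module_extension[OF mcm_fin_gen[OF assms(1)] assms(2) mcm_fin_gen[OF assms(3)] assms(4)])
  show "unmixed R B {\<zero>\<^bsub>B\<^esub>}"
    by (rule unmixed_extension[OF mcm_module[OF assms(1)] assms(2) mcm_module[OF assms(3)] assms(4)
          mcm_unmixed[OF assms(1)] mcm_unmixed[OF assms(3)]])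
qed

lemma zero_module_mcm:
  assumes "module R Z" "carrier Z = {\<zero>\<^bsub>Z\<^esub>}"
  shows "max_cohen_macaulay R Z"
proof -
  interpret module R Z by fact
  have "mspan R Z {} = carrier Z" using mspan_empty assms(2) by simp
  then have "fin_gen_module R Z" unfolding fin_gen_module_iff_mspan using assms(1) by blast
  then show ?thesis
    unfolding max_cohen_macaulay_iff_unmixed unmixed_zero_iff using assms(2) by simp
qed

lemma serreD:
  assumes "serre_subcategory R (cm R) S"
  shows "M \<in> S \<Longrightarrow> max_cohen_macaulay R M"
    "M \<in> S \<Longrightarrow> module R N \<Longrightarrow> module_isomorphic R M N \<Longrightarrow> N \<in> S"
    "module R Z \<Longrightarrow> carrier Z = {\<zero>\<^bsub>Z\<^esub>} \<Longrightarrow> Z \<in> S"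
    "M \<in> S \<Longrightarrow> N \<in> S \<Longrightarrow> module R L \<Longrightarrow> module_isomorphic R (direct_sum M N) L \<Longrightarrow> L \<in> S"
    "conflation R (cm R) A B C f g \<Longrightarrow> B \<in> S \<longleftrightarrow> A \<in> S \<and> C \<in> S"
  using assms unfolding serre_subcategory_def additive_subcategory_def cm_def by blast+

lemma has_copy_in_iff:
  assumes S: "serre_subcategory R (cm R) S" and M: "module R M" and L: "module R L"
    and iso: "module_isomorphic R M L"
  shows "has_copy_in R S M \<longleftrightarrow> L \<in> S"
proof
  assume "has_copy_in R S M"
  then obtain N where N: "N \<in> S" "module_isomorphic R M N" unfolding has_copy_in_def by blast
  have "module_isomorphic R N L"
    by (rule module_isomorphic_trans[OF module_isomorphic_sym[OF M N(2)] iso])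
  then show "L \<in> S" by (rule serreD(2)[OF S N(1) L])
qed (use iso in \<open>auto simp: has_copy_in_def\<close>)

lemma has_copy_in_iso:
  assumes M: "module R M" and iso: "module_isomorphic R M N" and M': "has_copy_in R S M"
  shows "has_copy_in R S N"
  using M' module_isomorphic_trans[OF module_isomorphic_sym[OF M iso]] unfolding has_copy_in_def by blast

text \<open>
  Finitely generated modules have copies with elements in \<open>'a list set\<close>, so no object is lost.
\<close>

lemma mcm_copy:
  assumes M: "max_cohen_macaulay R M"
  shows "\<exists>N :: ('a, 'a list set) module. N \<in> cm R \<and> module_isomorphic R M N"
  using fin_gen_module_copy[OF mcm_fin_gen[OF M]] mcm_iso[OF _ M] unfolding cm_def by blast

text \<open>
  The defining property of a Serre subcategory, transported along isomorphisms to short exact sequences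
  of maximal Cohen-Macaulay modules over arbitrary types.
\<close>

lemma serre_short_exact:
  assumes S: "serre_subcategory R (cm R) S" and A: "max_cohen_macaulay R A"
    and B: "max_cohen_macaulay R B" and C: "max_cohen_macaulay R C" and ex: "short_exact R A B C f g"
  shows "has_copy_in R S B \<longleftrightarrow> has_copy_in R S A \<and> has_copy_in R S C"
proof -
  obtain A' where A': "A' \<in> cm R" "module_isomorphic R A A'" using mcm_copy[OF A] by blast
  obtain B' where B': "B' \<in> cm R" "module_isomorphic R B B'" using mcm_copy[OF B] by blast
  obtain C' where C': "C' \<in> cm R" "module_isomorphic R C C'" using mcm_copy[OF C] by blast
  note mods = mcm_module[OF A] mcm_module[OF B] mcm_module[OF C]
  have mods': "module R A'" "module R B'" "module R C'"
    using A'(1) B'(1) C'(1) mcm_module unfolding cm_def by auto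
  obtain f' g' where "short_exact R A' B' C' f' g'"
    using short_exact_iso[OF mods mods' ex A'(2) B'(2) C'(2)] by blast
  then have "conflation R (cm R) A' B' C' f' g'"
    unfolding conflation_iff_short_exact using A' B' C' by blast
  then show ?thesis
    using serreD(5)[OF S] has_copy_in_iff[OF S mods(1) mods'(1) A'(2)]
      has_copy_in_iff[OF S mods(2) mods'(2) B'(2)] has_copy_in_iff[OF S mods(3) mods'(3) C'(2)] by blast
qed

lemma zero_module_has_copy_in:
  assumes S: "serre_subcategory R (cm R) S" and Z: "module R Z" "carrier Z = {\<zero>\<^bsub>Z\<^esub>}"
  shows "has_copy_in R S Z"
proof -
  obtain Z' where Z': "Z' \<in> cm R" "module_isomorphic R Z Z'" using mcm_copy[OF zero_module_mcm[OF Z]] by blast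
  then have m: "module R Z'" using mcm_module unfolding cm_def by blast
  obtain h where h: "h \<in> module_hom R Z Z'" "bij_betw h (carrier Z) (carrier Z')"
    using Z'(2) unfolding module_isomorphic_def by blast
  have "carrier Z' = {\<zero>\<^bsub>Z'\<^esub>}"
    using h(2) Z(2) module_hom_zero[OF Z(1) m h(1)] unfolding bij_betw_def by auto
  then have "Z' \<in> S" by (rule serreD(3)[OF S m])
  then show ?thesis using Z'(2) unfolding has_copy_in_def by blast
qed

lemma serre_submodule_quotient:
  assumes S: "serre_subcategory R (cm R) S" and M: "max_cohen_macaulay R M"
    and N: "submodule N R M" and un: "unmixed R M N"
  shows "has_copy_in R S M \<longleftrightarrow>
    has_copy_in R S (M\<lparr>carrier := N\<rparr>) \<and> has_copy_in R S (quotient_module M N)"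
proof -
  interpret module R M by (rule mcm_module[OF M])
  show ?thesis
    by (rule serre_short_exact[OF S mcm_submodule[OF M N] M mcm_quotient[OF mcm_fin_gen[OF M] N un]
          short_exact_quotient[OF N]])
qed

lemma serre_image:
  assumes S: "serre_subcategory R (cm R) S" and M: "max_cohen_macaulay R M"
    and C: "max_cohen_macaulay R C" and g: "g \<in> module_hom R M C" "g ` carrier M = carrier C"
    and M': "has_copy_in R S M"
  shows "has_copy_in R S C"
  using serre_short_exact[OF S mcm_submodule[OF M a_kernel_submodule[OF mcm_module[OF M] mcm_module[OF C] g(1)]]
      M C short_exact_kernel[OF g]] M' by blast

lemma direct_sum_mcm:
  assumes "max_cohen_macaulay R M" "max_cohen_macaulay R N"
  shows "max_cohen_macaulay R (direct_sum M N)"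
  by (rule mcm_extension[OF assms(1) direct_sum_module assms(2) direct_sum_short_exact])
    (rule mcm_module, fact)+

lemma colon_prime:
  assumes p: "primeideal p R" and x: "x \<in> carrier R" "x \<notin> p"
  shows "colon R (regular_module R) p x = p"
proof -
  interpret p: primeideal p R by fact
  show ?thesis using x p.I_prime p.I_r_closed p.a_Hcarr by (auto simp: colon_def)
qed

lemma residue_ring_mcm:
  assumes "p \<in> minimal_primes R"
  shows "max_cohen_macaulay R (quotient_module (regular_module R) p)"
proof -
  have p: "primeideal p R" by (rule minimal_primesD) fact
  have "unmixed R (regular_module R) p"
    unfolding unmixed_def using colon_prime[OF p] assms by auto
  then show ?thesis
    using mcm_quotient[OF regular_module_fin_gen ideal_is_submodule] p primeideal.axioms(1) by blast
qed

lemma residue_ring_supports_iff: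
  assumes p: "primeideal p R" and q: "primeideal q R"
  shows "supports R (quotient_module (regular_module R) p) q \<longleftrightarrow> p \<subseteq> q"
proof -
  interpret rm: module R "regular_module R" by (rule regular_module_is_module)
  interpret p: primeideal p R by fact
  have ps: "submodule p R (regular_module R)" by (rule ideal_is_submodule) (rule p.ideal_axioms)
  note qm = rm.quotient_module_hom[OF ps]
  have "supports R (quotient_module (regular_module R) p) q \<longleftrightarrow>
      (\<exists>x\<in>carrier R. colon R (regular_module R) p x \<subseteq> q)"
    unfolding supports_def qm(3)[symmetric] by (simp add: rm.annihilator_quotient[OF ps])
  also have "\<dots> \<longleftrightarrow> p \<subseteq> q"
  proof
    assume "\<exists>x\<in>carrier R. colon R (regular_module R) p x \<subseteq> q"
    then obtain x where "x \<in> carrier R" "colon R (regular_module R) p x \<subseteq> q" by blast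
    moreover have "p \<subseteq> colon R (regular_module R) p x"
      using \<open>x \<in> carrier R\<close> p.I_r_closed p.a_Hcarr by (auto simp: colon_def)
    ultimately show "p \<subseteq> q" by blast
  next
    assume "p \<subseteq> q"
    then show "\<exists>x\<in>carrier R. colon R (regular_module R) p x \<subseteq> q"
      using colon_prime[OF p one_closed] p.complement_multiplicative(1) by auto
  qed
  finally show ?thesis .
qed


section \<open>Adjoining a simple quotient inside a Serre subcategory\<close>

text \<open>
  The equality of colon ideals identifies \<open>(I + R z)/I\<close> with \<open>K/N\<close>.  The submodule \<open>E\<close> of
  \<open>L \<oplus> K\<close> in the proof is the fibre product of \<open>I + R z\<close> and \<open>K\<close> over this common quotient.  It is an
  extension of \<open>K\<close> by \<open>I\<close>, so it belongs to \<open>S\<close>, and \<open>I + R z\<close> is its quotient by \<open>N\<close>.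
\<close>

lemma adjoin_simple_has_copy_in:
  assumes S: "serre_subcategory R (cm R) S"
    and L: "max_cohen_macaulay R L" and I: "submodule I R L" and z: "z \<in> carrier L"
    and IS: "has_copy_in R S (L\<lparr>carrier := I\<rparr>)"
    and K: "max_cohen_macaulay R K" and N: "submodule N R K" and x: "x \<in> carrier K"
    and KN: "carrier K = adjoin R K N x" and KS: "has_copy_in R S K"
    and same: "colon R K N x = colon R L I z"
  shows "has_copy_in R S (L\<lparr>carrier := adjoin R L I z\<rparr>)"
proof -
  interpret L: module R L by (rule mcm_module[OF L])
  interpret K: module R K by (rule mcm_module[OF K])
  interpret T: module R "direct_sum L K" by (rule direct_sum_module) (rule L.module_axioms K.module_axioms)+
  note T = direct_sum_mcm[OF L K]
  note Im = L.submodule_mem[OF I] and IE = L.submoduleE[OF I]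
  note Nm = K.submodule_mem[OF N] and NE = K.submoduleE[OF N]
  have rel: "r \<odot>\<^bsub>K\<^esub> x \<in> N \<longleftrightarrow> r \<odot>\<^bsub>L\<^esub> z \<in> I" if "r \<in> carrier R" for r
    using same that unfolding colon_def by blast
  define E where "E = {(i \<oplus>\<^bsub>L\<^esub> r \<odot>\<^bsub>L\<^esub> z, n \<oplus>\<^bsub>K\<^esub> r \<odot>\<^bsub>K\<^esub> x) | i n r. i \<in> I \<and> n \<in> N \<and> r \<in> carrier R}"
  have EI: "(i \<oplus>\<^bsub>L\<^esub> r \<odot>\<^bsub>L\<^esub> z, n \<oplus>\<^bsub>K\<^esub> r \<odot>\<^bsub>K\<^esub> x) \<in> E" if "i \<in> I" "n \<in> N" "r \<in> carrier R" for i n r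
    using that unfolding E_def by blast
  have E: "submodule E R (direct_sum L K)"
  proof (rule T.submoduleI_smult)
    show "E \<subseteq> carrier (direct_sum L K)" using Im Nm x z by (auto simp: E_def)
    show "\<zero>\<^bsub>direct_sum L K\<^esub> \<in> E"
      using EI[OF L.submodule_zero[OF I] K.submodule_zero[OF N] zero_closed] x z by simp
  next
    fix u v assume "u \<in> E" "v \<in> E"
    then obtain i n r j m s where *: "i \<in> I" "n \<in> N" "r \<in> carrier R" "j \<in> I" "m \<in> N" "s \<in> carrier R"
      "u = (i \<oplus>\<^bsub>L\<^esub> r \<odot>\<^bsub>L\<^esub> z, n \<oplus>\<^bsub>K\<^esub> r \<odot>\<^bsub>K\<^esub> x)" "v = (j \<oplus>\<^bsub>L\<^esub> s \<odot>\<^bsub>L\<^esub> z, m \<oplus>\<^bsub>K\<^esub> s \<odot>\<^bsub>K\<^esub> x)"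
      unfolding E_def by blast
    have "u \<oplus>\<^bsub>direct_sum L K\<^esub> v = ((i \<oplus>\<^bsub>L\<^esub> j) \<oplus>\<^bsub>L\<^esub> (r \<oplus> s) \<odot>\<^bsub>L\<^esub> z, (n \<oplus>\<^bsub>K\<^esub> m) \<oplus>\<^bsub>K\<^esub> (r \<oplus> s) \<odot>\<^bsub>K\<^esub> x)"
      using * Im Nm x z by (simp add: L.smult_l_distr K.smult_l_distr L.a_ac K.a_ac)
    then show "u \<oplus>\<^bsub>direct_sum L K\<^esub> v \<in> E"
      using EI[OF IE(5)[OF *(1,4)] NE(5)[OF *(2,5)] a_closed[OF *(3,6)]] by simp
  next
    fix a u assume a: "a \<in> carrier R" and "u \<in> E"
    then obtain i n r where *: "i \<in> I" "n \<in> N" "r \<in> carrier R"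
      "u = (i \<oplus>\<^bsub>L\<^esub> r \<odot>\<^bsub>L\<^esub> z, n \<oplus>\<^bsub>K\<^esub> r \<odot>\<^bsub>K\<^esub> x)" unfolding E_def by blast
    have "a \<odot>\<^bsub>direct_sum L K\<^esub> u = (a \<odot>\<^bsub>L\<^esub> i \<oplus>\<^bsub>L\<^esub> (a \<otimes> r) \<odot>\<^bsub>L\<^esub> z, a \<odot>\<^bsub>K\<^esub> n \<oplus>\<^bsub>K\<^esub> (a \<otimes> r) \<odot>\<^bsub>K\<^esub> x)"
      using * a Im Nm x z by (simp add: L.smult_r_distr K.smult_r_distr L.smult_assoc1 K.smult_assoc1)
    then show "a \<odot>\<^bsub>direct_sum L K\<^esub> u \<in> E"
      using EI[OF IE(4)[OF a *(1)] NE(4)[OF a *(2)] m_closed[OF a *(3)]] by simp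
  qed
  let ?E = "(direct_sum L K)\<lparr>carrier := E\<rparr>" and ?I = "L\<lparr>carrier := I\<rparr>" and ?N = "K\<lparr>carrier := N\<rparr>"
  let ?I1 = "L\<lparr>carrier := adjoin R L I z\<rparr>"
  note I1 = L.adjoin_submodule[OF I z]
  have zero: "\<zero>\<^bsub>L\<^esub> \<in> I" "\<zero>\<^bsub>K\<^esub> \<in> N" using L.submodule_zero[OF I] K.submodule_zero[OF N] by auto
  have Emem: "u \<in> adjoin R L I z" "v \<in> carrier K" if "(u, v) \<in> E" for u v
    using that Nm x unfolding E_def adjoin_def by auto
  have "short_exact R ?I ?E K (\<lambda>i. (i, \<zero>\<^bsub>K\<^esub>)) snd"
  proof (rule short_exactI)
    have "(i, \<zero>\<^bsub>K\<^esub>) \<in> E" if "i \<in> I" for i using EI[OF that zero(2) zero_closed] Im[OF that] x z by simp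
    then show "(\<lambda>i. (i, \<zero>\<^bsub>K\<^esub>)) \<in> module_hom R ?I ?E" by (intro module_homI) auto
    show "snd \<in> module_hom R ?E K"
      by (rule module_homI) (auto dest: Emem)
    show "inj_on (\<lambda>i. (i, \<zero>\<^bsub>K\<^esub>)) (carrier ?I)" by (rule inj_onI) simp
    show "snd (i, \<zero>\<^bsub>K\<^esub>) = \<zero>\<^bsub>K\<^esub>" if "i \<in> carrier ?I" for i by simp
    show "\<exists>i\<in>carrier ?I. y = (i, \<zero>\<^bsub>K\<^esub>)" if y: "y \<in> carrier ?E" and y0: "snd y = \<zero>\<^bsub>K\<^esub>" for y
    proof -
      have "y \<in> E" using y by simp
      then obtain i n r where *: "i \<in> I" "n \<in> N" "r \<in> carrier R"
        "y = (i \<oplus>\<^bsub>L\<^esub> r \<odot>\<^bsub>L\<^esub> z, n \<oplus>\<^bsub>K\<^esub> r \<odot>\<^bsub>K\<^esub> x)" unfolding E_def by blast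
      have "n \<oplus>\<^bsub>K\<^esub> r \<odot>\<^bsub>K\<^esub> x \<in> N" using y0 *(4) zero(2) by simp
      then have "r \<odot>\<^bsub>K\<^esub> x \<in> N" using K.submodule_add_iff(1)[OF N *(2)] *(3) x by simp
      then have "i \<oplus>\<^bsub>L\<^esub> r \<odot>\<^bsub>L\<^esub> z \<in> I" using rel[OF *(3)] IE(5)[OF *(1)] by blast
      then show ?thesis using *(4) y0 by auto
    qed
    show "snd ` carrier ?E = carrier K"
    proof
      show "snd ` carrier ?E \<subseteq> carrier K" using Emem by auto
      show "carrier K \<subseteq> snd ` carrier ?E"
      proof
        fix v assume "v \<in> carrier K"
        then obtain n r where *: "n \<in> N" "r \<in> carrier R" "v = n \<oplus>\<^bsub>K\<^esub> r \<odot>\<^bsub>K\<^esub> x"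
          unfolding KN unfolding adjoin_def by blast
        show "v \<in> snd ` carrier ?E" using EI[OF zero(1) *(1,2)] *(3) by force
      qed
    qed
  qed
  then have ES: "has_copy_in R S ?E"
    using serre_short_exact[OF S mcm_submodule[OF L I] mcm_submodule[OF T E] K] IS KS by blast
  have "short_exact R ?N ?E ?I1 (\<lambda>n. (\<zero>\<^bsub>L\<^esub>, n)) fst"
  proof (rule short_exactI)
    have "(\<zero>\<^bsub>L\<^esub>, n) \<in> E" if "n \<in> N" for n using EI[OF zero(1) that zero_closed] Nm[OF that] x z by simp
    then show "(\<lambda>n. (\<zero>\<^bsub>L\<^esub>, n)) \<in> module_hom R ?N ?E" by (intro module_homI) auto
    show "fst \<in> module_hom R ?E ?I1"
      by (rule module_homI) (auto dest: Emem)
    show "inj_on (\<lambda>n. (\<zero>\<^bsub>L\<^esub>, n)) (carrier ?N)" by (rule inj_onI) simp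
    show "fst (\<zero>\<^bsub>L\<^esub>, n) = \<zero>\<^bsub>?I1\<^esub>" if "n \<in> carrier ?N" for n by simp
    show "\<exists>n\<in>carrier ?N. y = (\<zero>\<^bsub>L\<^esub>, n)" if y: "y \<in> carrier ?E" and y0: "fst y = \<zero>\<^bsub>?I1\<^esub>" for y
    proof -
      have "y \<in> E" using y by simp
      then obtain i n r where *: "i \<in> I" "n \<in> N" "r \<in> carrier R"
        "y = (i \<oplus>\<^bsub>L\<^esub> r \<odot>\<^bsub>L\<^esub> z, n \<oplus>\<^bsub>K\<^esub> r \<odot>\<^bsub>K\<^esub> x)" unfolding E_def by blast
      have "i \<oplus>\<^bsub>L\<^esub> r \<odot>\<^bsub>L\<^esub> z \<in> I" using y0 *(4) zero(1) by simp
      then have "r \<odot>\<^bsub>L\<^esub> z \<in> I" using L.submodule_add_iff(1)[OF I *(1)] *(3) z by simp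
      then have "n \<oplus>\<^bsub>K\<^esub> r \<odot>\<^bsub>K\<^esub> x \<in> N" using rel[OF *(3)] NE(5)[OF *(2)] by blast
      then show ?thesis using *(4) y0 by auto
    qed
    show "fst ` carrier ?E = carrier ?I1"
    proof
      show "fst ` carrier ?E \<subseteq> carrier ?I1" using Emem by auto
      show "carrier ?I1 \<subseteq> fst ` carrier ?E"
      proof
        fix u assume "u \<in> carrier ?I1"
        then obtain i r where *: "i \<in> I" "r \<in> carrier R" "u = i \<oplus>\<^bsub>L\<^esub> r \<odot>\<^bsub>L\<^esub> z"
          unfolding adjoin_def by auto
        show "u \<in> fst ` carrier ?E" using EI[OF *(1) zero(2) *(2)] *(3) by force
      qed
    qed
  qed
  then show ?thesis
    using serre_short_exact[OF S mcm_submodule[OF K N] mcm_submodule[OF T E] mcm_submodule[OF L I1]] ES by blast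
qed

text \<open>
  A prime \<open>m\<close> with a prime properly below it is a maximal ideal: a prime above \<open>m + R u\<close> would make a
  chain of length two.
\<close>

lemma comaximal_with_nonminimal_prime:
  assumes p: "primeideal p R" and m: "primeideal m R" and pm: "p \<subset> m"
    and u: "u \<in> carrier R" "u \<notin> m"
  shows "\<exists>a\<in>m. \<exists>b\<in>carrier R. \<one> = a \<oplus> b \<otimes> u"
proof (rule ccontr)
  assume no: "\<not> ?thesis"
  interpret rm: module R "regular_module R" by (rule regular_module_is_module)
  interpret m: primeideal m R by fact
  have ms: "submodule m R (regular_module R)" by (rule ideal_is_submodule) (rule m.ideal_axioms)
  have uc: "u \<in> carrier (regular_module R)" using u(1) by simp
  define J where "J = adjoin R (regular_module R) m u"
  have Js: "submodule J R (regular_module R)" unfolding J_def by (rule rm.adjoin_submodule[OF ms uc])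
  have "colon R (regular_module R) J \<one> = J"
    using rm.submodule_mem[OF Js] by (auto simp: colon_def)
  then have J: "ideal J R" using rm.colon_ideal[OF Js, of \<one>] by simp
  have "\<one> \<notin> J" using no unfolding J_def adjoin_def by auto
  then obtain q where q: "primeideal q R" "J \<subseteq> q"
    using prime_above_disjoint[OF noetherian J, of "{\<one>}"] by auto
  have "m \<subset> q" using rm.adjoin_mem(1,2)[OF ms uc] q(2) u(2) unfolding J_def by blast
  then show False using no_prime_chain_of_length_two[OF dim p m q(1) pm] by blast
qed

text \<open>
  For such \<open>m\<close>, the submodule \<open>N\<close> of \<open>nakayama_submodule\<close> is a maximal submodule with \<open>K/N \<cong> R/m\<close>: a
  submodule \<open>P\<close> strictly above \<open>N\<close> contains \<open>u K\<close> for some \<open>u \<notin> m\<close> as well as \<open>m K\<close>, and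
  \<open>m + R u = R\<close>.
\<close>

lemma simple_quotient_exists:
  assumes p: "primeideal p R" and m: "primeideal m R" and pm: "p \<subset> m"
    and K: "fin_gen_module R K" and x0: "x0 \<in> carrier K" "annihilator R K x0 \<subseteq> m"
  shows "\<exists>N x. submodule N R K \<and> x \<in> carrier K \<and> carrier K = adjoin R K N x \<and> colon R K N x = m"
proof -
  interpret K: module R K using K by (simp add: fin_gen_module_def)
  interpret m: primeideal m R by fact
  obtain N where N: "submodule N R K" "\<forall>u\<in>carrier R - m. \<exists>x\<in>carrier K. u \<odot>\<^bsub>K\<^esub> x \<notin> N"
    "\<forall>P. submodule P R K \<longrightarrow> N \<subset> P \<longrightarrow> (\<exists>u\<in>carrier R - m. \<forall>x\<in>carrier K. u \<odot>\<^bsub>K\<^esub> x \<in> P)"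
    "\<forall>a\<in>m. \<forall>x\<in>carrier K. a \<odot>\<^bsub>K\<^esub> x \<in> N"
    using K.nakayama_submodule[OF noetherian K m x0] by (elim exE conjE)
  note NE = K.submoduleE[OF N(1)]
  obtain x where x: "x \<in> carrier K" "x \<notin> N"
    using N(2) m.complement_multiplicative(1) K.smult_one by metis
  have split: "y = a \<odot>\<^bsub>K\<^esub> y \<oplus>\<^bsub>K\<^esub> b \<odot>\<^bsub>K\<^esub> (u \<odot>\<^bsub>K\<^esub> y)"
    if "\<one> = a \<oplus> b \<otimes> u" "a \<in> m" "b \<in> carrier R" "u \<in> carrier R" "y \<in> carrier K" for a b u y
  proof -
    have "a \<odot>\<^bsub>K\<^esub> y \<oplus>\<^bsub>K\<^esub> b \<odot>\<^bsub>K\<^esub> (u \<odot>\<^bsub>K\<^esub> y) = (a \<oplus> b \<otimes> u) \<odot>\<^bsub>K\<^esub> y"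
      using that(2-) m.a_Hcarr by (simp add: K.smult_l_distr K.smult_assoc1)
    then show ?thesis unfolding that(1)[symmetric] using K.smult_one[OF that(5)] by simp
  qed
  define P where "P = adjoin R K N x"
  have P: "submodule P R K" unfolding P_def by (rule K.adjoin_submodule[OF N(1) x(1)])
  have NP: "N \<subset> P" using K.adjoin_mem(1,2)[OF N(1) x(1)] x(2) unfolding P_def by blast
  obtain u where u: "u \<in> carrier R - m" "\<forall>y\<in>carrier K. u \<odot>\<^bsub>K\<^esub> y \<in> P" using N(3) P NP by blast
  obtain a b where ab: "a \<in> m" "b \<in> carrier R" "\<one> = a \<oplus> b \<otimes> u"
    using comaximal_with_nonminimal_prime[OF p m pm, of u] u(1) by blast
  have "carrier K \<subseteq> P"
  proof
    fix y assume y: "y \<in> carrier K"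
    have "a \<odot>\<^bsub>K\<^esub> y \<in> P" using N(4) ab(1) y NP by blast
    moreover have "b \<odot>\<^bsub>K\<^esub> (u \<odot>\<^bsub>K\<^esub> y) \<in> P" using K.submoduleE(4)[OF P ab(2)] u(2) y by blast
    ultimately have "a \<odot>\<^bsub>K\<^esub> y \<oplus>\<^bsub>K\<^esub> b \<odot>\<^bsub>K\<^esub> (u \<odot>\<^bsub>K\<^esub> y) \<in> P" by (rule K.submoduleE(5)[OF P])
    then show "y \<in> P" using split[OF ab(3,1,2) _ y] u(1) by simp
  qed
  then have "carrier K = adjoin R K N x" using K.submodule_subset[OF P] unfolding P_def by blast
  moreover have "colon R K N x = m"
  proof
    show "m \<subseteq> colon R K N x" using N(4) x(1) m.a_Hcarr unfolding colon_def by blast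
    show "colon R K N x \<subseteq> m"
    proof (rule subsetI, rule ccontr)
      fix r assume r: "r \<in> colon R K N x" "r \<notin> m"
      then have rc: "r \<in> carrier R" "r \<odot>\<^bsub>K\<^esub> x \<in> N" unfolding colon_def by auto
      obtain a b where ab: "a \<in> m" "b \<in> carrier R" "\<one> = a \<oplus> b \<otimes> r"
        using comaximal_with_nonminimal_prime[OF p m pm rc(1) r(2)] by blast
      have "a \<odot>\<^bsub>K\<^esub> x \<oplus>\<^bsub>K\<^esub> b \<odot>\<^bsub>K\<^esub> (r \<odot>\<^bsub>K\<^esub> x) \<in> N"
        using N(4) ab(1) x(1) NE(4)[OF ab(2) rc(2)] NE(5) by blast
      then show False using split[OF ab(3,1,2) rc(1) x(1)] x(2) by simp
    qed
  qed
  ultimately show ?thesis using N(1) x(1) by blast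
qed

lemma subset_minimal_prime:
  assumes "p \<in> minimal_primes R" "q \<in> minimal_primes R" "p \<subseteq> q" shows "p = q"
  using minimal_primes_antichain[OF assms(2) minimal_primesD[OF assms(1)] assms(3)] .

section \<open>Recovering a Serre subcategory from its residue rings\<close>

text \<open>
  An unmixed module killed by a minimal prime \<open>p\<close> is torsion-free over the domain \<open>R/p\<close>.
\<close>

lemma killed_annihilator_eq:
  assumes p: "p \<in> minimal_primes R" and L: "module R L"
    and un: "unmixed R L {\<zero>\<^bsub>L\<^esub>}"
    and kill: "\<And>a x. a \<in> p \<Longrightarrow> x \<in> carrier L \<Longrightarrow> a \<odot>\<^bsub>L\<^esub> x = \<zero>\<^bsub>L\<^esub>"
    and y: "y \<in> carrier L" "y \<noteq> \<zero>\<^bsub>L\<^esub>"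
  shows "annihilator R L y = p"
proof -
  interpret p: primeideal p R by (rule minimal_primesD[OF p])
  obtain q where q: "q \<in> minimal_primes R" "annihilator R L y \<subseteq> q"
    using un y unfolding unmixed_zero_iff by blast
  have "p \<subseteq> annihilator R L y" using kill y(1) p.a_Hcarr unfolding annihilator_def by blast
  then show ?thesis using q subset_minimal_prime[OF p q(1)] by blast
qed

lemma annihilated_part_submodule:
  assumes L: "module R L" and N: "submodule N R L" and p: "ideal p R"
  shows "submodule {x \<in> carrier L. \<forall>a\<in>p. a \<odot>\<^bsub>L\<^esub> x \<in> N} R L"
proof -
  interpret L: module R L by fact
  interpret p: ideal p R by fact
  show ?thesis
    using L.submodule_zero[OF N] L.submoduleE(4,5)[OF N] p.a_Hcarr
    by (intro L.submoduleI_smult) (auto simp: L.smult_r_distr L.smult_left_commute)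
qed

text \<open>
  If \<open>a x \<notin> N\<close> for some \<open>a \<in> p\<close>, then whatever multiplies \<open>x\<close> into the annihilated part multiplies \<open>a x\<close>
  into \<open>N\<close>.
\<close>

lemma annihilated_part_unmixed:
  assumes L: "module R L" and N: "submodule N R L" and p: "ideal p R" and un: "unmixed R L N"
  shows "unmixed R L {x \<in> carrier L. \<forall>a\<in>p. a \<odot>\<^bsub>L\<^esub> x \<in> N}" (is "unmixed R L ?P")
  unfolding unmixed_def
proof (intro ballI impI)
  interpret L: module R L by fact
  interpret p: ideal p R by fact
  fix x assume x: "x \<in> carrier L" "x \<notin> ?P"
  then obtain a where a: "a \<in> p" "a \<odot>\<^bsub>L\<^esub> x \<notin> N" by blast
  have ac: "a \<in> carrier R" using a(1) by (rule p.a_Hcarr)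
  obtain q where q: "q \<in> minimal_primes R" "colon R L N (a \<odot>\<^bsub>L\<^esub> x) \<subseteq> q"
    using un a(2) ac x(1) unfolding unmixed_def by (meson L.smult_closed)
  have "colon R L ?P x \<subseteq> colon R L N (a \<odot>\<^bsub>L\<^esub> x)"
    using a(1) ac x(1) by (auto simp: colon_def L.smult_left_commute[of a])
  then show "\<exists>p\<in>minimal_primes R. colon R L ?P x \<subseteq> p" using q by blast
qed

text \<open>
  A module over \<open>R/p\<close> with \<open>n\<close> generators is a quotient of \<open>(R/p)\<^sup>n\<close>.  The sum is built by adding one
  copy of \<open>R/p\<close> at a time and returning to an object of \<open>S\<close>, which keeps the type of elements
  fixed during the induction.
\<close>

lemma killed_module_has_copy_in:
  assumes S: "serre_subcategory R (cm R) S" and p: "p \<in> minimal_primes R"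
    and D: "has_copy_in R S (quotient_module (regular_module R) p)"
    and L: "max_cohen_macaulay R L"
    and kill: "\<And>a x. a \<in> p \<Longrightarrow> x \<in> carrier L \<Longrightarrow> a \<odot>\<^bsub>L\<^esub> x = \<zero>\<^bsub>L\<^esub>"
  shows "has_copy_in R S L"
proof -
  interpret L: module R L by (rule mcm_module[OF L])
  interpret rm: module R "regular_module R" by (rule regular_module_is_module)
  interpret p: primeideal p R by (rule minimal_primesD[OF p])
  have ps: "submodule p R (regular_module R)" by (rule ideal_is_submodule) (rule p.ideal_axioms)
  note q = rm.quotient_module_hom[OF ps]
  let ?D = "quotient_module (regular_module R) p"
  obtain D' where D': "D' \<in> S" "module_isomorphic R ?D D'" using D unfolding has_copy_in_def by blast
  note D'mcm = serreD(1)[OF S D'(1)]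
  interpret D': module R D' by (rule mcm_module[OF D'mcm])
  obtain \<delta> where \<delta>: "\<delta> \<in> module_hom R D' ?D" "bij_betw \<delta> (carrier D') (carrier ?D)"
    using module_isomorphic_sym[OF q(1) D'(2)] unfolding module_isomorphic_def by blast
  have gen: "\<exists>P\<in>S. \<exists>h\<in>module_hom R P L. B \<subseteq> h ` carrier P" if "finite B" "B \<subseteq> carrier L" for B
    using that
  proof (induction B)
    case empty
    have "(\<lambda>_. \<zero>\<^bsub>L\<^esub>) \<in> module_hom R D' L" by (rule module_homI) auto
    then show ?case using D'(1) by blast
  next
    case (insert b B)
    obtain P h where P: "P \<in> S" "h \<in> module_hom R P L" "B \<subseteq> h ` carrier P"
      using insert.IH insert.prems by blast
    have b: "b \<in> carrier L" using insert.prems by simp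
    note Pmcm = serreD(1)[OF S P(1)]
    interpret P: module R P by (rule mcm_module[OF Pmcm])
    \<comment> \<open>The homomorphism \<open>R/p \<rightarrow> L\<close> that sends \<open>1\<close> to \<open>b\<close>.\<close>
    obtain g where g: "g \<in> module_hom R ?D L"
      "\<forall>r\<in>carrier (regular_module R). g (residue_class (regular_module R) p r) = r \<odot>\<^bsub>L\<^esub> b"
      using rm.quotient_hom_factor[OF ps L.module_axioms L.multiples_hom[OF b] kill[OF _ b]] by blast
    obtain d where d: "d \<in> carrier D'" "\<delta> d = residue_class (regular_module R) p \<one>"
    proof -
      have "residue_class (regular_module R) p \<one> \<in> carrier ?D" unfolding q(3)[symmetric] by simp
      then have "residue_class (regular_module R) p \<one> \<in> \<delta> ` carrier D'"
        using \<delta>(2) unfolding bij_betw_def by simp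
      then show ?thesis using that by (elim imageE) simp
    qed
    define k where "k = g \<circ> \<delta>"
    have k: "k \<in> module_hom R D' L" unfolding k_def by (rule module_hom_comp[OF \<delta>(1) g(1)])
    have kd: "k d = b" using d(2) g(2) b by (simp add: k_def)
    note sum = direct_sum_mcm[OF D'mcm Pmcm]
    obtain Q where Q: "Q \<in> cm R" "module_isomorphic R (direct_sum D' P) Q" using mcm_copy[OF sum] by blast
    have Qm: "module R Q" using Q(1) mcm_module unfolding cm_def by blast
    have QS: "Q \<in> S" by (rule serreD(4)[OF S D'(1) P(1) Qm Q(2)])
    obtain \<theta> where \<theta>: "\<theta> \<in> module_hom R Q (direct_sum D' P)"
      "bij_betw \<theta> (carrier Q) (carrier (direct_sum D' P))"
      using module_isomorphic_sym[OF mcm_module[OF sum] Q(2)] unfolding module_isomorphic_def by blast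
    define f where "f = (\<lambda>(x, y). k x \<oplus>\<^bsub>L\<^esub> h y)"
    have f: "f \<in> module_hom R (direct_sum D' P) L"
    proof (rule module_homI)
      fix u assume "u \<in> carrier (direct_sum D' P)"
      then obtain x y where u: "u = (x, y)" "x \<in> carrier D'" "y \<in> carrier P" by auto
      show "f u \<in> carrier L" using u module_homD(1)[OF k] module_homD(1)[OF P(2)] by (simp add: f_def)
      fix a assume a: "a \<in> carrier R"
      show "f (a \<odot>\<^bsub>direct_sum D' P\<^esub> u) = a \<odot>\<^bsub>L\<^esub> f u"
        using u a module_homD(1,3)[OF k] module_homD(1,3)[OF P(2)] by (simp add: f_def L.smult_r_distr)
    next
      fix u v assume "u \<in> carrier (direct_sum D' P)" "v \<in> carrier (direct_sum D' P)"
      then obtain x y x' y' where u: "u = (x, y)" "x \<in> carrier D'" "y \<in> carrier P"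
        "v = (x', y')" "x' \<in> carrier D'" "y' \<in> carrier P" by auto
      then show "f (u \<oplus>\<^bsub>direct_sum D' P\<^esub> v) = f u \<oplus>\<^bsub>L\<^esub> f v"
        using module_homD(1,2)[OF k] module_homD(1,2)[OF P(2)] by (simp add: f_def L.a_ac)
    qed
    have img: "(f \<circ> \<theta>) ` carrier Q = f ` (carrier D' \<times> carrier P)"
      using \<theta>(2) unfolding bij_betw_def by (metis direct_sum_simps(1) image_comp)
    have "insert b B \<subseteq> f ` (carrier D' \<times> carrier P)"
    proof
      fix c assume "c \<in> insert b B"
      then consider "c = b" | y where "y \<in> carrier P" "c = h y" using P(3) by blast
      then show "c \<in> f ` (carrier D' \<times> carrier P)"
      proof cases
        case 1
        have "f (d, \<zero>\<^bsub>P\<^esub>) = b"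
          using kd b module_hom_zero[OF P.module_axioms L.module_axioms P(2)] by (simp add: f_def)
        then show ?thesis using 1 d(1) by (intro image_eqI[of _ _ "(d, \<zero>\<^bsub>P\<^esub>)"]) auto
      next
        case 2
        have "f (\<zero>\<^bsub>D'\<^esub>, y) = h y"
          using 2 module_homD(1)[OF P(2)] module_hom_zero[OF D'.module_axioms L.module_axioms k] by (simp add: f_def)
        then show ?thesis using 2 by (intro image_eqI[of _ _ "(\<zero>\<^bsub>D'\<^esub>, y)"]) auto
      qed
    qed
    then have "insert b B \<subseteq> (f \<circ> \<theta>) ` carrier Q" unfolding img .
    then show ?case using QS module_hom_comp[OF \<theta>(1) f] by (intro bexI)
  qed
  obtain B where B: "finite B" "B \<subseteq> carrier L" "mspan R L B = carrier L"
    using mcm_fin_gen[OF L] unfolding fin_gen_module_iff_mspan by (elim conjE exE)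
  obtain P h where P: "P \<in> S" "h \<in> module_hom R P L" "B \<subseteq> h ` carrier P" using gen[OF B(1,2)] by blast
  note Pmcm = serreD(1)[OF S P(1)]
  interpret P: module R P by (rule mcm_module[OF Pmcm])
  have "mspan R L B \<subseteq> h ` carrier P"
    by (rule L.mspan_least[OF module_hom_image_submodule[OF P.module_axioms L.module_axioms P(2)
          P.carrier_is_submodule] P(3)])
  then have surj: "h ` carrier P = carrier L" using B(3) module_homD(1)[OF P(2)] by blast
  have "(\<lambda>x. x) \<in> module_hom R P P" by (rule module_homI) auto
  then have "module_isomorphic R P P" by (rule module_isomorphicI) auto
  then have "has_copy_in R S P" using P(1) unfolding has_copy_in_def by blast
  then show ?thesis by (rule serre_image[OF S Pmcm L P(2) surj])
qed

text \<open>
  The module \<open>R x\<close> is a copy of \<open>R/p\<close>.  Let \<open>K \<subseteq> R x\<close> be maximal among the submodules in \<open>S\<close> that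
  contain \<open>K0\<close>.  If \<open>K\<close> were not all of \<open>R x\<close>, then \<open>R x/K\<close> would have an associated prime \<open>m = (K : z)\<close>.
  It contains \<open>p\<close> and \<open>t\<close>, so it lies strictly above \<open>p\<close>; hence \<open>K\<close> has a quotient \<open>R/m\<close>, and
  \<open>adjoin_simple_has_copy_in\<close>, in which both \<open>I\<close> and the second module are \<open>K\<close>, puts the larger module \<open>K + R z\<close> into \<open>S\<close>.
\<close>

lemma residue_ring_has_copy_in_of_cyclic:
  assumes S: "serre_subcategory R (cm R) S" and p: "p \<in> minimal_primes R"
    and Y: "max_cohen_macaulay R Y" and x: "x \<in> carrier Y" "annihilator R Y x = p"
    and K0: "submodule K0 R Y" "K0 \<subseteq> adjoin R Y {\<zero>\<^bsub>Y\<^esub>} x" "has_copy_in R S (Y\<lparr>carrier := K0\<rparr>)"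
    and t: "t \<in> carrier R" "t \<notin> p" "t \<odot>\<^bsub>Y\<^esub> x \<in> K0"
  shows "has_copy_in R S (quotient_module (regular_module R) p)"
proof -
  interpret Y: module R Y by (rule mcm_module[OF Y])
  interpret p: primeideal p R by (rule minimal_primesD[OF p])
  interpret rm: module R "regular_module R" by (rule regular_module_is_module)
  define Rx where "Rx = adjoin R Y {\<zero>\<^bsub>Y\<^esub>} x"
  have Rx: "submodule Rx R Y" unfolding Rx_def by (rule Y.adjoin_submodule[OF Y.zero_submodule x(1)])
  have Rx_eq: "Rx = (\<lambda>r. r \<odot>\<^bsub>Y\<^esub> x) ` carrier R" unfolding Rx_def by (rule Y.adjoin_zero[OF x(1)])
  define F where "F = {K. submodule K R Y \<and> K0 \<subseteq> K \<and> K \<subseteq> Rx \<and> has_copy_in R S (Y\<lparr>carrier := K\<rparr>)}"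
  have "K0 \<in> F" using K0 unfolding F_def Rx_def by blast
  then have ne: "F \<noteq> {}" by blast
  have "submodule K R Y" if "K \<in> F" for K using that by (simp add: F_def)
  then have "\<exists>K\<in>F. \<forall>P\<in>F. K \<subseteq> P \<longrightarrow> P = K"
    by (rule submodule_family_has_maximal[OF noetherian mcm_fin_gen[OF Y] _ ne])
  then obtain K where K: "K \<in> F" "\<forall>P\<in>F. K \<subseteq> P \<longrightarrow> P = K" by (elim bexE)
  have Ks: "submodule K R Y" "K0 \<subseteq> K" "K \<subseteq> Rx" "has_copy_in R S (Y\<lparr>carrier := K\<rparr>)"
    using K(1) unfolding F_def by auto
  have "x \<in> K"
  proof (rule ccontr)
    assume "x \<notin> K"
    then have "colon R Y K x \<inter> {\<one>} = {}" using x(1) by (simp add: colon_def)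
    then obtain c where c: "c \<in> carrier R" "primeideal (colon R Y K (c \<odot>\<^bsub>Y\<^esub> x)) R"
      "colon R Y K (c \<odot>\<^bsub>Y\<^esub> x) \<inter> {\<one>} = {}"
      using Y.prime_colon_exists[OF noetherian Ks(1) x(1), of "{\<one>}"] by auto
    define z where "z = c \<odot>\<^bsub>Y\<^esub> x"
    define m where "m = colon R Y K z"
    have z: "z \<in> carrier Y" using c(1) x(1) by (simp add: z_def)
    have m: "primeideal m R" using c(2) unfolding m_def z_def .
    have "colon R Y K x \<subseteq> m" unfolding m_def z_def by (rule Y.colon_smult_mono[OF Ks(1) x(1) c(1)])
    moreover have "p \<subseteq> colon R Y K x"
    proof
      fix a assume "a \<in> p"
      then have "a \<in> annihilator R Y x" using x(2) by simp
      then show "a \<in> colon R Y K x"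
        using Y.submodule_zero[OF Ks(1)] by (simp add: colon_def annihilator_def)
    qed
    moreover have "t \<in> colon R Y K x" using t Ks(2) unfolding colon_def by blast
    ultimately have pm: "p \<subset> m" using t(2) by blast
    have zK: "z \<notin> K" using c(3) z unfolding z_def[symmetric] by (simp add: colon_def)
    let ?K = "Y\<lparr>carrier := K\<rparr>"
    note Kmcm = mcm_submodule[OF Y Ks(1)]
    have tx: "t \<odot>\<^bsub>Y\<^esub> x \<in> carrier ?K" using t(3) Ks(2) by auto
    have "annihilator R ?K (t \<odot>\<^bsub>Y\<^esub> x) \<subseteq> m"
    proof
      fix r assume "r \<in> annihilator R ?K (t \<odot>\<^bsub>Y\<^esub> x)"
      then have r: "r \<in> carrier R" "r \<odot>\<^bsub>Y\<^esub> (t \<odot>\<^bsub>Y\<^esub> x) = \<zero>\<^bsub>Y\<^esub>" unfolding annihilator_def by auto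
      then have "r \<otimes> t \<in> annihilator R Y x" using t(1) x(1) by (simp add: annihilator_def Y.smult_assoc1)
      then have "r \<otimes> t \<in> p" using x(2) by simp
      then show "r \<in> m" using p.I_prime[OF r(1) t(1)] t(2) pm by blast
    qed
    then obtain N w where N: "submodule N R ?K" "w \<in> carrier ?K" "carrier ?K = adjoin R ?K N w"
      "colon R ?K N w = m"
      using simple_quotient_exists[OF minimal_primesD[OF p] m pm mcm_fin_gen[OF Kmcm] tx] by blast
    have "has_copy_in R S (Y\<lparr>carrier := adjoin R Y K z\<rparr>)"
      by (rule adjoin_simple_has_copy_in[OF S Y Ks(1) z Ks(4) Kmcm N(1,2,3) Ks(4)]) (use N(4) m_def in simp)
    moreover have "z \<in> Rx" using c(1) unfolding z_def Rx_eq by blast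
    then have "adjoin R Y K z \<subseteq> Rx" by (rule Y.adjoin_least[OF Rx Ks(3)])
    ultimately have "adjoin R Y K z \<in> F"
      unfolding F_def using Y.adjoin_submodule[OF Ks(1) z] Y.adjoin_mem(2)[OF Ks(1) z] Ks(2) by blast
    then have "adjoin R Y K z = K" using K(2) Y.adjoin_mem(2)[OF Ks(1) z] by blast
    then show False using Y.adjoin_mem(1)[OF Ks(1) z] zK by simp
  qed
  then have "Rx \<subseteq> K" unfolding Rx_def using Y.submodule_zero[OF Ks(1)] by (intro Y.adjoin_least[OF Ks(1)]) auto
  then have KRx: "K = Rx" using Ks(3) by blast
  let ?D = "quotient_module (regular_module R) p"
  have ps: "submodule p R (regular_module R)" by (rule ideal_is_submodule) (rule p.ideal_axioms)
  note q = rm.quotient_module_hom[OF ps]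
  have kill: "a \<odot>\<^bsub>Y\<^esub> x = \<zero>\<^bsub>Y\<^esub>" if "a \<in> p" for a using that unfolding x(2)[symmetric] annihilator_def by blast
  obtain g where g: "g \<in> module_hom R ?D Y"
    "\<forall>r\<in>carrier (regular_module R). g (residue_class (regular_module R) p r) = r \<odot>\<^bsub>Y\<^esub> x"
    using rm.quotient_hom_factor[OF ps Y.module_axioms Y.multiples_hom[OF x(1)] kill] by blast
  have img: "g ` carrier ?D = Rx"
    unfolding q(3)[symmetric] image_image Rx_eq using g(2) by (intro image_cong) simp_all
  have inj: "inj_on g (carrier ?D)"
    unfolding module_hom_inj_iff[OF q(1) Y.module_axioms g(1)] unfolding q(3)[symmetric]
  proof (intro ballI impI)
    fix u assume "u \<in> residue_class (regular_module R) p ` carrier (regular_module R)" and u0: "g u = \<zero>\<^bsub>Y\<^esub>"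
    then obtain r where r: "r \<in> carrier (regular_module R)" "u = residue_class (regular_module R) p r" by blast
    then have "r \<odot>\<^bsub>Y\<^esub> x = \<zero>\<^bsub>Y\<^esub>" using g(2) u0 by simp
    then have "r \<in> annihilator R Y x" using r(1) by (simp add: annihilator_def)
    then show "u = \<zero>\<^bsub>?D\<^esub>" using q(4)[OF r(1)] r(2) x(2) by simp
  qed
  have "g \<in> module_hom R ?D (Y\<lparr>carrier := Rx\<rparr>)"
    using img module_homD[OF g(1)] by (intro module_homI) auto
  then have "module_isomorphic R ?D (Y\<lparr>carrier := Rx\<rparr>)"
    by (rule module_isomorphicI) (use inj img in auto)
  then have "module_isomorphic R (Y\<lparr>carrier := Rx\<rparr>) ?D" by (rule module_isomorphic_sym[OF q(1)])
  then show ?thesis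
    using has_copy_in_iso[OF Y.submodule_module[OF Rx]] Ks(4) unfolding KRx by blast
qed

text \<open>
  The prime \<open>p\<close> is the annihilator of some \<open>x \<in> M\<close>.  The part \<open>X'\<close> of \<open>M\<close> killed by \<open>p\<close> is in \<open>S\<close>, being
  a submodule with unmixed quotient.  Divide it by a submodule \<open>Z\<close> that is maximal subject to
  \<open>Z \<inter> R x = 0\<close>.  The quotient \<open>Y\<close> is unmixed and hence in \<open>S\<close>, and each of its elements has a multiple
  by some \<open>s \<notin> p\<close> in the copy of \<open>R/p\<close> generated by the class \<open>\<xi>\<close> of \<open>x\<close>.  By finite
  generation a single \<open>t \<notin> p\<close> maps all of \<open>Y\<close> there.  As \<open>t\<close> acts injectively, \<open>Y \<cong> t Y\<close>.
\<close>

lemma residue_ring_has_copy_in_of_supports: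
  assumes S: "serre_subcategory R (cm R) S" and p: "p \<in> minimal_primes R"
    and M: "max_cohen_macaulay R M" "has_copy_in R S M" and supp: "supports R M p"
  shows "has_copy_in R S (quotient_module (regular_module R) p)"
proof -
  interpret M: module R M by (rule mcm_module[OF M(1)])
  interpret p: primeideal p R by (rule minimal_primesD[OF p])
  obtain x where x: "x \<in> carrier M" "annihilator R M x = p"
    using M.minimal_prime_is_annihilator[OF noetherian p supp] by blast
  define L where "L = {y \<in> carrier M. \<forall>a\<in>p. a \<odot>\<^bsub>M\<^esub> y \<in> {\<zero>\<^bsub>M\<^esub>}}"
  have Ls: "submodule L R M" unfolding L_def
    by (rule annihilated_part_submodule[OF M.module_axioms M.zero_submodule p.ideal_axioms])
  have Lun: "unmixed R M L" unfolding L_def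
    by (rule annihilated_part_unmixed[OF M.module_axioms M.zero_submodule p.ideal_axioms mcm_unmixed[OF M(1)]])
  define X' where "X' = M\<lparr>carrier := L\<rparr>"
  have X': "max_cohen_macaulay R X'" "has_copy_in R S X'"
    unfolding X'_def using mcm_submodule[OF M(1) Ls] serre_submodule_quotient[OF S M(1) Ls Lun] M(2) by auto
  interpret X': module R X' by (rule mcm_module[OF X'(1)])
  have killX: "a \<odot>\<^bsub>X'\<^esub> y = \<zero>\<^bsub>X'\<^esub>" if "a \<in> p" "y \<in> carrier X'" for a y
    using that by (simp add: X'_def L_def)
  have xX: "x \<in> carrier X'" using x unfolding X'_def L_def annihilator_def by auto
  have annX: "annihilator R X' x = p" using x(2) by (simp add: annihilator_def X'_def)
  \<comment> \<open>The condition \<open>(Z : x) \<subseteq> p\<close> says that \<open>Z \<inter> R x = 0\<close>, since \<open>x\<close> has annihilator \<open>p\<close>.\<close>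
  define F where "F = {Z. submodule Z R X' \<and> colon R X' Z x \<subseteq> p}"
  have "{\<zero>\<^bsub>X'\<^esub>} \<in> F" unfolding F_def using X'.zero_submodule annX by (simp add: colon_zero)
  then have ne: "F \<noteq> {}" by blast
  have "submodule Z R X'" if "Z \<in> F" for Z using that by (simp add: F_def)
  then have "\<exists>Z\<in>F. \<forall>P\<in>F. Z \<subseteq> P \<longrightarrow> P = Z"
    by (rule submodule_family_has_maximal[OF noetherian mcm_fin_gen[OF X'(1)] _ ne])
  then obtain Z where Z: "Z \<in> F" "\<forall>P\<in>F. Z \<subseteq> P \<longrightarrow> P = Z" by (elim bexE)
  have Zs: "submodule Z R X'" and Zx: "colon R X' Z x \<subseteq> p" using Z(1) unfolding F_def by auto
  have essential: "\<exists>r\<in>carrier R. \<exists>s\<in>carrier R. \<exists>w\<in>Z. r \<notin> p \<and> r \<odot>\<^bsub>X'\<^esub> x = w \<oplus>\<^bsub>X'\<^esub> s \<odot>\<^bsub>X'\<^esub> y"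
    if y: "y \<in> carrier X'" "y \<notin> Z" for y
  proof -
    have "adjoin R X' Z y \<noteq> Z" using X'.adjoin_mem(1)[OF Zs y(1)] y(2) by blast
    then have "adjoin R X' Z y \<notin> F" using Z(2) X'.adjoin_mem(2)[OF Zs y(1)] by blast
    then obtain r where "r \<in> colon R X' (adjoin R X' Z y) x" "r \<notin> p"
      unfolding F_def using X'.adjoin_submodule[OF Zs y(1)] by blast
    then show ?thesis unfolding colon_def adjoin_def by blast
  qed
  have Zun: "unmixed R X' Z"
    unfolding unmixed_def
  proof (intro ballI impI)
    fix y assume y: "y \<in> carrier X'" "y \<notin> Z"
    obtain r s w where rs: "r \<in> carrier R" "s \<in> carrier R" "w \<in> Z" "r \<notin> p"
      "r \<odot>\<^bsub>X'\<^esub> x = w \<oplus>\<^bsub>X'\<^esub> s \<odot>\<^bsub>X'\<^esub> y" using essential[OF y] by blast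
    have "colon R X' Z y \<subseteq> p"
    proof
      fix t assume "t \<in> colon R X' Z y"
      then have t: "t \<in> carrier R" "t \<odot>\<^bsub>X'\<^esub> y \<in> Z" unfolding colon_def by auto
      have "(t \<otimes> r) \<odot>\<^bsub>X'\<^esub> x = t \<odot>\<^bsub>X'\<^esub> w \<oplus>\<^bsub>X'\<^esub> s \<odot>\<^bsub>X'\<^esub> (t \<odot>\<^bsub>X'\<^esub> y)"
        using rs t y(1) xX X'.submodule_mem[OF Zs]
        by (simp add: X'.smult_assoc1 X'.smult_r_distr X'.smult_left_commute[of t s])
      also have "\<dots> \<in> Z"
        using rs t X'.submoduleE(4,5)[OF Zs] by blast
      finally have "t \<otimes> r \<in> p" using Zx t(1) rs(1) unfolding colon_def by blast
      then show "t \<in> p" using p.I_prime[OF t(1) rs(1)] rs(4) by blast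
    qed
    then show "\<exists>p\<in>minimal_primes R. colon R X' Z y \<subseteq> p" using p by blast
  qed
  define Y where "Y = quotient_module X' Z"
  let ?h = "residue_class X' Z"
  note q = X'.quotient_module_hom[OF Zs, folded Y_def]
  have Y: "max_cohen_macaulay R Y" "has_copy_in R S Y"
    unfolding Y_def using mcm_quotient[OF mcm_fin_gen[OF X'(1)] Zs Zun]
      serre_submodule_quotient[OF S X'(1) Zs Zun] X'(2) by auto
  interpret Y: module R Y by (rule mcm_module[OF Y(1)])
  define \<xi> where "\<xi> = ?h x"
  have \<xi>: "\<xi> \<in> carrier Y" unfolding \<xi>_def using q(3) xX by blast
  have killY: "a \<odot>\<^bsub>Y\<^esub> v = \<zero>\<^bsub>Y\<^esub>" if a: "a \<in> p" and v: "v \<in> carrier Y" for a v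
  proof -
    have ac: "a \<in> carrier R" using a by (rule p.a_Hcarr)
    obtain y where y: "y \<in> carrier X'" "v = ?h y" using v q(3) by blast
    then have "a \<odot>\<^bsub>Y\<^esub> v = ?h (a \<odot>\<^bsub>X'\<^esub> y)" using module_homD(3)[OF q(2) ac y(1)] by simp
    then show ?thesis using killX[OF a y(1)] module_hom_zero[OF X'.module_axioms Y.module_axioms q(2)] by simp
  qed
  have \<xi>nz: "\<xi> \<noteq> \<zero>\<^bsub>Y\<^esub>"
  proof
    assume "\<xi> = \<zero>\<^bsub>Y\<^esub>"
    then have "x \<in> Z" using q(4)[OF xX] unfolding \<xi>_def by simp
    then have "\<one> \<in> colon R X' Z x" using xX by (simp add: colon_def)
    then show False using Zx p.complement_multiplicative(1) by blast
  qed
  have annY: "annihilator R Y v = p" if "v \<in> carrier Y" "v \<noteq> \<zero>\<^bsub>Y\<^esub>" for v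
    by (rule killed_annihilator_eq[OF p Y.module_axioms mcm_unmixed[OF Y(1)] killY that])
  define R\<xi> where "R\<xi> = adjoin R Y {\<zero>\<^bsub>Y\<^esub>} \<xi>"
  have R\<xi>: "submodule R\<xi> R Y" unfolding R\<xi>_def by (rule Y.adjoin_submodule[OF Y.zero_submodule \<xi>])
  have R\<xi>_mem: "r \<odot>\<^bsub>Y\<^esub> \<xi> \<in> R\<xi>" if "r \<in> carrier R" for r
    unfolding R\<xi>_def by (rule Y.adjoin_mem(3)[OF Y.zero_submodule \<xi> that])
  have "\<exists>u\<in>carrier R - p. u \<odot>\<^bsub>Y\<^esub> v \<in> R\<xi>" if v: "v \<in> carrier Y" for v
  proof (cases "v = \<zero>\<^bsub>Y\<^esub>")
    case True
    then show ?thesis using p.complement_multiplicative(1) Y.submodule_zero[OF R\<xi>] by force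
  next
    case False
    obtain y where y: "y \<in> carrier X'" "v = ?h y" using v q(3) by blast
    have "y \<notin> Z" using False q(4)[OF y(1)] y(2) by simp
    then obtain r s w where rs: "r \<in> carrier R" "s \<in> carrier R" "w \<in> Z" "r \<notin> p"
      "r \<odot>\<^bsub>X'\<^esub> x = w \<oplus>\<^bsub>X'\<^esub> s \<odot>\<^bsub>X'\<^esub> y" using essential[OF y(1)] by blast
    have w: "w \<in> carrier X'" using rs(3) by (rule X'.submodule_mem[OF Zs])
    have "s \<notin> p"
    proof
      assume "s \<in> p"
      then have "r \<odot>\<^bsub>X'\<^esub> x = w" using rs(5) killX[of s y] y(1) w by simp
      then have "r \<in> colon R X' Z x" using rs(1,3) by (simp add: colon_def)
      then show False using Zx rs(4) by blast
    qed
    have "r \<odot>\<^bsub>Y\<^esub> \<xi> = ?h (w \<oplus>\<^bsub>X'\<^esub> s \<odot>\<^bsub>X'\<^esub> y)"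
      using module_homD(3)[OF q(2) rs(1) xX] rs(5) by (simp add: \<xi>_def)
    also have "\<dots> = s \<odot>\<^bsub>Y\<^esub> v"
      using module_homD(2)[OF q(2) w, of "s \<odot>\<^bsub>X'\<^esub> y"] module_homD(3)[OF q(2) rs(2) y(1)]
        q(4)[OF w] rs(2,3) y v by simp
    finally have "s \<odot>\<^bsub>Y\<^esub> v \<in> R\<xi>" using R\<xi>_mem[OF rs(1)] by simp
    then show ?thesis using rs(2) \<open>s \<notin> p\<close> by blast
  qed
  then obtain t where t: "t \<in> carrier R - p" "\<forall>v\<in>carrier Y. t \<odot>\<^bsub>Y\<^esub> v \<in> R\<xi>"
    using Y.uniform_multiplier[OF p.primeideal mcm_fin_gen[OF Y(1)] R\<xi>] by blast
  have tc: "t \<in> carrier R" using t(1) by blast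
  define K0 where "K0 = (\<lambda>v. t \<odot>\<^bsub>Y\<^esub> v) ` carrier Y"
  have K0: "submodule K0 R Y" unfolding K0_def by (rule Y.smult_image_submodule[OF tc Y.carrier_is_submodule])
  have th: "(\<lambda>v. t \<odot>\<^bsub>Y\<^esub> v) \<in> module_hom R Y Y"
    using tc by (intro module_homI) (auto simp: Y.smult_r_distr Y.smult_left_commute)
  have inj: "inj_on (\<lambda>v. t \<odot>\<^bsub>Y\<^esub> v) (carrier Y)"
    unfolding module_hom_inj_iff[OF Y.module_axioms Y.module_axioms th]
  proof (intro ballI impI, rule ccontr)
    fix v assume v: "v \<in> carrier Y" "t \<odot>\<^bsub>Y\<^esub> v = \<zero>\<^bsub>Y\<^esub>" "v \<noteq> \<zero>\<^bsub>Y\<^esub>"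
    then have "t \<in> annihilator R Y v" using tc by (simp add: annihilator_def)
    then show False using annY[OF v(1,3)] t(1) by blast
  qed
  have "(\<lambda>v. t \<odot>\<^bsub>Y\<^esub> v) \<in> module_hom R Y (Y\<lparr>carrier := K0\<rparr>)"
    using module_homD[OF th] by (intro module_homI) (auto simp: K0_def)
  then have "module_isomorphic R Y (Y\<lparr>carrier := K0\<rparr>)"
    by (rule module_isomorphicI[OF _ inj]) (simp add: K0_def)
  then have "has_copy_in R S (Y\<lparr>carrier := K0\<rparr>)"
    by (rule has_copy_in_iso[OF Y.module_axioms _ Y(2)])
  moreover have "K0 \<subseteq> R\<xi>" unfolding K0_def using t(2) by blast
  moreover have "t \<odot>\<^bsub>Y\<^esub> \<xi> \<in> K0" unfolding K0_def using \<xi> by blast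
  ultimately show ?thesis
    using residue_ring_has_copy_in_of_cyclic[OF S p Y(1) \<xi> annY[OF \<xi> \<xi>nz] K0 _ _ tc] t(1)
    unfolding R\<xi>_def by blast
qed

text \<open>
  Let \<open>N\<close> be maximal among the submodules in \<open>S\<close> with unmixed quotient.  If \<open>N \<noteq> M\<close>, the quotient has
  an associated prime \<open>p\<close>, which is minimal, and the preimage \<open>N'\<close> of the part of \<open>M/N\<close> killed by \<open>p\<close> is
  a larger submodule of this kind.
\<close>

lemma has_copy_in_of_residue_rings:
  assumes S: "serre_subcategory R (cm R) S" and M: "max_cohen_macaulay R M"
    and D: "\<And>p. p \<in> minimal_primes R \<Longrightarrow> supports R M p \<Longrightarrow>
      has_copy_in R S (quotient_module (regular_module R) p)"
  shows "has_copy_in R S M"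
proof -
  interpret M: module R M by (rule mcm_module[OF M])
  define F where "F = {N. submodule N R M \<and> unmixed R M N \<and> has_copy_in R S (M\<lparr>carrier := N\<rparr>)}"
  have "has_copy_in R S (M\<lparr>carrier := {\<zero>\<^bsub>M\<^esub>}\<rparr>)"
    by (rule zero_module_has_copy_in[OF S M.submodule_module[OF M.zero_submodule]]) simp
  then have "{\<zero>\<^bsub>M\<^esub>} \<in> F" unfolding F_def using M.zero_submodule mcm_unmixed[OF M] by blast
  then have ne: "F \<noteq> {}" by blast
  have "submodule N R M" if "N \<in> F" for N using that by (simp add: F_def)
  then have "\<exists>N\<in>F. \<forall>P\<in>F. N \<subseteq> P \<longrightarrow> P = N"
    by (rule submodule_family_has_maximal[OF noetherian mcm_fin_gen[OF M] _ ne])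
  then obtain N where N: "N \<in> F" "\<forall>P\<in>F. N \<subseteq> P \<longrightarrow> P = N" by (elim bexE)
  have Ns: "submodule N R M" "unmixed R M N" "has_copy_in R S (M\<lparr>carrier := N\<rparr>)"
    using N(1) unfolding F_def by auto
  have "carrier M \<subseteq> N"
  proof (rule ccontr)
    assume "\<not> carrier M \<subseteq> N"
    then obtain x where x: "x \<in> carrier M" "x \<notin> N" by blast
    then obtain p where p: "p \<in> minimal_primes R" "colon R M N x \<subseteq> p"
      using Ns(2) unfolding unmixed_def by blast
    interpret p: primeideal p R by (rule minimal_primesD[OF p(1)])
    obtain c where c: "c \<in> carrier R" "colon R M N (c \<odot>\<^bsub>M\<^esub> x) = p"
      using M.minimal_prime_is_colon[OF noetherian Ns(1) x(1) p] by blast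
    define y where "y = c \<odot>\<^bsub>M\<^esub> x"
    have y: "y \<in> carrier M" "colon R M N y = p" using c x(1) by (auto simp: y_def)
    have "annihilator R M y \<subseteq> p"
      using y M.submodule_zero[OF Ns(1)] unfolding y(2)[symmetric] annihilator_def colon_def by auto
    then have "supports R M p" using y(1) unfolding supports_def by blast
    then have Dp: "has_copy_in R S (quotient_module (regular_module R) p)" by (rule D[OF p(1)])
    define N' where "N' = {x \<in> carrier M. \<forall>a\<in>p. a \<odot>\<^bsub>M\<^esub> x \<in> N}"
    have N's: "submodule N' R M" unfolding N'_def
      by (rule annihilated_part_submodule[OF M.module_axioms Ns(1) p.ideal_axioms])
    have N'un: "unmixed R M N'" unfolding N'_def
      by (rule annihilated_part_unmixed[OF M.module_axioms Ns(1) p.ideal_axioms Ns(2)])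
    have NN': "N \<subseteq> N'" unfolding N'_def using M.submoduleE(1,4)[OF Ns(1)] p.a_Hcarr by blast
    have "y \<in> N'" unfolding N'_def using y unfolding colon_def by blast
    have "y \<notin> N"
    proof
      assume "y \<in> N"
      then have "\<one> \<in> colon R M N y" using y(1) by (simp add: colon_def)
      then show False using y(2) p.complement_multiplicative(1) by blast
    qed
    define X' where "X' = M\<lparr>carrier := N'\<rparr>"
    have X': "max_cohen_macaulay R X'" unfolding X'_def by (rule mcm_submodule[OF M N's])
    interpret X': module R X' by (rule mcm_module[OF X'])
    have NX: "submodule N R X'" unfolding X'_def by (rule M.submodule_in_submodule[OF N's Ns(1) NN'])
    have unX: "unmixed R X' N"
      using Ns(2) M.submodule_subset[OF N's] unfolding unmixed_def X'_def colon_def by auto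
    define Q where "Q = quotient_module X' N"
    note q = X'.quotient_module_hom[OF NX, folded Q_def]
    have Q: "max_cohen_macaulay R Q" unfolding Q_def by (rule mcm_quotient[OF mcm_fin_gen[OF X'] NX unX])
    have "a \<odot>\<^bsub>Q\<^esub> v = \<zero>\<^bsub>Q\<^esub>" if a: "a \<in> p" and v: "v \<in> carrier Q" for a v
    proof -
      have ac: "a \<in> carrier R" using a by (rule p.a_Hcarr)
      obtain w where w: "w \<in> carrier X'" "v = residue_class X' N w" using v q(3) by blast
      have "a \<odot>\<^bsub>X'\<^esub> w \<in> N" using w(1) a by (simp add: X'_def N'_def)
      then show ?thesis using q(4)[of "a \<odot>\<^bsub>X'\<^esub> w"] module_homD(3)[OF q(2) ac w(1)] w ac by simp
    qed
    then have "has_copy_in R S Q" by (rule killed_module_has_copy_in[OF S p(1) Dp Q])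
    moreover have "has_copy_in R S (X'\<lparr>carrier := N\<rparr>)" using Ns(3) by (simp add: X'_def)
    ultimately have "has_copy_in R S X'"
      using serre_submodule_quotient[OF S X' NX unX] unfolding Q_def by blast
    then have "N' \<in> F" unfolding F_def X'_def using N's N'un by blast
    then show False using N(2) NN' \<open>y \<in> N'\<close> \<open>y \<notin> N\<close> by blast
  qed
  then have "N = carrier M" using M.submodule_subset[OF Ns(1)] by blast
  then show ?thesis using Ns(3) by simp
qed

lemma serre_subcategory_mem_iff:
  assumes S: "serre_subcategory R (cm R) S"
  shows "M \<in> S \<longleftrightarrow> M \<in> cm R \<and> (\<forall>p\<in>minimal_primes R. supports R M p \<longrightarrow>
    has_copy_in R S (quotient_module (regular_module R) p))"
proof -
  have "has_copy_in R S M \<longleftrightarrow> M \<in> S" if "module R M"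
  proof (rule has_copy_in_iff[OF S that that])
    have "(\<lambda>x. x) \<in> module_hom R M M" by (rule module_homI) auto
    then show "module_isomorphic R M M" by (rule module_isomorphicI) auto
  qed
  then have "has_copy_in R S M \<longleftrightarrow> M \<in> S" if "max_cohen_macaulay R M" using mcm_module[OF that] by blast
  then show ?thesis
    using serreD(1)[OF S] residue_ring_has_copy_in_of_supports[OF S] has_copy_in_of_residue_rings[OF S]
    unfolding cm_def by blast
qed

section \<open>The Serre subcategory of a set of minimal primes\<close>

definition supported_on :: "'a set set \<Rightarrow> ('a, 'a list set) module set"
  where "supported_on W = {M \<in> cm R. \<forall>p\<in>minimal_primes R. supports R M p \<longrightarrow> p \<in> W}"

lemma supports_iso:
  assumes "module R M" "module R N" "module_isomorphic R M N" "supports R N p"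
  shows "supports R M p"
proof -
  obtain h where "h \<in> module_hom R N M" "bij_betw h (carrier N) (carrier M)"
    using module_isomorphic_sym[OF assms(1,3)] unfolding module_isomorphic_def by blast
  then show ?thesis using supports_inj_hom[OF assms(2,1) _ _ assms(4)] by (simp add: bij_betw_def)
qed

lemma supported_on_serre: "serre_subcategory R (cm R) (supported_on W)"
proof -
  have sub: "supported_on W \<subseteq> cm R" unfolding supported_on_def by blast
  have mod: "module R M" if "M \<in> cm R" for M :: "('a, 'a list set) module"
    using that mcm_module unfolding cm_def by blast
  have iso: "N \<in> supported_on W"
    if M: "M \<in> supported_on W" and N: "module R N" "module_isomorphic R M N" for M N
  proof -
    have Mcm: "M \<in> cm R" using M sub by blast
    then have "max_cohen_macaulay R N" using mcm_iso[OF N(1) _ N(2)] by (simp add: cm_def)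
    moreover have "p \<in> W" if "p \<in> minimal_primes R" "supports R N p" for p
      using supports_iso[OF mod[OF Mcm] N that(2)] that(1) M unfolding supported_on_def by blast
    ultimately show ?thesis unfolding supported_on_def cm_def by blast
  qed
  have zero: "Z \<in> supported_on W" if Z: "module R Z" "carrier Z = {\<zero>\<^bsub>Z\<^esub>}" for Z
  proof -
    interpret Z: module R Z by fact
    have "\<not> supports R Z p" if "p \<in> minimal_primes R" for p
    proof -
      interpret p: primeideal p R by (rule minimal_primesD[OF that])
      have "\<one> \<in> annihilator R Z \<zero>\<^bsub>Z\<^esub>" by (simp add: annihilator_def)
      then have "\<not> annihilator R Z \<zero>\<^bsub>Z\<^esub> \<subseteq> p" using p.complement_multiplicative(1) by blast
      then show ?thesis unfolding supports_def Z(2) by simp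
    qed
    then show ?thesis unfolding supported_on_def cm_def using zero_module_mcm[OF Z] by blast
  qed
  have sum: "L \<in> supported_on W"
    if M: "M \<in> supported_on W" and N: "N \<in> supported_on W" and L: "module R L" "module_isomorphic R (direct_sum M N) L"
    for M N L
  proof -
    have Mm: "module R M" "module R N" using M N sub mod by blast+
    have MN: "max_cohen_macaulay R (direct_sum M N)"
      using direct_sum_mcm M N sub unfolding cm_def by blast
    have "max_cohen_macaulay R L" by (rule mcm_iso[OF L(1) MN L(2)])
    moreover have "p \<in> W" if p: "p \<in> minimal_primes R" "supports R L p" for p
    proof -
      have "supports R (direct_sum M N) p" by (rule supports_iso[OF mcm_module[OF MN] L p(2)])
      then have "supports R M p \<or> supports R N p"
        using supports_extension_iff[OF Mm(1) mcm_module[OF MN] Mm(2) direct_sum_short_exact[OF Mm]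
            minimal_primesD[OF p(1)]] by blast
      then show ?thesis using M N p(1) unfolding supported_on_def by blast
    qed
    ultimately show ?thesis unfolding supported_on_def cm_def by blast
  qed
  have ext: "B \<in> supported_on W \<longleftrightarrow> A \<in> supported_on W \<and> C \<in> supported_on W"
    if "conflation R (cm R) A B C f g" for A B C f g
  proof -
    have ABC: "A \<in> cm R" "B \<in> cm R" "C \<in> cm R" "short_exact R A B C f g"
      using that unfolding conflation_iff_short_exact by auto
    have "supports R B p \<longleftrightarrow> supports R A p \<or> supports R C p" if "p \<in> minimal_primes R" for p
      by (rule supports_extension_iff[OF mod[OF ABC(1)] mod[OF ABC(2)] mod[OF ABC(3)] ABC(4) minimal_primesD[OF that]])
    then show ?thesis using ABC(1-3) unfolding supported_on_def by blast
  qed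
  have "additive_subcategory R (supported_on W)"
    unfolding additive_subcategory_def
  proof (intro conjI ballI allI impI)
    show "module R M" if "M \<in> supported_on W" for M using that sub mod by blast
  qed (auto intro: iso zero sum)
  then show ?thesis unfolding serre_subcategory_def using sub ext by blast
qed

text \<open>
  The only minimal prime in the support of \<open>R/p\<close> is \<open>p\<close>.
\<close>

lemma residue_ring_in_supported_on_iff:
  assumes p: "p \<in> minimal_primes R"
  shows "has_copy_in R (supported_on W) (quotient_module (regular_module R) p) \<longleftrightarrow> p \<in> W"
proof -
  let ?D = "quotient_module (regular_module R) p"
  note D = residue_ring_mcm[OF p]
  obtain L where L: "L \<in> cm R" "module_isomorphic R ?D L" using mcm_copy[OF D] by blast
  have Lm: "module R L" using L(1) mcm_module unfolding cm_def by blast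
  have suppL: "supports R L q \<longleftrightarrow> q = p" if q: "q \<in> minimal_primes R" for q
  proof -
    have "supports R L q \<longleftrightarrow> supports R ?D q"
      using supports_iso[OF mcm_module[OF D] Lm L(2)]
        supports_iso[OF Lm mcm_module[OF D] module_isomorphic_sym[OF mcm_module[OF D] L(2)]] by blast
    also have "\<dots> \<longleftrightarrow> p \<subseteq> q" by (rule residue_ring_supports_iff[OF minimal_primesD[OF p] minimal_primesD[OF q]])
    finally show ?thesis using subset_minimal_prime[OF p q] by blast
  qed
  have "has_copy_in R (supported_on W) ?D \<longleftrightarrow> L \<in> supported_on W"
    by (rule has_copy_in_iff[OF supported_on_serre mcm_module[OF D] Lm L(2)])
  then show ?thesis using L(1) suppL p unfolding supported_on_def by blast
qed

end

theorem theorem6: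
  fixes R :: "('a, 'r) ring_scheme"
  assumes "cring R"
    and "noetherian_ring R"
    and "krull_dim R = 1"
    and "cohen_macaulay_ring R"
  shows "\<exists>\<phi>. bij_betw \<phi> {S. serre_subcategory R (cm R) S} (Pow (minimal_primes R))"
proof -
  interpret one_dim_cm_ring R
    using assms by (intro one_dim_cm_ring.intro one_dim_cm_ring_axioms.intro)
  define \<phi> where "\<phi> S = {p \<in> minimal_primes R. has_copy_in R S (quotient_module (regular_module R) p)}" for S
  have "bij_betw \<phi> {S. serre_subcategory R (cm R) S} (Pow (minimal_primes R))"
  proof (rule bij_betwI')
    fix S T assume S: "S \<in> {S. serre_subcategory R (cm R) S}" and T: "T \<in> {S. serre_subcategory R (cm R) S}"
    show "\<phi> S = \<phi> T \<longleftrightarrow> S = T"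
    proof
      assume eq: "\<phi> S = \<phi> T"
      have "M \<in> S \<longleftrightarrow> M \<in> T" for M
        using serre_subcategory_mem_iff[of S M] serre_subcategory_mem_iff[of T M] S T eq
        unfolding \<phi>_def by blast
      then show "S = T" by blast
    qed simp
  next
    fix S show "\<phi> S \<in> Pow (minimal_primes R)" unfolding \<phi>_def by blast
  next
    fix W assume W: "W \<in> Pow (minimal_primes R)"
    have "\<phi> (supported_on W) = W"
      unfolding \<phi>_def using residue_ring_in_supported_on_iff[of _ W] W by blast
    then show "\<exists>S\<in>{S. serre_subcategory R (cm R) S}. W = \<phi> S"
      using supported_on_serre[of W] by (intro bexI[of _ "supported_on W"]) auto
  qed
  then show ?thesis by blast
qed

end
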